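(* Let $D\subset\mathbb{R}^2$ be a closed disk of area $1$ (radius $\pi^{-1/2}$), centered at the origin. A curve $\beta\subset D$ satisfies all of the following six conditions: \begin{enumerate} \item[(cong)] $\beta$ splits $D$ into two congruent parts; \item[(conc)] $\beta$ crosses each circle concentric with $D$ (of radius at most $\pi^{-1/2}$) exactly twice; \item[(rad)] $\beta$ crosses each radius of $D$ exactly once, besides at the center of $D$; \item[(perf)] $\beta$ splits $D$ into two perfect sets; \item[(smooth)] $\beta$ has an infinitely differentiable parameterization $[0,1]\to D$ with nowhere vanishing derivative; \item[(alg)] $\beta$ is algebraic in polar coordinates; \end{enumerate} if and only if $\beta$ is congruent to Fermat's spiral given in polar coordinates by $\pi^2r^2=\phi$, $0\le\phi\le\pi$ (equivalently $-\pi^{-1/2}\le r\le\pi^{-1/2}$).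
   Context: A curve is the image of a real segment under an injective continuous map. Let $\mu$ denote Lebesgue measure. Let $\mathrm{Sym}(D)$ be the group of isometries of $\mathbb{R}^2$ mapping $D$ onto itself. A set $X\subseteq D$ is called symmetric if $s(X)=X$ for some non-identity $s\in\mathrm{Sym}(D)$. A measurable set $A\subseteq D$ is called perfect if $\mu(A)=1/2$ and every symmetric subset of $A$ has measure at most $1/4$. Polar coordinates: the map $\Pi$ from the $(\phi,r)$-plane onto the $(x,y)$-plane given by $x=r\cos\phi$, $y=r\sin\phi$, where $\phi$ and $r$ may take any real values. A curve in the $(\phi,r)$-plane is algebraic if all its points satisfy $P(\phi,r)=0$ for some nonzero real bivariate polynomial $P$; a curve in the $(x,y)$-plane is algebraic in polar coordinates if it is the image under $\Pi$ of an algebraic curve in the $(\phi,r)$-plane. *)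

theory Defs
  imports "HOL-Analysis.Analysis" "HOL-Computational_Algebra.Polynomial"
begin

definition is_curve :: "'a::topological_space set \<Rightarrow> bool" where
  "is_curve C \<longleftrightarrow> (\<exists>g. arc g \<and> path_image g = C)"

text \<open>Distance-preserving self-maps of the plane are automatically bijective.\<close>

definition isometry :: "(real^2 \<Rightarrow> real^2) \<Rightarrow> bool" where
  "isometry f \<longleftrightarrow> (\<forall>x y. dist (f x) (f y) = dist x y)"

definition congruent_sets :: "(real^2) set \<Rightarrow> (real^2) set \<Rightarrow> bool" where
  "congruent_sets X Y \<longleftrightarrow> (\<exists>f. isometry f \<and> f ` X = Y)"

definition disk :: "(real^2) set" where
  "disk = cball 0 (1 / sqrt pi)"

definition disk_symmetries :: "(real^2 \<Rightarrow> real^2) set" where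
  "disk_symmetries = {s. isometry s \<and> s ` disk = disk}"

definition symmetric_subset :: "(real^2) set \<Rightarrow> bool" where
  "symmetric_subset X \<longleftrightarrow> X \<subseteq> disk \<and> (\<exists>s\<in>disk_symmetries. s \<noteq> id \<and> s ` X = X)"

text \<open>Non-measurable symmetric subsets need not be considered: if \<open>s ` X = X\<close>, then \<open>X\<close> lies in the
  intersection of the images of \<open>A\<close> under the integer powers of \<open>s\<close>, which is a measurable subset
  of \<open>A\<close> invariant under \<open>s\<close>.\<close>

definition perfect :: "(real^2) set \<Rightarrow> bool" where
  "perfect A \<longleftrightarrow>
     A \<subseteq> disk \<and> A \<in> sets lebesgue \<and> measure lebesgue A = 1/2 \<and>
     (\<forall>X. X \<subseteq> A \<and> X \<in> sets lebesgue \<and> symmetric_subset X \<longrightarrow> measure lebesgue X \<le> 1/4)"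

text \<open>The two parts are the connected components of the complement of \<open>\<beta>\<close> in the disk, so \<open>\<beta>\<close>
  belongs to neither of them.\<close>

definition splits_disk_into :: "(real^2) set \<Rightarrow> (real^2) set \<Rightarrow> (real^2) set \<Rightarrow> bool" where
  "splits_disk_into \<beta> A B \<longleftrightarrow> A \<noteq> B \<and> components (disk - \<beta>) = {A, B}"

definition splits_congruent :: "(real^2) set \<Rightarrow> bool" where
  "splits_congruent \<beta> \<longleftrightarrow> (\<exists>A B. splits_disk_into \<beta> A B \<and> congruent_sets A B)"

definition crosses_circles_twice :: "(real^2) set \<Rightarrow> bool" where
  "crosses_circles_twice \<beta> \<longleftrightarrow>
     (\<forall>\<rho>. 0 < \<rho> \<and> \<rho> \<le> 1 / sqrt pi \<longrightarrow> card (\<beta> \<inter> sphere 0 \<rho>) = 2)"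

definition crosses_radii_once :: "(real^2) set \<Rightarrow> bool" where
  "crosses_radii_once \<beta> \<longleftrightarrow>
     (\<forall>u\<in>sphere 0 (1 / sqrt pi). card (\<beta> \<inter> closed_segment 0 u - {0}) = 1)"

definition splits_perfect :: "(real^2) set \<Rightarrow> bool" where
  "splits_perfect \<beta> \<longleftrightarrow> (\<exists>A B. splits_disk_into \<beta> A B \<and> perfect A \<and> perfect B)"

text \<open>\<open>F k\<close> is the \<open>k\<close>-th derivative of \<open>f\<close> on \<open>S\<close>, one-sided at the end points of an interval.\<close>

definition infinitely_differentiable_on ::
    "(real \<Rightarrow> 'a::real_normed_vector) \<Rightarrow> real set \<Rightarrow> bool" where
  "infinitely_differentiable_on f S \<longleftrightarrow>
     (\<exists>F. F 0 = f \<and>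
        (\<forall>k::nat. \<forall>t\<in>S. (F k has_vector_derivative F (Suc k) t) (at t within S)))"

definition smooth_curve :: "(real^2) set \<Rightarrow> bool" where
  "smooth_curve \<beta> \<longleftrightarrow>
     (\<exists>\<gamma>. arc \<gamma> \<and> path_image \<gamma> = \<beta> \<and> infinitely_differentiable_on \<gamma> {0..1} \<and>
        (\<forall>t\<in>{0..1}. vector_derivative \<gamma> (at t within {0..1}) \<noteq> 0))"

text \<open>The pair is \<open>(\<phi>, r)\<close>; \<open>r\<close> may be negative and \<open>\<phi>\<close> is an arbitrary real.\<close>

definition polar :: "real \<times> real \<Rightarrow> real^2" where
  "polar = (\<lambda>(\<phi>, r). vector [r * cos \<phi>, r * sin \<phi>])"

text \<open>A bivariate polynomial in \<open>(\<phi>, r)\<close> is a polynomial in \<open>\<phi>\<close> (the outer variable) whose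
  coefficients are polynomials in \<open>r\<close>.\<close>

definition poly2 :: "real poly poly \<Rightarrow> real \<Rightarrow> real \<Rightarrow> real" where
  "poly2 P \<phi> r = poly (poly P [:\<phi>:]) r"

definition algebraic_curve :: "(real \<times> real) set \<Rightarrow> bool" where
  "algebraic_curve C \<longleftrightarrow>
     is_curve C \<and> (\<exists>P. P \<noteq> 0 \<and> (\<forall>(\<phi>, r)\<in>C. poly2 P \<phi> r = 0))"

definition algebraic_in_polar :: "(real^2) set \<Rightarrow> bool" where
  "algebraic_in_polar \<beta> \<longleftrightarrow> (\<exists>C. algebraic_curve C \<and> \<beta> = polar ` C)"

definition fermat_spiral :: "(real^2) set" where
  "fermat_spiral = polar ` {(\<phi>, r). pi\<^sup>2 * r\<^sup>2 = \<phi> \<and> 0 \<le> \<phi> \<and> \<phi> \<le> pi}"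

end

theory Submission imports Defs begin

text \<open>Let \<open>R\<close> be the radius of the disk. Conditions (conc) and (rad), together with the tangent at
  the centre, force the curve to consist of two branches \<open>\<rho> \<mapsto> (p \<rho>, \<rho>)\<close> and \<open>\<rho> \<mapsto> (q \<rho>, \<rho>)\<close> in
  polar coordinates, with \<open>p\<close> and \<open>q\<close> increasing (after a rotation or reflection) from \<open>0\<close> to \<open>\<pi>\<close>
  and from \<open>\<pi>\<close> to \<open>2\<pi>\<close>; comparing the lengths of the arcs that the two congruent parts cut out of
  each circle gives \<open>q = p + \<pi>\<close>.

  Put \<open>z = \<pi>\<^sup>2 r\<^sup>2\<close> and let \<open>s\<close> be the reflection \<open>\<theta> \<mapsto> \<psi> - \<theta>\<close>. The area of \<open>A \<inter> s A\<close> is a constant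
  multiple of the integral \<open>M \<psi>\<close> of \<open>arccos (cos (\<psi> - 2 p))\<close> over \<open>0 \<le> z \<le> \<pi>\<close>. Since
  \<open>M \<psi> + M (\<psi> + \<pi>)\<close> does not depend on \<open>\<psi>\<close>, perfectness makes \<open>M\<close> constant, and differentiating
  in \<open>\<psi>\<close> shows that the curve in the \<open>(\<theta>, z)\<close>-plane is mapped to itself by the translation
  by \<open>(\<pi>/2, \<pi>/2)\<close>. For the spiral \<open>M\<close> is constant because it integrates over a full period.

  Finally \<open>u = z + \<theta>\<close> is a regular parameter and \<open>w = z - \<theta>\<close> is locally a \<open>\<pi>\<close>-periodic function
  of \<open>u\<close>. Choose a nonzero polynomial of minimal degree in \<open>w\<close> that vanishes on a piece of the curve.
  Smoothness lets it vanish along the whole arc: a polynomial expression in \<open>u\<close> and \<open>w\<close> with a zero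
  of infinite order would violate a Bezout identity. Minimality then makes the ratios
  of its coefficients periodic rational functions of \<open>u\<close>, hence constants, so \<open>w\<close> takes finitely many
  values and is constant. This gives \<open>\<pi>\<^sup>2 r\<^sup>2 = \<theta>\<close>.\<close>

section \<open>Polar coordinates and isometries of the plane\<close>

text \<open>Three obstacles shape the proof. The congruence of the two parts, the symmetries of the
  disk and the congruence with the spiral are not known to fix the centre; each time two antipodal
  boundary points, whose distance is the diameter, pin it down. At the centre the polar angle is
  undefined, and a curve could a priori wind around it infinitely often. Dividing the curve by
  \<open>t - t0\<close>, where \<open>t0\<close> is the time of passage, gives by regularity a
  continuous nowhere vanishing vector, so an angle can be chosen continuously through the centre, at
  the price of an extra pi on the half where the divisor is negative. Finally, the curve is only
  infinitely differentiable, not analytic: it might switch between branches of its polynomial, and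
  the translation property holds only where a point and its translate both lie on the arc. Hence the
  coordinates \<open>u\<close> and \<open>w\<close>: the translation becomes a shift of
  \<open>u\<close> by pi that fixes \<open>w\<close>, so a polynomial in \<open>w\<close> with
  coefficients in \<open>u\<close> can be compared with its own shift, and minimality of the degree
  does the work of analytic continuation.\<close>

abbreviation R :: real where "R \<equiv> 1 / sqrt pi"

lemma R_pos: "R > 0" by simp

lemma R_square: "R\<^sup>2 = 1 / pi" by (simp add: power_divide)

lemma polar_nth [simp]: "polar (\<phi>, r) $ 1 = r * cos \<phi>" "polar (\<phi>, r) $ 2 = r * sin \<phi>"
  by (simp_all add: polar_def)

lemma vec2_eq_iff: "(x::real^2) = y \<longleftrightarrow> x $ 1 = y $ 1 \<and> x $ 2 = y $ 2"
  by (simp add: vec_eq_iff forall_2)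

lemma norm_vec2: "norm (x::real^2) = sqrt ((x $ 1)\<^sup>2 + (x $ 2)\<^sup>2)"
  by (simp add: norm_vec_def L2_set_def sum_2)

lemma norm_polar [simp]: "norm (polar (\<phi>, r)) = \<bar>r\<bar>"
proof -
  have "(r * cos \<phi>)\<^sup>2 + (r * sin \<phi>)\<^sup>2 = r\<^sup>2 * ((cos \<phi>)\<^sup>2 + (sin \<phi>)\<^sup>2)"
    by (simp only: power_mult_distrib distrib_left)
  then show ?thesis by (simp add: norm_vec2)
qed

lemma polar_0 [simp]: "polar (\<phi>, 0) = 0"
  by (simp add: vec2_eq_iff)

lemma polar_minus: "polar (\<phi>, - r) = - polar (\<phi>, r)"
  by (simp add: vec2_eq_iff)

lemma polar_plus_pi: "polar (\<phi> + pi, r) = - polar (\<phi>, r)"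
  by (simp add: vec2_eq_iff)

lemma polar_scaleR: "polar (\<phi>, c * r) = c *\<^sub>R polar (\<phi>, r)"
  by (simp add: vec2_eq_iff mult.assoc)

lemma polar_eq_iff:
  assumes "r > 0"
  shows "polar (a, r) = polar (b, r) \<longleftrightarrow> (\<exists>k::int. a = b + 2 * pi * k)"
proof -
  have "polar (a, r) = polar (b, r) \<longleftrightarrow> sin a = sin b \<and> cos a = cos b"
    using assms by (auto simp: vec2_eq_iff)
  also have "\<dots> \<longleftrightarrow> (\<exists>k::int. a = b + 2 * pi * k)" by (simp add: sin_cos_eq_iff mult_ac)
  finally show ?thesis .
qed

lemma polar_eq_pos_iff:
  assumes "r > 0" "s > 0"
  shows "polar (a, r) = polar (b, s) \<longleftrightarrow> r = s \<and> (\<exists>k::int. a = b + 2 * pi * k)"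
proof
  assume *: "polar (a, r) = polar (b, s)"
  then have "\<bar>r\<bar> = \<bar>s\<bar>" by (metis norm_polar)
  then show "r = s \<and> (\<exists>k::int. a = b + 2 * pi * k)" using * assms polar_eq_iff by auto
qed (use assms polar_eq_iff in auto)

lemma polar_exists_from: "\<exists>\<theta>. c \<le> \<theta> \<and> \<theta> < c + 2 * pi \<and> x = polar (\<theta>, norm x)"
proof -
  obtain t where t: "x = polar (t, norm x)"
  proof (cases "x = 0")
    case False
    then have "(x $ 1 / norm x)\<^sup>2 + (x $ 2 / norm x)\<^sup>2 = 1"
      by (simp add: power_divide norm_vec2[of x] vec2_eq_iff sum_power2_eq_zero_iff flip: add_divide_distrib)
    then obtain t where "x $ 1 / norm x = cos t" "x $ 2 / norm x = sin t"
      using sincos_total_2pi by metis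
    then have "x $ 1 = norm x * cos t" "x $ 2 = norm x * sin t" using False by (simp_all add: field_simps)
    then have "x = polar (t, norm x)" unfolding vec2_eq_iff polar_nth by blast
    then show ?thesis by (rule that)
  qed (use that in simp)
  define k where "k = \<lfloor>(t - c) / (2 * pi)\<rfloor>"
  have k: "real_of_int k \<le> (t - c) / (2 * pi)" "(t - c) / (2 * pi) < real_of_int k + 1"
    unfolding k_def by linarith+
  have "polar (t - 2 * pi * k, norm x) = polar (t, norm x)"
    by (cases "x = 0") (auto simp: polar_eq_iff intro: exI[of _ "- k"])
  moreover have "c \<le> t - 2 * pi * k" "t - 2 * pi * k < c + 2 * pi"
    using k by (simp_all add: field_simps)
  ultimately show ?thesis using t by (intro exI[of _ "t - 2 * pi * k"]) simp
qed

lemma polar_exists: obtains \<theta> where "x = polar (\<theta>, norm x)"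
  using polar_exists_from by blast

lemma continuous_on_polar [continuous_intros]:
  fixes S :: "'a::t2_space set"
  assumes "continuous_on S f" "continuous_on S g"
  shows "continuous_on S (\<lambda>x. polar (f x, g x))"
proof -
  have *: "polar (f x, g x) = (g x * cos (f x)) *\<^sub>R axis 1 1 + (g x * sin (f x)) *\<^sub>R axis 2 1" for x
    by (simp add: vec2_eq_iff axis_def)
  show ?thesis
    unfolding * by (intro continuous_on_add continuous_on_scaleR continuous_on_mult continuous_on_cos
        continuous_on_sin assms continuous_on_const)
qed

section \<open>Isometries and the centre of the disk\<close>

lemma isometry_orthogonal: "isometry f \<Longrightarrow> f 0 = 0 \<Longrightarrow> orthogonal_transformation f"
  by (simp add: isometry_def orthogonal_transformation_isometry)

lemma orthogonal_isometry: "orthogonal_transformation f \<Longrightarrow> isometry f"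
  by (simp add: isometry_def orthogonal_transformation_isometry)

lemma isometry_continuous: "isometry f \<Longrightarrow> continuous_on S f"
  by (intro lipschitz_on_continuous_on[of 1] lipschitz_onI) (auto simp: isometry_def)

lemma parallelogram:
  fixes x y :: "'a::real_inner"
  shows "(norm (x + y))\<^sup>2 + (norm (x - y))\<^sup>2 = 2 * (norm x)\<^sup>2 + 2 * (norm y)\<^sup>2"
  by (simp add: power2_norm_eq_inner inner_add_left inner_add_right inner_diff_left inner_diff_right inner_commute)

text \<open>The equality case of the triangle inequality, through the parallelogram law: it leaves
  \<open>norm (x + y)\<close> no room but to vanish.\<close>

lemma diametral_points:
  fixes x y :: "'a::real_inner"
  assumes "norm x \<le> r" "norm y \<le> r" "norm (x - y) = 2 * r"
  shows "y = - x" "norm x = r"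
proof -
  have r: "r \<ge> 0" using assms(1) norm_ge_zero order_trans by blast
  have par: "(norm (x + y))\<^sup>2 + (norm (x - y))\<^sup>2 = 2 * (norm x)\<^sup>2 + 2 * (norm y)\<^sup>2"
    by (rule parallelogram)
  have xy: "(norm x)\<^sup>2 \<le> r\<^sup>2" "(norm y)\<^sup>2 \<le> r\<^sup>2" using assms by (simp_all add: power_mono)
  have "(2 * r)\<^sup>2 = 4 * r\<^sup>2" by (simp add: power_mult_distrib)
  then have eq: "(norm (x + y))\<^sup>2 + 4 * r\<^sup>2 = 2 * (norm x)\<^sup>2 + 2 * (norm y)\<^sup>2" using par assms(3) by simp
  then have "(norm (x + y))\<^sup>2 \<le> 0" using xy by argo
  then show "y = - x" by (simp add: eq_neg_iff_add_eq_0 add.commute)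
  have "(norm (x + y))\<^sup>2 \<ge> 0" by simp
  then have "(norm x)\<^sup>2 \<ge> r\<^sup>2" using eq xy by argo
  then show "norm x = r" using assms(1) r by (metis norm_ge_zero order_antisym power2_le_imp_le)
qed

text \<open>The points \<open>f p\<close> and \<open>f (- p)\<close> lie in the ball at distance
  \<open>2 * r\<close>, so they are antipodal. Since \<open>f 0\<close> is at distance
  \<open>r\<close> from both, the parallelogram law for \<open>f 0\<close> and \<open>f p\<close>
  leaves only \<open>f 0 = 0\<close>.\<close>

lemma isometry_fixes_origin:
  assumes f: "isometry f" and p: "norm p = r" and "norm (f p) \<le> r" "norm (f (- p)) \<le> r"
  shows "f 0 = 0"
proof -
  have d: "norm (f x - f y) = norm (x - y)" for x y
    using f unfolding isometry_def dist_norm by blast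
  have "norm (f p - f (- p)) = norm (2 *\<^sub>R p)" unfolding d by (simp add: scaleR_2)
  then have fp: "f (- p) = - f p" "norm (f p) = r"
    using diametral_points[OF assms(3,4)] p by simp_all
  have "(norm (f 0 + f p))\<^sup>2 + (norm (f 0 - f p))\<^sup>2 = 2 * (norm (f 0))\<^sup>2 + 2 * (norm (f p))\<^sup>2"
    by (rule parallelogram)
  moreover have "norm (f 0 + f p) = r" "norm (f 0 - f p) = r" using d[of 0 "- p"] d[of 0 p] p fp by simp_all
  ultimately have "2 * (norm (f 0))\<^sup>2 = 0" using fp(2) by simp
  then show ?thesis by simp
qed

lemma isometry_polar:
  assumes "isometry f" "f 0 = 0"
  shows "\<exists>\<alpha> \<sigma>. (\<sigma> = 1 \<or> \<sigma> = -1) \<and> (\<forall>\<theta> r. f (polar (\<theta>, r)) = polar (\<alpha> + \<sigma> * \<theta>, r))"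
proof -
  have o: "orthogonal_transformation f" using assms isometry_orthogonal by blast
  then have lin: "linear f" and inner: "\<And>v w. f v \<bullet> f w = v \<bullet> w"
    by (auto simp: orthogonal_transformation_def)
  define p q where "p = f (axis 1 1)" and "q = f (axis 2 1)"
  have i2: "v \<bullet> w = v $ 1 * w $ 1 + v $ 2 * w $ 2" for v w :: "real^2"
    by (simp add: inner_vec_def sum_2)
  have "p \<bullet> p = 1" "q \<bullet> q = 1" "p \<bullet> q = 0"
    unfolding p_def q_def inner by (simp_all add: i2 axis_def)
  then have pq: "(p $ 1)\<^sup>2 + (p $ 2)\<^sup>2 = 1" "(q $ 1)\<^sup>2 + (q $ 2)\<^sup>2 = 1" "p $ 1 * q $ 1 + p $ 2 * q $ 2 = 0"
    by (auto simp: i2 power2_eq_square)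
  obtain \<alpha> where \<alpha>: "p $ 1 = cos \<alpha>" "p $ 2 = sin \<alpha>" using sincos_total_2pi[OF pq(1)] by metis
  \<comment> \<open>\<open>\<sigma>\<close> is the determinant of \<open>f\<close>; orthogonality
    makes \<open>q\<close> equal to \<open>\<sigma>\<close> times the quarter turn of
    \<open>p\<close>.\<close>
  define \<sigma> where "\<sigma> = q $ 2 * cos \<alpha> - q $ 1 * sin \<alpha>"
  have z: "cos \<alpha> * q $ 1 + sin \<alpha> * q $ 2 = 0" using pq(3) \<alpha> by simp
  have "q $ 1 * ((cos \<alpha>)\<^sup>2 + (sin \<alpha>)\<^sup>2) = - \<sigma> * sin \<alpha> + cos \<alpha> * (cos \<alpha> * q $ 1 + sin \<alpha> * q $ 2)"
    unfolding \<sigma>_def by algebra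
  then have q1: "q $ 1 = - \<sigma> * sin \<alpha>" using z by simp
  have "q $ 2 * ((cos \<alpha>)\<^sup>2 + (sin \<alpha>)\<^sup>2) = \<sigma> * cos \<alpha> + sin \<alpha> * (cos \<alpha> * q $ 1 + sin \<alpha> * q $ 2)"
    unfolding \<sigma>_def by algebra
  then have q2: "q $ 2 = \<sigma> * cos \<alpha>" using z by simp
  have "\<sigma>\<^sup>2 * ((sin \<alpha>)\<^sup>2 + (cos \<alpha>)\<^sup>2) = 1"
    using pq(2) unfolding q1 q2 by (simp only: power_mult_distrib distrib_left power2_minus)
  then have \<sigma>: "\<sigma> = 1 \<or> \<sigma> = -1" by (simp add: power2_eq_1_iff)
  have "f (polar (\<theta>, r)) = polar (\<alpha> + \<sigma> * \<theta>, r)" for \<theta> r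
  proof -
    have "polar (\<theta>, r) = (r * cos \<theta>) *\<^sub>R axis 1 1 + (r * sin \<theta>) *\<^sub>R axis 2 1"
      by (simp add: vec2_eq_iff axis_def)
    then have "f (polar (\<theta>, r)) = (r * cos \<theta>) *\<^sub>R p + (r * sin \<theta>) *\<^sub>R q"
      by (simp add: linear_add[OF lin] linear_scale[OF lin] p_def q_def)
    also have "\<dots> = polar (\<alpha> + \<sigma> * \<theta>, r)"
      using \<sigma> by (auto simp: vec2_eq_iff \<alpha> q1 q2 cos_add sin_add cos_diff sin_diff algebra_simps)
    finally show ?thesis .
  qed
  then show ?thesis using \<sigma> by blast
qed

lemma polar_map_isometry:
  assumes "\<sigma> = 1 \<or> \<sigma> = -1"
  shows "\<exists>f. isometry f \<and> f 0 = 0 \<and> (\<forall>\<theta> r. f (polar (\<theta>, r)) = polar (\<alpha> + \<sigma> * \<theta>, r))"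
proof -
  define f :: "real^2 \<Rightarrow> real^2" where
    "f x = vector [cos \<alpha> * x $ 1 - \<sigma> * sin \<alpha> * x $ 2, sin \<alpha> * x $ 1 + \<sigma> * cos \<alpha> * x $ 2]" for x
  have f: "f x $ 1 = cos \<alpha> * x $ 1 - \<sigma> * sin \<alpha> * x $ 2"
    "f x $ 2 = sin \<alpha> * x $ 1 + \<sigma> * cos \<alpha> * x $ 2" for x by (simp_all add: f_def)
  have "norm (f x - f y) = norm (x - y)" for x y
  proof -
    have s2: "\<sigma>\<^sup>2 = 1" using assms by auto
    have "(f x $ 1 - f y $ 1)\<^sup>2 + (f x $ 2 - f y $ 2)\<^sup>2 =
        ((sin \<alpha>)\<^sup>2 + (cos \<alpha>)\<^sup>2) * ((x $ 1 - y $ 1)\<^sup>2 + \<sigma>\<^sup>2 * (x $ 2 - y $ 2)\<^sup>2)"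
      unfolding f by algebra
    then show ?thesis by (simp add: norm_vec2 s2)
  qed
  then have "isometry f" by (simp add: isometry_def dist_norm)
  moreover have "f 0 = 0" by (simp add: vec2_eq_iff f)
  moreover have "f (polar (\<theta>, r)) = polar (\<alpha> + \<sigma> * \<theta>, r)" for \<theta> r
    using assms by (auto simp: vec2_eq_iff f cos_add sin_add cos_diff sin_diff algebra_simps)
  ultimately show ?thesis by blast
qed

lemma isometry_inverse:
  assumes "isometry f" "f 0 = 0"
  shows "\<exists>g. isometry g \<and> g 0 = 0 \<and> (\<forall>x. g (f x) = x) \<and> (\<forall>x. f (g x) = x)"
proof -
  have o: "orthogonal_transformation f" using assms isometry_orthogonal by blast
  then have b: "bij f" by (rule orthogonal_transformation_bij)
  have "isometry (inv f)" using orthogonal_transformation_inv[OF o] orthogonal_isometry by blast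
  moreover have "inv f (f x) = x" "f (inv f x) = x" for x
    using b by (auto simp: bij_is_inj bij_is_surj surj_f_inv_f)
  moreover have "inv f 0 = 0" using assms b by (metis calculation(2))
  ultimately show ?thesis by blast
qed

lemma isometry_norm: "isometry f \<Longrightarrow> f 0 = 0 \<Longrightarrow> norm (f x) = norm x"
  using isometry_orthogonal orthogonal_transformation_norm by blast

lemma isometry_image_cball:
  assumes "isometry f" "f 0 = 0" shows "f ` cball 0 r = cball 0 r" "f ` sphere 0 r = sphere 0 r"
proof -
  obtain g where g: "isometry g" "g 0 = 0" "\<And>x. g (f x) = x" "\<And>x. f (g x) = x"
    using isometry_inverse[OF assms] by blast
  show "f ` cball 0 r = cball 0 r"
    using isometry_norm[OF assms] isometry_norm[OF g(1,2)] g(4)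
    by (auto simp: image_iff) (metis mem_cball_0)
  show "f ` sphere 0 r = sphere 0 r"
    using isometry_norm[OF assms] isometry_norm[OF g(1,2)] g(4)
    by (auto simp: image_iff) (metis mem_sphere_0)
qed

lemma disk_symmetry_fixes_origin: "s \<in> disk_symmetries \<Longrightarrow> isometry s \<and> s 0 = 0"
proof -
  assume s: "s \<in> disk_symmetries"
  then have i: "isometry s" "s ` disk = disk" by (auto simp: disk_symmetries_def)
  have "polar (0, R) \<in> disk" "- polar (0, R) \<in> disk" by (auto simp: disk_def)
  then have "s (polar (0, R)) \<in> disk" "s (- polar (0, R)) \<in> disk" using i(2) by blast+
  then show ?thesis using isometry_fixes_origin[OF i(1), of "polar (0, R)" R] i(1) by (simp add: disk_def)
qed

section \<open>Invariance under isometries fixing the origin\<close>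

text \<open>Connected sets through a point travel forward along \<open>f\<close> and back along
  \<open>g\<close>, so the components correspond.\<close>

lemma components_homeomorphic_image:
  fixes f :: "'a::topological_space \<Rightarrow> 'b::topological_space"
  assumes f: "continuous_on S f" and g: "continuous_on (f ` S) g" "\<And>x. x \<in> S \<Longrightarrow> g (f x) = x"
  shows "components (f ` S) = (`) f ` components S"
proof -
  have "connected_component_set (f ` S) (f x) = f ` connected_component_set S x" if x: "x \<in> S" for x
  proof (intro set_eqI iffI)
    fix y assume "y \<in> connected_component_set (f ` S) (f x)"
    then obtain T where T: "connected T" "T \<subseteq> f ` S" "f x \<in> T" "y \<in> T"
      by (auto simp: connected_component_def)
    have "connected (g ` T)"
      using T g continuous_on_subset connected_continuous_image by metis
    moreover have "g ` T \<subseteq> S" "x \<in> g ` T" "g y \<in> g ` T" "y = f (g y)"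
      using T g(2) x by (force simp: image_iff)+
    ultimately show "y \<in> f ` connected_component_set S x"
      by (auto simp: connected_component_def image_iff intro!: exI[of _ "g y"])
  next
    fix y assume "y \<in> f ` connected_component_set S x"
    then obtain T z where T: "connected T" "T \<subseteq> S" "x \<in> T" "z \<in> T" "y = f z"
      by (auto simp: connected_component_def)
    then have "connected (f ` T)"
      using f continuous_on_subset connected_continuous_image by metis
    then show "y \<in> connected_component_set (f ` S) (f x)"
      using T by (auto simp: connected_component_def intro!: exI[of _ "f ` T"])
  qed
  then show ?thesis unfolding components_def by (force simp: image_iff)
qed

lemma lmeasurable_subset_disk: "A \<subseteq> disk \<Longrightarrow> A \<in> sets lebesgue \<Longrightarrow> A \<in> lmeasurable"
  by (metis bounded_cball bounded_set_imp_lmeasurable bounded_subset disk_def)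

context
  fixes f :: "real^2 \<Rightarrow> real^2"
  assumes f: "isometry f" "f 0 = 0"
begin

lemma isometry_inj: "inj f"
proof -
  obtain g where "\<And>x. g (f x) = x" using isometry_inverse[OF f] by blast
  then show ?thesis by (metis injI)
qed

lemma isometry_image_disk: "f ` disk = disk"
  unfolding disk_def by (rule isometry_image_cball[OF f])

lemma splits_disk_into_image:
  assumes "splits_disk_into \<beta> A B"
  shows "splits_disk_into (f ` \<beta>) (f ` A) (f ` B)"
proof -
  obtain g where g: "isometry g" "g 0 = 0" "\<And>x. g (f x) = x" "\<And>x. f (g x) = x"
    using isometry_inverse[OF f] by blast
  have "disk - f ` \<beta> = f ` (disk - \<beta>)"
    using isometry_image_disk isometry_inj by (metis image_set_diff)
  moreover have "components (f ` (disk - \<beta>)) = (`) f ` components (disk - \<beta>)"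
    by (rule components_homeomorphic_image[where g = g]) (auto simp: f g isometry_continuous)
  ultimately show ?thesis using assms isometry_inj
    by (auto simp: splits_disk_into_def inj_image_eq_iff)
qed

lemma splits_congruent_image:
  assumes "splits_congruent \<beta>" shows "splits_congruent (f ` \<beta>)"
proof -
  obtain A B h where *: "splits_disk_into \<beta> A B" "isometry h" "h ` A = B"
    using assms by (auto simp: splits_congruent_def congruent_sets_def)
  obtain g where g: "isometry g" "g 0 = 0" "\<And>x. g (f x) = x" "\<And>x. f (g x) = x"
    using isometry_inverse[OF f] by blast
  have "(f \<circ> h \<circ> g) ` f ` A = f ` B" using *(3) g(3) by (auto simp: image_image)
  moreover have "isometry (f \<circ> h \<circ> g)" using f(1) *(2) g(1) by (simp add: isometry_def)
  ultimately show ?thesis using splits_disk_into_image[OF *(1)]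
    unfolding splits_congruent_def congruent_sets_def by blast
qed

lemma crosses_circles_twice_image:
  assumes "crosses_circles_twice \<beta>" shows "crosses_circles_twice (f ` \<beta>)"
proof -
  have "f ` \<beta> \<inter> sphere 0 \<rho> = f ` (\<beta> \<inter> sphere 0 \<rho>)" for \<rho>
    using image_Int[OF isometry_inj] isometry_image_cball(2)[OF f] by metis
  moreover have "card (f ` S) = card S" for S using isometry_inj by (simp add: card_image inj_on_subset)
  ultimately show ?thesis using assms by (simp add: crosses_circles_twice_def)
qed

lemma crosses_radii_once_image:
  assumes "crosses_radii_once \<beta>" shows "crosses_radii_once (f ` \<beta>)"
  unfolding crosses_radii_once_def
proof
  fix u assume "u \<in> sphere (0::real^2) (1 / sqrt pi)"
  then obtain v where v: "v \<in> sphere 0 (1 / sqrt pi)" "u = f v"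
    using isometry_image_cball(2)[OF f] by blast
  have "linear f" using isometry_orthogonal[OF f] orthogonal_transformation_linear by blast
  then have "f ` closed_segment 0 v = closed_segment 0 u"
    using closed_segment_linear_image[of f 0 v] f(2) v by simp
  then have "f ` \<beta> \<inter> closed_segment 0 u - {0} = f ` (\<beta> \<inter> closed_segment 0 v - {0})"
    using isometry_inj f(2) by (simp add: image_Int image_set_diff)
  then show "card (f ` \<beta> \<inter> closed_segment 0 u - {0}) = 1"
    using assms v(1) isometry_inj by (simp add: crosses_radii_once_def card_image inj_on_subset)
qed

lemma measure_isometry_image:
  assumes "A \<subseteq> disk" "A \<in> sets lebesgue"
  shows "f ` A \<in> sets lebesgue" "measure lebesgue (f ` A) = measure lebesgue A"
  using measurable_orthogonal_image measure_orthogonal_image isometry_orthogonal[OF f]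
    lmeasurable_subset_disk[OF assms] by blast+

end

lemma perfect_image:
  assumes f: "isometry f" "f 0 = 0" and A: "perfect A"
  shows "perfect (f ` A)"
  unfolding perfect_def
proof (intro conjI allI impI)
  have A': "A \<subseteq> disk" "A \<in> sets lebesgue" "measure lebesgue A = 1/2"
    "\<And>X. X \<subseteq> A \<Longrightarrow> X \<in> sets lebesgue \<Longrightarrow> symmetric_subset X \<Longrightarrow> measure lebesgue X \<le> 1/4"
    using A by (auto simp: perfect_def)
  obtain g where g: "isometry g" "g 0 = 0" "\<And>x. g (f x) = x" "\<And>x. f (g x) = x"
    using isometry_inverse[OF f] by blast
  show "f ` A \<subseteq> disk" using A'(1) isometry_image_disk[OF f] by blast
  show "f ` A \<in> sets lebesgue" "measure lebesgue (f ` A) = 1/2"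
    using measure_isometry_image[OF f A'(1,2)] A'(3) by auto
  fix X assume X: "X \<subseteq> f ` A \<and> X \<in> sets lebesgue \<and> symmetric_subset X"
  then obtain s where s: "X \<subseteq> disk" "s \<in> disk_symmetries" "s \<noteq> id" "s ` X = X"
    by (auto simp: symmetric_subset_def)
  have "g ` X \<subseteq> A" using X g(3) by auto
  moreover have "(g \<circ> s \<circ> f) ` g ` X = g ` s ` X" using g(4) by (simp add: image_image)
  then have "(g \<circ> s \<circ> f) ` g ` X = g ` X" using s(4) by simp
  moreover have "g \<circ> s \<circ> f \<noteq> id"
  proof
    assume *: "g \<circ> s \<circ> f = id"
    have "s x = x" for x using fun_cong[OF *, of "g x"] g(4) by (metis comp_apply id_apply)
    then show False using s(3) by auto
  qed
  moreover have "g \<circ> s \<circ> f \<in> disk_symmetries"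
  proof -
    have "s ` disk = disk" using s(2) by (simp add: disk_symmetries_def)
    then have "(g \<circ> s \<circ> f) ` disk = disk"
      using isometry_image_disk[OF f] isometry_image_disk[OF g(1,2)] by (simp only: image_comp[symmetric])
    moreover have "isometry (g \<circ> s \<circ> f)"
      using f(1) g(1) s(2) by (simp add: isometry_def disk_symmetries_def)
    ultimately show ?thesis by (simp add: disk_symmetries_def)
  qed
  ultimately have "symmetric_subset (g ` X)"
    unfolding symmetric_subset_def using A'(1) by blast
  then have "measure lebesgue (g ` X) \<le> 1/4"
    using A'(4)[of "g ` X"] \<open>g ` X \<subseteq> A\<close> measure_isometry_image[OF g(1,2) s(1)] X by blast
  then show "measure lebesgue X \<le> 1/4"
    using measure_isometry_image[OF g(1,2) s(1)] X by simp
qed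

lemma splits_perfect_image:
  assumes "isometry f" "f 0 = 0" "splits_perfect \<beta>" shows "splits_perfect (f ` \<beta>)"
  using assms perfect_image splits_disk_into_image unfolding splits_perfect_def by metis

lemma smooth_vector_derivative:
  fixes \<gamma> :: "real \<Rightarrow> real^2"
  assumes "\<And>t. t \<in> {0..1} \<Longrightarrow> (\<gamma> has_vector_derivative \<gamma>' t) (at t within {0..1::real})" "t \<in> {0..1}"
  shows "vector_derivative \<gamma> (at t within {0..1}) = \<gamma>' t"
  using assms(1)[OF assms(2)] assms(2) by (intro vector_derivative_within_closed_interval) auto

lemma smooth_curve_image:
  assumes f: "isometry f" "f 0 = 0" and "smooth_curve \<beta>"
  shows "smooth_curve (f ` \<beta>)"
proof -
  obtain \<gamma> F where \<gamma>: "arc \<gamma>" "path_image \<gamma> = \<beta>" "F 0 = \<gamma>"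
    "\<And>k t. t \<in> {0..1} \<Longrightarrow> (F k has_vector_derivative F (Suc k) t) (at t within {0..1})"
    "\<And>t. t \<in> {0..1} \<Longrightarrow> vector_derivative \<gamma> (at t within {0..1}) \<noteq> 0"
    using assms(3) unfolding smooth_curve_def infinitely_differentiable_on_def by blast
  have lin: "linear f" using isometry_orthogonal[OF f] orthogonal_transformation_linear by blast
  have F: "((f \<circ> F k) has_vector_derivative (f \<circ> F (Suc k)) t) (at t within {0..1})" if "t \<in> {0..1}" for k t
    using bounded_linear.has_vector_derivative[OF _ \<gamma>(4)[OF that]] lin
    by (simp add: linear_conv_bounded_linear o_def)
  have "arc (f \<circ> \<gamma>)"
    using \<gamma>(1) isometry_inj[OF f] isometry_continuous[OF f(1)]
    unfolding arc_def path_def by (metis comp_inj_on continuous_on_compose inj_on_subset subset_UNIV)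
  moreover have "path_image (f \<circ> \<gamma>) = f ` \<beta>" using \<gamma>(2) by (simp add: path_image_compose)
  moreover have "infinitely_differentiable_on (f \<circ> \<gamma>) {0..1}"
    unfolding infinitely_differentiable_on_def
    using F \<gamma>(3) by (intro exI[of _ "\<lambda>k. f \<circ> F k"]) auto
  moreover have "vector_derivative (f \<circ> \<gamma>) (at t within {0..1}) \<noteq> 0" if t: "t \<in> {0..1}" for t
  proof -
    have "vector_derivative (f \<circ> \<gamma>) (at t within {0..1}) = (f \<circ> F 1) t"
      using F[of _ 0] unfolding \<gamma>(3)[symmetric] One_nat_def by (intro smooth_vector_derivative t)
    moreover have "F 1 t \<noteq> 0"
      using \<gamma>(5)[OF t] smooth_vector_derivative[of \<gamma> "F 1" t] \<gamma>(4)[of _ 0] \<gamma>(3) t by auto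
    ultimately show ?thesis using isometry_inj[OF f] f(2) by (metis comp_apply injD)
  qed
  ultimately show ?thesis unfolding smooth_curve_def by blast
qed

lemma poly2_pcompose: "poly2 (P \<circ>\<^sub>p [:[:a:], [:b:]:]) x y = poly2 P (a + b * x) y"
  by (simp add: poly2_def poly_pcompose mult.commute)

lemma algebraic_in_polar_image:
  assumes f: "isometry f" "f 0 = 0" and "algebraic_in_polar \<beta>"
  shows "algebraic_in_polar (f ` \<beta>)"
proof -
  obtain \<alpha> \<sigma> where \<sigma>: "\<sigma> = 1 \<or> \<sigma> = -1" and fp: "\<And>\<theta> r. f (polar (\<theta>, r)) = polar (\<alpha> + \<sigma> * \<theta>, r)"
    using isometry_polar[OF f] by blast
  obtain g P where g: "arc g" "P \<noteq> 0" "\<forall>(\<phi>, r)\<in>path_image g. poly2 P \<phi> r = 0"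
    "\<beta> = polar ` path_image g"
    using assms(3) unfolding algebraic_in_polar_def algebraic_curve_def is_curve_def by blast
  define h where "h = (\<lambda>(\<phi>, r). (\<alpha> + \<sigma> * \<phi>, r :: real))"
  have h: "continuous_on UNIV h" "inj h"
    using \<sigma> unfolding h_def by (auto simp: case_prod_unfold inj_def intro!: continuous_intros)
  have "arc (h \<circ> g)"
    using g(1) h unfolding arc_def path_def
    by (metis comp_inj_on continuous_on_compose continuous_on_subset inj_on_subset subset_UNIV)
  then have "is_curve (path_image (h \<circ> g))" unfolding is_curve_def by blast
  \<comment> \<open>Since \<open>\<sigma>\<close> is its own inverse, \<phi> -> -\<sigma>\<alpha> +
    \<sigma>\<phi> undoes the action \<phi> -> \<alpha> + \<sigma>\<phi> of the isometry on the
    angle.\<close>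
  moreover define Q where "Q = P \<circ>\<^sub>p [:[:- \<sigma> * \<alpha>:], [:\<sigma>:]:]"
  have "Q \<noteq> 0" unfolding Q_def using g(2) \<sigma> by (auto simp: pcompose_eq_0_iff)
  moreover have "\<forall>(\<phi>, r)\<in>path_image (h \<circ> g). poly2 Q \<phi> r = 0"
  proof -
    have "poly2 Q (\<alpha> + \<sigma> * \<phi>) r = poly2 P \<phi> r" for \<phi> r
      using \<sigma> unfolding Q_def poly2_pcompose by (auto simp: algebra_simps)
    then show ?thesis using g(3) by (auto simp: path_image_compose h_def)
  qed
  moreover have "f ` \<beta> = polar ` path_image (h \<circ> g)"
  proof -
    have "f (polar p) = polar (h p)" for p by (cases p) (simp add: fp h_def)
    then show ?thesis unfolding g(4) path_image_compose by (simp add: image_image)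
  qed
  ultimately show ?thesis unfolding algebraic_in_polar_def algebraic_curve_def by blast
qed

section \<open>Sectors of the disk\<close>

lemma int_multiple_2pi_small:
  assumes "\<bar>2 * pi * real_of_int k\<bar> < 2 * pi" shows "k = 0"
proof -
  have "2 * pi * \<bar>real_of_int k\<bar> < 2 * pi * 1" using assms by (simp add: abs_mult)
  then have "\<bar>real_of_int k\<bar> < 1" by (subst (asm) mult_less_cancel_left_pos) auto
  then show ?thesis by linarith
qed

lemma polar_inj_window:
  assumes "r > 0" "polar (a, r) = polar (b, r)" "c \<le> a" "a < c + 2 * pi" "c \<le> b" "b < c + 2 * pi"
  shows "a = b"
proof -
  obtain k :: int where k: "a = b + 2 * pi * k" using assms polar_eq_iff by blast
  have "\<bar>2 * pi * real_of_int k\<bar> < 2 * pi" using k assms(3-) by linarith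
  then have "k = 0" by (rule int_multiple_2pi_small)
  then show ?thesis using k by simp
qed

text \<open>The bounding angles depend on the radius, so this is the region between two spiral-like
  branches; the centre is left out.\<close>

definition sector :: "(real \<Rightarrow> real) \<Rightarrow> (real \<Rightarrow> real) \<Rightarrow> (real^2) set" where
  "sector p q = {polar (\<theta>, \<rho>) |\<theta> \<rho>. 0 < \<rho> \<and> \<rho> \<le> R \<and> p \<rho> < \<theta> \<and> \<theta> < q \<rho>}"

text \<open>Compact companion of the open sector, centre included. It separates components: each
  open sector lies in its own closed sector and misses the complementary one.\<close>

definition closed_sector :: "(real \<Rightarrow> real) \<Rightarrow> (real \<Rightarrow> real) \<Rightarrow> (real^2) set" where
  "closed_sector p q = {polar (\<theta>, \<rho>) |\<theta> \<rho>. 0 \<le> \<rho> \<and> \<rho> \<le> R \<and> p \<rho> \<le> \<theta> \<and> \<theta> \<le> q \<rho>}"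

lemma sectorI: "0 < \<rho> \<Longrightarrow> \<rho> \<le> R \<Longrightarrow> p \<rho> < \<theta> \<Longrightarrow> \<theta> < q \<rho> \<Longrightarrow> polar (\<theta>, \<rho>) \<in> sector p q"
  unfolding sector_def by blast

lemma sectorE:
  assumes "x \<in> sector p q"
  shows "\<exists>\<theta>. x = polar (\<theta>, norm x) \<and> 0 < norm x \<and> norm x \<le> R \<and> p (norm x) < \<theta> \<and> \<theta> < q (norm x)"
proof -
  obtain \<theta> \<rho> where *: "x = polar (\<theta>, \<rho>)" "0 < \<rho>" "\<rho> \<le> R" "p \<rho> < \<theta>" "\<theta> < q \<rho>"
    using assms unfolding sector_def by blast
  then have "norm x = \<rho>" by simp
  then show ?thesis using * by blast
qed

lemma affine_between:
  fixes a b t :: real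
  assumes "a \<le> t" "t \<le> b" "a < b"
  shows "\<exists>s. 0 \<le> s \<and> s \<le> 1 \<and> t = a + s * (b - a) \<and> (a < t \<longrightarrow> 0 < s) \<and> (t < b \<longrightarrow> s < 1)"
  using assms by (intro exI[of _ "(t - a) / (b - a)"]) (auto simp: field_simps)

context
  fixes p q :: "real \<Rightarrow> real"
  assumes cont: "continuous_on {0..R} p" "continuous_on {0..R} q"
    and pq: "\<And>\<rho>. \<rho> \<in> {0..R} \<Longrightarrow> p \<rho> < q \<rho>"
begin

text \<open>Writing the angle as \<open>p + s * (q - p)\<close> with a fraction \<open>s\<close>
  makes a sector the image of a rectangle, from which it inherits connectedness or
  compactness.\<close>

lemma continuous_on_sector_map:
  "continuous_on ({0..R} \<times> T) (\<lambda>z. polar (p (fst z) + snd z * (q (fst z) - p (fst z)), fst z))"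
proof -
  have *: "continuous_on ({0..R} \<times> T) (\<lambda>z. p (fst z))" "continuous_on ({0..R} \<times> T) (\<lambda>z. q (fst z))"
    by (rule continuous_on_compose2[OF cont(1)] continuous_on_compose2[OF cont(2)];
        auto intro!: continuous_intros)+
  show ?thesis by (intro continuous_intros *)
qed

lemma sector_connected: "connected (sector p q)"
proof -
  have "sector p q = (\<lambda>z. polar (p (fst z) + snd z * (q (fst z) - p (fst z)), fst z)) ` ({0<..R} \<times> {0<..<1})"
    (is "_ = ?f ` ?S")
  proof (intro set_eqI iffI)
    fix x assume "x \<in> sector p q"
    then obtain \<theta> \<rho> where *: "x = polar (\<theta>, \<rho>)" "0 < \<rho>" "\<rho> \<le> R" "p \<rho> < \<theta>" "\<theta> < q \<rho>"
      unfolding sector_def by blast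
    then obtain s where "0 < s" "s < 1" "\<theta> = p \<rho> + s * (q \<rho> - p \<rho>)"
      using affine_between[of "p \<rho>" \<theta> "q \<rho>"] by auto
    then show "x \<in> ?f ` ?S" using * by (intro image_eqI[of _ _ "(\<rho>, s)"]) auto
  next
    fix x assume "x \<in> ?f ` ?S"
    then obtain \<rho> s where *: "0 < \<rho>" "\<rho> \<le> R" "0 < s" "s < 1" "x = polar (p \<rho> + s * (q \<rho> - p \<rho>), \<rho>)"
      by auto
    have "s * (q \<rho> - p \<rho>) < 1 * (q \<rho> - p \<rho>)" "0 < s * (q \<rho> - p \<rho>)"
      using * pq[of \<rho>] by (intro mult_strict_right_mono mult_pos_pos; simp)+
    then show "x \<in> sector p q" using * by (auto intro!: sectorI)
  qed
  moreover have "continuous_on ({0<..R} \<times> {0<..<1}) (\<lambda>z. polar (p (fst z) + snd z * (q (fst z) - p (fst z)), fst z))"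
    by (rule continuous_on_subset[OF continuous_on_sector_map[of "{0<..<1}"]]) auto
  moreover have "connected ({0<..R} \<times> {0::real<..<1})" by (intro connected_Times) auto
  ultimately show ?thesis by (simp add: connected_continuous_image)
qed

lemma closed_sector_closed: "closed (closed_sector p q)"
proof -
  have "closed_sector p q = (\<lambda>z. polar (p (fst z) + snd z * (q (fst z) - p (fst z)), fst z)) ` ({0..R} \<times> {0..1})"
    (is "_ = ?f ` ?S")
  proof (intro set_eqI iffI)
    fix x assume "x \<in> closed_sector p q"
    then obtain \<theta> \<rho> where *: "x = polar (\<theta>, \<rho>)" "0 \<le> \<rho>" "\<rho> \<le> R" "p \<rho> \<le> \<theta>" "\<theta> \<le> q \<rho>"
      unfolding closed_sector_def by blast
    then obtain s where "0 \<le> s" "s \<le> 1" "\<theta> = p \<rho> + s * (q \<rho> - p \<rho>)"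
      using affine_between[of "p \<rho>" \<theta> "q \<rho>"] pq[of \<rho>] by auto
    then show "x \<in> ?f ` ?S" using * by (intro image_eqI[of _ _ "(\<rho>, s)"]) auto
  next
    fix x assume "x \<in> ?f ` ?S"
    then obtain \<rho> s where *: "0 \<le> \<rho>" "\<rho> \<le> R" "0 \<le> s" "s \<le> 1" "x = polar (p \<rho> + s * (q \<rho> - p \<rho>), \<rho>)"
      by auto
    have "s * (q \<rho> - p \<rho>) \<le> 1 * (q \<rho> - p \<rho>)" "0 \<le> s * (q \<rho> - p \<rho>)"
      using * pq[of \<rho>] by (intro mult_right_mono mult_nonneg_nonneg; simp)+
    then show "x \<in> closed_sector p q" using * unfolding closed_sector_def by force
  qed
  moreover have "compact (({0..R} \<times> {0..1})::(real\<times>real) set)" by (intro compact_Times) auto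
  ultimately show ?thesis
    using compact_continuous_image[OF continuous_on_sector_map[of "{0..1}"]] compact_imp_closed by metis
qed

end

section \<open>Components of the disk cut along two branches\<close>

text \<open>The closed sets \<open>K\<close> and \<open>L\<close> cover \<open>A \<union> B\<close>
  and have no common point there, so no connected subset can meet both \<open>A\<close> and
  \<open>B\<close>.\<close>

lemma components_two:
  assumes K: "closed K" "closed L" "A \<subseteq> K" "B \<subseteq> L" "A \<inter> L = {}" "B \<inter> K = {}"
    and A: "connected A" "A \<noteq> {}" and B: "connected B" "B \<noteq> {}"
  shows "components (A \<union> B) = {A, B}"
proof -
  have AB: "A \<inter> B = {}" using K by blast
  have sub: "C \<subseteq> A \<or> C \<subseteq> B" if "connected C" "C \<subseteq> A \<union> B" for C
  proof (rule ccontr)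
    assume "\<not> ?thesis"
    then have "K \<inter> C \<noteq> {}" "L \<inter> C \<noteq> {}" "K \<inter> L \<inter> C = {}" "C \<subseteq> K \<union> L" using K that by blast+
    then show False using connected_closedD[OF that(1), of K L] K by blast
  qed
  have comp: "connected_component_set (A \<union> B) x = C" if C: "C = A \<or> C = B" and x: "x \<in> C" for x C
  proof
    have xS: "x \<in> A \<union> B" using C x by blast
    show "C \<subseteq> connected_component_set (A \<union> B) x"
      using C x A B by (intro connected_component_maximal) auto
    have "x \<in> connected_component_set (A \<union> B) x" using xS by simp
    moreover have "connected_component_set (A \<union> B) x \<subseteq> A \<or> connected_component_set (A \<union> B) x \<subseteq> B"
      by (rule sub) (rule connected_connected_component connected_component_subset)+
    ultimately show "connected_component_set (A \<union> B) x \<subseteq> C" using C x AB by blast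
  qed
  show ?thesis
  proof
    show "components (A \<union> B) \<subseteq> {A, B}"
    proof
      fix C assume "C \<in> components (A \<union> B)"
      then obtain x where x: "x \<in> A \<union> B" "C = connected_component_set (A \<union> B) x"
        unfolding components_def by blast
      then show "C \<in> {A, B}" using comp[of A x] comp[of B x] by blast
    qed
    obtain a b where ab: "a \<in> A" "b \<in> B" using A B by blast
    have "connected_component_set (A \<union> B) a = A" "connected_component_set (A \<union> B) b = B"
      using comp[of A a] comp[of B b] ab by simp_all
    moreover have "connected_component_set (A \<union> B) a \<in> components (A \<union> B)"
      "connected_component_set (A \<union> B) b \<in> components (A \<union> B)"
      unfolding components_def using ab by blast+
    ultimately show "{A, B} \<subseteq> components (A \<union> B)" by simp
  qed
qed

definition two_branches :: "(real \<Rightarrow> real) \<Rightarrow> (real \<Rightarrow> real) \<Rightarrow> (real^2) set" where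
  "two_branches p q = (\<lambda>\<rho>. polar (p \<rho>, \<rho>)) ` {0..R} \<union> (\<lambda>\<rho>. polar (q \<rho>, \<rho>)) ` {0..R}"

context
  fixes p q :: "real \<Rightarrow> real"
  assumes cont: "continuous_on {0..R} p" "continuous_on {0..R} q"
    and pq: "\<And>\<rho>. \<rho> \<in> {0..R} \<Longrightarrow> p \<rho> < q \<rho>" "\<And>\<rho>. \<rho> \<in> {0..R} \<Longrightarrow> q \<rho> < p \<rho> + 2 * pi"
begin

lemma two_branches_not_in_sector:
  "\<lbrakk>0 < \<rho>; \<rho> \<le> R; p \<rho> < \<theta>; \<theta> < q \<rho>\<rbrakk> \<Longrightarrow> polar (\<theta>, \<rho>) \<notin> two_branches p q"
  "\<lbrakk>0 < \<rho>; \<rho> \<le> R; q \<rho> < \<theta>; \<theta> < p \<rho> + 2 * pi\<rbrakk> \<Longrightarrow> polar (\<theta>, \<rho>) \<notin> two_branches p q"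
proof -
  have *: "\<theta> = p \<rho> \<or> \<theta> = q \<rho>"
    if "0 < \<rho>" "\<rho> \<le> R" "p \<rho> \<le> \<theta>" "\<theta> < p \<rho> + 2 * pi" "polar (\<theta>, \<rho>) \<in> two_branches p q" for \<theta> \<rho>
  proof -
    have "\<exists>r\<in>{0..R}. polar (\<theta>, \<rho>) = polar (p r, r) \<or> polar (\<theta>, \<rho>) = polar (q r, r)"
      using that(5) unfolding two_branches_def by blast
    then obtain r where r: "r \<in> {0..R}" "polar (\<theta>, \<rho>) = polar (p r, r) \<or> polar (\<theta>, \<rho>) = polar (q r, r)" by blast
    then have "\<bar>r\<bar> = \<bar>\<rho>\<bar>" by (metis norm_polar)
    then have "r = \<rho>" using r(1) that(1) by simp
    then show ?thesis
      using r polar_inj_window[OF that(1) _ that(3,4)] pq[OF r(1)] pi_gt_zero by (metis add_strict_increasing2 less_imp_le less_add_same_cancel1 mult_pos_pos order_refl zero_less_numeral)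
  qed
  show "\<lbrakk>0 < \<rho>; \<rho> \<le> R; p \<rho> < \<theta>; \<theta> < q \<rho>\<rbrakk> \<Longrightarrow> polar (\<theta>, \<rho>) \<notin> two_branches p q"
    using *[of \<rho> \<theta>] pq[of \<rho>] by fastforce
  show "\<lbrakk>0 < \<rho>; \<rho> \<le> R; q \<rho> < \<theta>; \<theta> < p \<rho> + 2 * pi\<rbrakk> \<Longrightarrow> polar (\<theta>, \<rho>) \<notin> two_branches p q"
    using *[of \<rho> \<theta>] pq[of \<rho>] by fastforce
qed

lemma disk_minus_two_branches_cases:
  assumes x: "x \<in> disk - two_branches p q"
  shows "\<exists>\<theta> \<rho>. x = polar (\<theta>, \<rho>) \<and> 0 < \<rho> \<and> \<rho> \<le> R \<and> (p \<rho> < \<theta> \<and> \<theta> < q \<rho> \<or> q \<rho> < \<theta> \<and> \<theta> < p \<rho> + 2 * pi)"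
proof -
  define \<rho> where "\<rho> = norm x"
  have br: "polar (p r, r) \<in> two_branches p q" "polar (q r, r) \<in> two_branches p q" if "0 \<le> r" "r \<le> R" for r
    using that unfolding two_branches_def by auto
  have \<rho>: "0 \<le> \<rho>" "\<rho> \<le> R" using x by (auto simp: \<rho>_def disk_def)
  have "x \<noteq> 0" using br(1)[of 0] x by auto
  then have "0 < \<rho>" by (simp add: \<rho>_def)
  obtain \<theta> where \<theta>: "p \<rho> \<le> \<theta>" "\<theta> < p \<rho> + 2 * pi" "x = polar (\<theta>, \<rho>)"
    using polar_exists_from[of "p \<rho>" x] unfolding \<rho>_def by blast
  have "\<theta> \<noteq> p \<rho>" "\<theta> \<noteq> q \<rho>" using br[OF \<rho>] x \<theta>(3) by auto
  then show ?thesis using \<theta> \<open>0 < \<rho>\<close> \<rho> by (intro exI[of _ \<theta>] exI[of _ \<rho>]) linarith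
qed

lemma sectors_facts:
  defines "A \<equiv> sector p q" and "B \<equiv> sector q (\<lambda>\<rho>. p \<rho> + 2 * pi)"
  shows "A \<inter> B = {}" "disk - two_branches p q = A \<union> B" "A \<noteq> {}" "B \<noteq> {}"
    "A \<subseteq> closed_sector p q" "B \<subseteq> closed_sector q (\<lambda>\<rho>. p \<rho> + 2 * pi)"
    "A \<inter> closed_sector q (\<lambda>\<rho>. p \<rho> + 2 * pi) = {}" "B \<inter> closed_sector p q = {}"
proof -
  have win: "False" if "0 < \<rho>" "\<rho> \<le> R" "p \<rho> \<le> \<theta>" "\<theta> \<le> q \<rho>" "q \<rho> < \<theta>'" "\<theta>' < p \<rho> + 2 * pi"
    "polar (\<theta>, \<rho>) = polar (\<theta>', \<rho>)" for \<rho> \<theta> \<theta>'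
    using polar_inj_window[OF that(1,7), of "p \<rho>"] that by linarith
  have win2: "False" if "0 < \<rho>" "\<rho> \<le> R" "p \<rho> < \<theta>" "\<theta> < q \<rho>" "q \<rho> \<le> \<theta>'" "\<theta>' \<le> p \<rho> + 2 * pi"
    "polar (\<theta>, \<rho>) = polar (\<theta>', \<rho>)" for \<rho> \<theta> \<theta>'
    using polar_inj_window[OF that(1,7), of "q \<rho> - 2 * pi"] polar_inj_window[OF that(1,7), of "p \<rho>"] that
    by (smt (verit) polar_inj_window pi_gt_zero)
  show "A \<inter> B = {}"
  proof (rule ccontr)
    assume "A \<inter> B \<noteq> {}"
    then obtain x where "x \<in> A" "x \<in> B" by blast
    then show False using sectorE[of x] win unfolding A_def B_def by (metis less_imp_le)
  qed
  have AB: "A \<subseteq> disk - two_branches p q" "B \<subseteq> disk - two_branches p q"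
    unfolding A_def B_def sector_def disk_def using two_branches_not_in_sector by auto
  show un: "disk - two_branches p q = A \<union> B"
  proof
    show "disk - two_branches p q \<subseteq> A \<union> B"
    proof
      fix x assume "x \<in> disk - two_branches p q"
      then obtain \<theta> \<rho> where *: "x = polar (\<theta>, \<rho>)" "0 < \<rho>" "\<rho> \<le> R"
         "p \<rho> < \<theta> \<and> \<theta> < q \<rho> \<or> q \<rho> < \<theta> \<and> \<theta> < p \<rho> + 2 * pi"
        using disk_minus_two_branches_cases by blast
      then show "x \<in> A \<union> B" unfolding A_def B_def by (auto intro: sectorI)
    qed
  qed (use AB in blast)
  have R: "R \<in> {0..R}" by simp
  have "polar ((p R + q R) / 2, R) \<in> A" unfolding A_def
    using pq[OF R] by (intro sectorI) auto
  then show "A \<noteq> {}" by blast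
  have "polar ((q R + (p R + 2 * pi)) / 2, R) \<in> B" unfolding B_def
    using pq[OF R] by (intro sectorI) auto
  then show "B \<noteq> {}" by blast
  show "A \<subseteq> closed_sector p q" "B \<subseteq> closed_sector q (\<lambda>\<rho>. p \<rho> + 2 * pi)"
    unfolding A_def B_def sector_def closed_sector_def by force+
  have 1: "x \<notin> closed_sector p q" if xB: "x \<in> B" for x
  proof
    assume "x \<in> closed_sector p q"
    then obtain \<theta> \<rho> where *: "x = polar (\<theta>, \<rho>)" "0 \<le> \<rho>" "\<rho> \<le> R" "p \<rho> \<le> \<theta>" "\<theta> \<le> q \<rho>"
      unfolding closed_sector_def by blast
    then have n: "norm x = \<rho>" by simp
    obtain \<theta>' where "x = polar (\<theta>', norm x)" "0 < norm x" "norm x \<le> R" "q (norm x) < \<theta>'" "\<theta>' < p (norm x) + 2 * pi"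
      using sectorE[OF xB[unfolded B_def]] by blast
    then show False using win[of \<rho> \<theta> \<theta>'] * n by simp
  qed
  have 2: "x \<notin> closed_sector q (\<lambda>\<rho>. p \<rho> + 2 * pi)" if xA: "x \<in> A" for x
  proof
    assume "x \<in> closed_sector q (\<lambda>\<rho>. p \<rho> + 2 * pi)"
    then obtain \<theta> \<rho> where *: "x = polar (\<theta>, \<rho>)" "0 \<le> \<rho>" "\<rho> \<le> R" "q \<rho> \<le> \<theta>" "\<theta> \<le> p \<rho> + 2 * pi"
      unfolding closed_sector_def by blast
    then have n: "norm x = \<rho>" by simp
    obtain \<theta>' where "x = polar (\<theta>', norm x)" "0 < norm x" "norm x \<le> R" "p (norm x) < \<theta>'" "\<theta>' < q (norm x)"
      using sectorE[OF xA[unfolded A_def]] by blast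
    then show False using win2[of \<rho> \<theta>' \<theta>] * n by simp
  qed
  show "A \<inter> closed_sector q (\<lambda>\<rho>. p \<rho> + 2 * pi) = {}" "B \<inter> closed_sector p q = {}"
    using 1 2 by blast+
qed

lemma splits_two_branches:
  "splits_disk_into (two_branches p q) (sector p q) (sector q (\<lambda>\<rho>. p \<rho> + 2 * pi))"
proof -
  have c: "continuous_on {0..R} (\<lambda>\<rho>. p \<rho> + 2 * pi)" by (intro continuous_intros cont)
  have "components (disk - two_branches p q) = {sector p q, sector q (\<lambda>\<rho>. p \<rho> + 2 * pi)}"
    unfolding sectors_facts(2)
    by (rule components_two[OF closed_sector_closed[OF cont] closed_sector_closed[OF cont(2) c]
      sectors_facts(5-8) sector_connected[OF cont] sectors_facts(3) sector_connected[OF cont(2) c] sectors_facts(4)])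
      (use pq in auto)
  moreover have "sector p q \<noteq> sector q (\<lambda>\<rho>. p \<rho> + 2 * pi)" using sectors_facts(1,3) by blast
  ultimately show ?thesis by (simp add: splits_disk_into_def)
qed

end

text \<open>An open arc shorter than a full turn does not contain its own end points modulo
  \<open>2 * pi\<close>. Once the two intervals overlap, an end point of one can therefore not lie
  strictly inside the other.\<close>

lemma arc_endpoints_unique:
  assumes r: "r > 0" and ab: "a < b" "b - a < 2 * pi" and cd: "c < d" "d - c < 2 * pi"
    and eq: "(\<lambda>\<theta>. polar (\<theta>, r)) ` {a<..<b} = (\<lambda>\<theta>. polar (\<theta>, r)) ` {c<..<d}"
  shows "\<exists>k::int. c = a + 2 * pi * k \<and> d = b + 2 * pi * k"
proof -
  have *: "\<exists>k::int. a' < \<theta> + 2 * pi * k \<and> \<theta> + 2 * pi * k < b'"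
    if eq: "(\<lambda>\<theta>. polar (\<theta>, r)) ` {a'<..<b'} = (\<lambda>\<theta>. polar (\<theta>, r)) ` {c'<..<d'}" and \<theta>: "c' < \<theta>" "\<theta> < d'" for a' b' c' d' \<theta>
  proof -
    have "polar (\<theta>, r) \<in> (\<lambda>\<theta>. polar (\<theta>, r)) ` {a'<..<b'}" unfolding eq using \<theta> by auto
    then obtain \<eta> where \<eta>: "a' < \<eta>" "\<eta> < b'" "polar (\<eta>, r) = polar (\<theta>, r)" by auto
    then obtain k :: int where "\<eta> = \<theta> + 2 * pi * k" using polar_eq_iff[OF r] by blast
    then show ?thesis using \<eta> by blast
  qed
  \<comment> \<open>The midpoint of the second arc lies on the first arc modulo
    \<open>2 * pi\<close>; translating by that multiple makes the intervals overlap.\<close>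
  obtain k :: int where k: "a < (c + d) / 2 + 2 * pi * k" "(c + d) / 2 + 2 * pi * k < b"
    using *[OF eq, of "(c + d) / 2"] cd by auto
  define c' d' where "c' = c + 2 * pi * k" and "d' = d + 2 * pi * k"
  have m: "a < (c' + d') / 2" "(c' + d') / 2 < b" "c' < d'" "d' - c' < 2 * pi"
    using k cd by (auto simp: c'_def d'_def field_simps)
  have eq': "(\<lambda>\<theta>. polar (\<theta>, r)) ` {a<..<b} = (\<lambda>\<theta>. polar (\<theta>, r)) ` {c'<..<d'}"
  proof -
    have "(\<lambda>\<theta>. polar (\<theta>, r)) ` {c<..<d} = (\<lambda>\<theta>. polar (\<theta>, r)) ` {c'<..<d'}"
    proof (intro set_eqI iffI)
      fix x assume "x \<in> (\<lambda>\<theta>. polar (\<theta>, r)) ` {c<..<d}"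
      then obtain \<theta> where "x = polar (\<theta>, r)" "c < \<theta>" "\<theta> < d" by auto
      then show "x \<in> (\<lambda>\<theta>. polar (\<theta>, r)) ` {c'<..<d'}"
        by (intro image_eqI[of _ _ "\<theta> + 2 * pi * k"]) (auto simp: c'_def d'_def polar_eq_iff[OF r] intro: exI[of _ "-k"])
    next
      fix x assume "x \<in> (\<lambda>\<theta>. polar (\<theta>, r)) ` {c'<..<d'}"
      then obtain \<theta> where "x = polar (\<theta>, r)" "c' < \<theta>" "\<theta> < d'" by auto
      then show "x \<in> (\<lambda>\<theta>. polar (\<theta>, r)) ` {c<..<d}"
        by (intro image_eqI[of _ _ "\<theta> - 2 * pi * k"]) (auto simp: c'_def d'_def polar_eq_iff[OF r] intro: exI[of _ "k"])
    qed
    then show ?thesis using eq by simp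
  qed
  have no: "\<not> (l < x + 2 * pi * real_of_int j \<and> x + 2 * pi * real_of_int j < u)" if "x = l \<or> x = u" "u - l < 2 * pi" for l u x and j :: int
  proof
    assume j: "l < x + 2 * pi * real_of_int j \<and> x + 2 * pi * real_of_int j < u"
    then have "\<bar>2 * pi * real_of_int j\<bar> < 2 * pi" using that by linarith
    then have "j = 0" by (rule int_multiple_2pi_small)
    then show False using j that(1) by auto
  qed
  have "\<not> c' < a" using *[OF eq', of a] no[of a a b] ab m by force
  moreover have "\<not> a < c'" using *[OF eq'[symmetric], of c'] no[of c' c' d'] ab m by force
  moreover have "\<not> b < d'" using *[OF eq', of b] no[of b a b] ab m by force
  moreover have "\<not> d' < b" using *[OF eq'[symmetric], of d'] no[of d' c' d'] ab m by force
  ultimately have "c' = a" "d' = b" by auto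
  then show ?thesis by (intro exI[of _ "-k"]) (auto simp: c'_def d'_def)
qed

section \<open>Area in polar coordinates\<close>

definition vec_of_pair :: "real \<times> real \<Rightarrow> real^2" where
  "vec_of_pair z = vector [fst z, snd z]"

lemma vec_of_pair_nth [simp]: "vec_of_pair z $ 1 = fst z" "vec_of_pair z $ 2 = snd z"
  by (simp_all add: vec_of_pair_def)

lemma vec_of_pair_measurable: "vec_of_pair \<in> borel_measurable borel"
proof (rule borel_measurable_continuous_onI)
  have "continuous_on UNIV (\<lambda>z::real \<times> real. fst z *\<^sub>R axis 1 1 + snd z *\<^sub>R (axis 2 1 :: real^2))"
    by (intro continuous_intros)
  then show "continuous_on UNIV vec_of_pair"
    by (rule continuous_on_eq) (auto simp: vec2_eq_iff axis_def)
qed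

lemma Basis_vec2: "Basis = {axis 1 1, axis 2 1 :: real^2}"
  by (auto simp: Basis_vec_def UNIV_2)

lemma Basis_pair: "Basis = {(1, 0), (0, 1 :: real) :: real \<times> real}"
  by (auto simp: Basis_prod_def)

text \<open>Both measures give every box the product of its side lengths, which determines Lebesgue
  measure. The identification gives the plane the slicing formula of product measures.\<close>

lemma lborel_vec2: "(lborel :: (real^2) measure) = distr lborel borel vec_of_pair"
proof (rule lborel_eqI)
  fix l u :: "real^2"
  assume *: "\<And>b. b \<in> Basis \<Longrightarrow> l \<bullet> b \<le> u \<bullet> b"
  have le: "l $ 1 \<le> u $ 1" "l $ 2 \<le> u $ 2"
    using *[of "axis 1 1"] *[of "axis 2 1"] by (simp_all add: Basis_vec2 inner_axis)
  have ne: "axis 1 1 \<noteq> (axis 2 1 :: real^2)" by (simp add: axis_eq_axis)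
  have "emeasure (distr lborel borel vec_of_pair) (box l u) = emeasure lborel (vec_of_pair -` box l u)"
    using vec_of_pair_measurable by (simp add: emeasure_distr)
  also have "vec_of_pair -` box l u = box (l $ 1, l $ 2) (u $ 1, u $ 2)"
    by (auto simp: mem_box Basis_vec2 Basis_pair inner_axis)
  also have "emeasure lborel \<dots> = ennreal ((u $ 1 - l $ 1) * (u $ 2 - l $ 2))"
    using le by (subst emeasure_lborel_box) (auto simp: Basis_pair)
  also have "(u $ 1 - l $ 1) * (u $ 2 - l $ 2) = (\<Prod>b\<in>Basis. (u - l) \<bullet> b)"
    using ne by (simp add: Basis_vec2 inner_axis)
  finally show "emeasure (distr lborel borel vec_of_pair) (box l u) = ennreal (\<Prod>b\<in>Basis. (u - l) \<bullet> b)" .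
qed simp

lemma emeasure_vec2_slices:
  assumes "E \<in> sets borel"
  shows "emeasure lborel E = (\<integral>\<^sup>+ a. emeasure lborel {b. vec_of_pair (a, b) \<in> E} \<partial>lborel)"
proof -
  have m: "vec_of_pair -` E \<in> sets borel"
    using measurable_sets[OF vec_of_pair_measurable assms] by simp
  have "emeasure lborel E = emeasure (lborel :: (real \<times> real) measure) (vec_of_pair -` E)"
    using assms vec_of_pair_measurable by (subst lborel_vec2) (simp add: emeasure_distr)
  also have "\<dots> = emeasure ((lborel :: real measure) \<Otimes>\<^sub>M (lborel :: real measure)) (vec_of_pair -` E)"
    by (simp only: lborel_prod)
  also have "\<dots> = (\<integral>\<^sup>+ a. emeasure lborel (Pair a -` (vec_of_pair -` E)) \<partial>lborel)"
    using m by (intro lborel.emeasure_pair_measure_alt) (simp only: lborel_prod sets_lborel)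
  finally show ?thesis by (simp add: vimage_def)
qed

text \<open>Polar coordinates with the radius \<open>r\<close> replaced by \<open>\<pi>\<^sup>2 r\<^sup>2\<close>, which makes the Jacobian constant.\<close>

definition area_polar :: "real^2 \<Rightarrow> real^2" where
  "area_polar v = polar (v $ 2, sqrt (v $ 1) / pi)"

text \<open>With z = pi^2 r^2 the area element r dr d\<phi> becomes dz d\<phi> / (2 pi^2); this is
  the origin of the factor \<open>2 * pi\<^sup>2\<close> in all area formulas.\<close>

lemma area_polar_has_derivative:
  assumes "v $ 1 > 0"
  defines "f' \<equiv> \<lambda>h. ((h $ 1 / (2 * sqrt (v $ 1)) / pi) * cos (v $ 2) - sqrt (v $ 1) / pi * sin (v $ 2) * h $ 2) *\<^sub>R axis 1 1
     + ((h $ 1 / (2 * sqrt (v $ 1)) / pi) * sin (v $ 2) + sqrt (v $ 1) / pi * cos (v $ 2) * h $ 2) *\<^sub>R (axis 2 1 :: real^2)"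
  shows "(area_polar has_derivative f') (at v within S)" "det (matrix f') = 1 / (2 * pi\<^sup>2)"
proof -
  have nth: "((\<lambda>v::real^2. v $ i) has_derivative (\<lambda>h. h $ i)) (at v within S)" for i
    by (rule bounded_linear.has_derivative[OF bounded_linear_vec_nth has_derivative_ident])
  have 1: "((\<lambda>v. sqrt (v $ 1) / pi) has_derivative (\<lambda>h. h $ 1 / (2 * sqrt (v $ 1)) / pi)) (at v within S)"
    using assms(1) by (auto intro!: derivative_eq_intros nth simp: divide_simps)
  have 2: "((\<lambda>v. cos (v $ 2)) has_derivative (\<lambda>h. - sin (v $ 2) * h $ 2)) (at v within S)"
    "((\<lambda>v. sin (v $ 2)) has_derivative (\<lambda>h. cos (v $ 2) * h $ 2)) (at v within S)"
    by (auto intro!: derivative_eq_intros nth)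
  have "((\<lambda>v. (sqrt (v $ 1) / pi * cos (v $ 2)) *\<^sub>R axis 1 1 + (sqrt (v $ 1) / pi * sin (v $ 2)) *\<^sub>R (axis 2 1 :: real^2))
      has_derivative f') (at v within S)"
    unfolding f'_def
    by (rule derivative_eq_intros refl has_derivative_mult[OF 1 2(1)] has_derivative_mult[OF 1 2(2)])+
      (auto simp: fun_eq_iff algebra_simps)
  moreover have "area_polar = (\<lambda>v. (sqrt (v $ 1) / pi * cos (v $ 2)) *\<^sub>R axis 1 1 + (sqrt (v $ 1) / pi * sin (v $ 2)) *\<^sub>R (axis 2 1 :: real^2))"
    by (auto simp: fun_eq_iff area_polar_def vec2_eq_iff axis_def)
  ultimately show "(area_polar has_derivative f') (at v within S)" by simp
  have m: "matrix f' $ 1 $ 1 = cos (v $ 2) / (2 * sqrt (v $ 1)) / pi"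
    "matrix f' $ 1 $ 2 = - sqrt (v $ 1) / pi * sin (v $ 2)"
    "matrix f' $ 2 $ 1 = sin (v $ 2) / (2 * sqrt (v $ 1)) / pi"
    "matrix f' $ 2 $ 2 = sqrt (v $ 1) / pi * cos (v $ 2)"
    by (simp_all add: matrix_def f'_def axis_def)
  have "det (matrix f') = ((cos (v $ 2))\<^sup>2 + (sin (v $ 2))\<^sup>2) / (2 * pi\<^sup>2)"
    unfolding det_2 m using assms(1) by (simp add: field_simps power2_eq_square)
  then show "det (matrix f') = 1 / (2 * pi\<^sup>2)" by simp
qed

lemma measure_area_polar_image:
  assumes E: "E \<in> sets borel" and sub: "\<And>v. v \<in> E \<Longrightarrow> 0 < v $ 1 \<and> v $ 1 \<le> pi \<and> 0 < v $ 2 \<and> v $ 2 \<le> 2 * pi"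
  shows "measure lebesgue (area_polar ` E) = measure lborel E / (2 * pi\<^sup>2)"
proof -
  have "E \<subseteq> cbox 0 (vector [pi, 2 * pi])"
    using sub by (fastforce simp: mem_box_cart forall_2)
  then have "bounded E" using bounded_cbox bounded_subset by blast
  moreover have Es: "E \<in> sets lebesgue" using E by simp
  ultimately have lm: "E \<in> lmeasurable" using bounded_set_imp_lmeasurable by blast
  have inj: "inj_on area_polar E"
  proof (rule inj_onI)
    fix v w assume v: "v \<in> E" and w: "w \<in> E" and eq: "area_polar v = area_polar w"
    have "sqrt (v $ 1) / pi > 0" "sqrt (w $ 1) / pi > 0" using sub[OF v] sub[OF w] by auto
    then have *: "sqrt (v $ 1) / pi = sqrt (w $ 1) / pi" "\<exists>k::int. v $ 2 = w $ 2 + 2 * pi * k"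
      using eq unfolding area_polar_def by (simp_all add: polar_eq_pos_iff)
    then obtain k :: int where k: "v $ 2 = w $ 2 + 2 * pi * k" by blast
    then have "\<bar>2 * pi * k\<bar> < 2 * pi" using sub[OF v] sub[OF w] by linarith
    then have "k = 0" by (rule int_multiple_2pi_small)
    then show "v = w" using * k by (simp add: vec2_eq_iff)
  qed
  let ?f' = "\<lambda>v h. ((h $ 1 / (2 * sqrt (v $ 1)) / pi) * cos (v $ 2) - sqrt (v $ 1) / pi * sin (v $ 2) * h $ 2) *\<^sub>R axis 1 1
     + ((h $ 1 / (2 * sqrt (v $ 1)) / pi) * sin (v $ 2) + sqrt (v $ 1) / pi * cos (v $ 2) * h $ 2) *\<^sub>R (axis 2 1 :: real^2)"
  have det: "\<bar>det (matrix (?f' v))\<bar> = 1 / (2 * pi\<^sup>2)" if "v \<in> E" for v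
    using area_polar_has_derivative(2)[of v] sub[OF that] by simp
  have "measure lebesgue (area_polar ` E) = integral E (\<lambda>v. \<bar>det (matrix (?f' v))\<bar>)"
  proof (rule measure_differentiable_image_eq[OF Es _ inj])
    show "(area_polar has_derivative ?f' v) (at v within E)" if "v \<in> E" for v
      using area_polar_has_derivative(1)[of v E] sub[OF that] by simp
    have "(\<lambda>v. \<bar>det (matrix (?f' v))\<bar>) integrable_on E \<longleftrightarrow> (\<lambda>v. 1 / (2 * pi\<^sup>2)) integrable_on E"
      by (rule integrable_cong) (rule det)
    then show "(\<lambda>v. \<bar>det (matrix (?f' v))\<bar>) integrable_on E" using integrable_on_const[OF lm] by blast
  qed
  also have "\<dots> = integral E (\<lambda>v. 1 / (2 * pi\<^sup>2) * 1)" using det by (intro integral_cong) (simp only: mult_1_right)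
  also have "\<dots> = 1 / (2 * pi\<^sup>2) * measure lebesgue E"
    unfolding integral_mult_right lmeasure_integral[OF lm] by simp
  also have "measure lebesgue E = measure lborel E" using E by simp
  finally show ?thesis by simp
qed

text \<open>Change of variables followed by slicing: \<open>l \<tau>\<close> is the angular length
  of \<open>X\<close> on the circle where pi^2 r^2 = \<tau>, and only the centre escapes the
  coordinates.\<close>

lemma polar_measure:
  assumes X: "X \<in> sets borel" "X \<subseteq> disk" and l: "continuous_on {0..pi} l" "\<And>\<tau>. \<tau> \<in> {0..pi} \<Longrightarrow> 0 \<le> l \<tau>"
    and slice: "\<And>\<tau>. \<tau> \<in> {0<..pi} \<Longrightarrow>
      emeasure lborel {\<theta>\<in>{0<..2 * pi}. polar (\<theta>, sqrt \<tau> / pi) \<in> X} = ennreal (l \<tau>)"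
  shows "measure lebesgue X = integral {0..pi} l / (2 * pi\<^sup>2)"
proof -
  define E where "E = {v. 0 < v $ 1 \<and> v $ 1 \<le> pi \<and> 0 < v $ 2 \<and> v $ 2 \<le> 2 * pi \<and> area_polar v \<in> X}"
  have "continuous_on UNIV area_polar"
    unfolding area_polar_def by (intro continuous_intros)  auto
  then have "area_polar -` X \<in> sets borel"
    using measurable_sets[OF borel_measurable_continuous_onI X(1)] by simp
  moreover have "E = {v. 0 < v $ 1} \<inter> {v. v $ 1 \<le> pi} \<inter> {v. 0 < v $ 2} \<inter> {v. v $ 2 \<le> 2 * pi} \<inter> area_polar -` X"
    by (auto simp: E_def)
  moreover have "{v::real^2. 0 < v $ i} \<in> sets borel" "{v::real^2. v $ i \<le> c} \<in> sets borel" for i c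
    by (intro borel_open borel_closed open_Collect_less closed_Collect_le continuous_intros)+
  ultimately have E: "E \<in> sets borel" by (metis sets.Int)
  have img: "area_polar ` E = X - {0}"
  proof (intro set_eqI iffI)
    fix x assume "x \<in> area_polar ` E"
    then obtain v where v: "v \<in> E" "x = area_polar v" by blast
    then have "norm x > 0" by (auto simp: E_def area_polar_def)
    then show "x \<in> X - {0}" using v by (auto simp: E_def)
  next
    fix x assume x: "x \<in> X - {0}"
    \<comment> \<open>Angles are supplied in windows closed on the left. Taking the angle of the
      mirror image in \<open>[- 2 * pi, 0)\<close> and negating it gives one in
      \<open>(0, 2 * pi]\<close>, as \<open>E\<close> demands.\<close>
    obtain \<theta> where \<theta>: "- (2 * pi) \<le> \<theta>" "\<theta> < - (2 * pi) + 2 * pi" "(vector [x $ 1, - (x $ 2)] :: real^2) = polar (\<theta>, norm (vector [x $ 1, - (x $ 2)] :: real^2))"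
      using polar_exists_from by blast
    have n: "norm (vector [x $ 1, - (x $ 2)] :: real^2) = norm x" by (simp add: norm_vec2)
    have "x = polar (- \<theta>, norm x)" using \<theta>(3) unfolding n vec2_eq_iff by simp
    moreover define \<tau> where "\<tau> = pi\<^sup>2 * (norm x)\<^sup>2"
    have s: "sqrt \<tau> / pi = norm x" by (simp add: \<tau>_def real_sqrt_mult)
    have "norm x \<le> R" using x X(2) by (auto simp: disk_def)
    then have "(norm x)\<^sup>2 \<le> R\<^sup>2" by (intro power_mono) auto
    then have "\<tau> \<le> pi" unfolding R_square \<tau>_def by (simp add: power2_eq_square field_simps)
    moreover have "0 < \<tau>" using x by (simp add: \<tau>_def)
    ultimately have "vec_of_pair (\<tau>, - \<theta>) \<in> E" "area_polar (vec_of_pair (\<tau>, - \<theta>)) = x"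
      using x \<theta> by (auto simp: E_def area_polar_def s)
    then show "x \<in> area_polar ` E" by (metis image_eqI)
  qed
  have "measure lebesgue X = measure lebesgue (X - {0})"
  proof (rule measure_negligible_symdiff)
    show "X - {0} \<in> lmeasurable"
      using X by (intro bounded_set_imp_lmeasurable) (auto simp: disk_def intro: bounded_subset[OF bounded_cball])
    have "X - {0} - X \<union> (X - (X - {0})) \<subseteq> {0}" by auto
    then show "negligible (X - {0} - X \<union> (X - (X - {0})))" using negligible_subset negligible_sing by blast
  qed
  then have 1: "measure lebesgue X = measure lborel E / (2 * pi\<^sup>2)"
    using measure_area_polar_image[OF E] img by (simp add: E_def)
  have "emeasure lborel E = (\<integral>\<^sup>+ a. emeasure lborel {b. vec_of_pair (a, b) \<in> E} \<partial>lborel)"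
    by (rule emeasure_vec2_slices[OF E])
  also have "\<dots> = (\<integral>\<^sup>+ a. ennreal (if a \<in> {0..pi} then l a else 0) \<partial>lborel)"
  proof (rule nn_integral_cong_AE)
    \<comment> \<open>At \<open>a = 0\<close> the slice is empty although \<open>l 0\<close> may be
      positive.\<close>
    have "AE a in lborel. a \<noteq> (0::real)" by (rule AE_lborel_singleton)
    then show "AE a in lborel. emeasure lborel {b. vec_of_pair (a, b) \<in> E} = ennreal (if a \<in> {0..pi} then l a else 0)"
    proof eventually_elim
      case (elim a)
      have "{b. vec_of_pair (a, b) \<in> E} = (if a \<in> {0<..pi} then {\<theta>\<in>{0<..2 * pi}. polar (\<theta>, sqrt a / pi) \<in> X} else {})"
        by (auto simp: E_def area_polar_def)
      then show ?case using slice[of a] elim by auto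
    qed
  qed
  also have "\<dots> = ennreal (integral {0..pi} l)"
  proof (rule nn_integral_has_integral_lborel)
    have "(\<lambda>a. indicator {0..pi} a *\<^sub>R l a) \<in> borel_measurable borel"
      by (rule borel_measurable_continuous_on_indicator[OF _ l(1)]) simp
    then show "(\<lambda>a. if a \<in> {0..pi} then l a else 0) \<in> borel_measurable borel"
      by (rule measurable_cong[THEN iffD1, rotated]) (auto simp: indicator_def)
    show "0 \<le> (if a \<in> {0..pi} then l a else 0)" for a using l(2) by simp
    have "(l has_integral integral {0..pi} l) {0..pi}"
      using l(1) by (simp add: integrable_continuous_real integrable_integral)
    then show "((\<lambda>a. if a \<in> {0..pi} then l a else 0) has_integral integral {0..pi} l) UNIV"
      unfolding has_integral_restrict_UNIV .
  qed
  finally have "emeasure lborel E = ennreal (integral {0..pi} l)" .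
  moreover have "integral {0..pi} l \<ge> 0"
    using l by (intro integral_nonneg integrable_continuous_real) auto
  ultimately have "measure lborel E = integral {0..pi} l" by (simp add: measure_def)
  then show ?thesis using 1 by simp
qed

section \<open>Half sectors and their reflections\<close>

lemma sin_periodic_int: "sin (x + 2 * pi * real_of_int k) = sin x"
  and cos_periodic_int: "cos (x + 2 * pi * real_of_int k) = cos x"
proof -
  have "\<exists>n::int. x + 2 * pi * real_of_int k = x + 2 * pi * real_of_int n" by blast
  then have "sin (x + 2 * pi * real_of_int k) = sin x \<and> cos (x + 2 * pi * real_of_int k) = cos x"
    by (subst sin_cos_eq_iff) (simp add: mult_ac)
  then show "sin (x + 2 * pi * real_of_int k) = sin x" "cos (x + 2 * pi * real_of_int k) = cos x" by auto
qed

text \<open>Cut the window at a multiple of \<open>2 * pi\<close> and move the left piece one period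
  to the right: the result is a translate of the standard window.\<close>

lemma emeasure_periodic_window:
  fixes S :: "real set"
  assumes S: "S \<in> sets borel" and per: "\<And>x k. x + 2 * pi * real_of_int k \<in> S \<longleftrightarrow> x \<in> S"
  shows "emeasure lborel (S \<inter> {c<..c + 2 * pi}) = emeasure lborel (S \<inter> {0<..2 * pi})"
proof -
  have shift: "emeasure lborel (S \<inter> {a<..b}) = emeasure lborel (S \<inter> {a + 2 * pi * real_of_int k<..b + 2 * pi * real_of_int k})"
    for a b k
  proof -
    have "emeasure lborel (S \<inter> {a + 2 * pi * real_of_int k<..b + 2 * pi * real_of_int k})
        = emeasure (distr lborel borel ((+) (2 * pi * real_of_int k))) (S \<inter> {a + 2 * pi * real_of_int k<..b + 2 * pi * real_of_int k})"
      by (simp only: lborel_distr_plus)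
    also have "\<dots> = emeasure lborel ((+) (2 * pi * real_of_int k) -` (S \<inter> {a + 2 * pi * real_of_int k<..b + 2 * pi * real_of_int k}))"
      using S by (subst emeasure_distr) auto
    also have "(+) (2 * pi * real_of_int k) -` (S \<inter> {a + 2 * pi * real_of_int k<..b + 2 * pi * real_of_int k}) = S \<inter> {a<..b}"
    proof (rule set_eqI)
      fix x show "x \<in> (+) (2 * pi * real_of_int k) -` (S \<inter> {a + 2 * pi * real_of_int k<..b + 2 * pi * real_of_int k})
          \<longleftrightarrow> x \<in> S \<inter> {a<..b}"
        using per[of x k] by (simp add: add.commute[of _ x])
    qed
    finally show ?thesis ..
  qed
  define k where "k = \<lceil>c / (2 * pi)\<rceil>"
  define m where "m = 2 * pi * real_of_int k"
  have "c / (2 * pi) \<le> k" "k < c / (2 * pi) + 1" unfolding k_def by linarith+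
  then have m: "c \<le> m" "m \<le> c + 2 * pi" by (simp_all add: m_def field_simps)
  have add: "emeasure lborel (S \<inter> {x<..z}) = emeasure lborel (S \<inter> {x<..y}) + emeasure lborel (S \<inter> {y<..z})"
    if "x \<le> y" "y \<le> z" for x y z
  proof -
    have "S \<inter> {x<..z} = (S \<inter> {x<..y}) \<union> (S \<inter> {y<..z})" using that by auto
    moreover have "emeasure lborel (S \<inter> {x<..y}) + emeasure lborel (S \<inter> {y<..z}) = emeasure lborel ((S \<inter> {x<..y}) \<union> (S \<inter> {y<..z}))"
      using S by (intro plus_emeasure) auto
    ultimately show ?thesis by simp
  qed
  have "emeasure lborel (S \<inter> {c<..c + 2 * pi}) = emeasure lborel (S \<inter> {c<..m}) + emeasure lborel (S \<inter> {m<..c + 2 * pi})"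
    by (rule add[OF m])
  also have "emeasure lborel (S \<inter> {c<..m}) = emeasure lborel (S \<inter> {c + 2 * pi<..m + 2 * pi})"
    using shift[of c m 1] by simp
  also have "\<dots> + emeasure lborel (S \<inter> {m<..c + 2 * pi}) = emeasure lborel (S \<inter> {m<..m + 2 * pi})"
    using add[of m "c + 2 * pi" "m + 2 * pi"] m by (simp add: add.commute)
  also have "\<dots> = emeasure lborel (S \<inter> {0<..2 * pi})"
    using shift[of 0 "2 * pi" k] by (simp add: m_def add.commute)
  finally show ?thesis .
qed

lemma sin_pos_iff: "- pi < x \<Longrightarrow> x < pi \<Longrightarrow> sin x > 0 \<longleftrightarrow> x > 0"
  using sin_gt_zero[of x] sin_ge_zero[of "- x"] by (cases "x > 0") auto

text \<open>Relative to \<open>h\<close> the two conditions describe the half circles (0, pi) and (y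
  - pi, y) with y = \<psi> - 2h modulo 2pi. For y in [-pi, pi) they overlap in an arc of length |y|,
  which is the distance of \<psi> - 2h to the multiples of 2pi, that is,
  \<open>arccos (cos (\<psi> - 2 * h))\<close>.\<close>

lemma reflected_arcs_overlap:
  "emeasure lborel {\<theta>\<in>{0<..2 * pi}. sin (\<theta> - h) > 0 \<and> sin (\<psi> - \<theta> - h) > 0} = ennreal (arccos (cos (\<psi> - 2 * h)))"
proof -
  define S where "S = {\<theta>. sin (\<theta> - h) > 0 \<and> sin (\<psi> - \<theta> - h) > 0}"
  have "open S" unfolding S_def by (intro open_Collect_conj open_Collect_less continuous_intros)
  then have S: "S \<in> sets borel" by simp
  have per: "x + 2 * pi * real_of_int k \<in> S \<longleftrightarrow> x \<in> S" for x k
  proof -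
    have "sin (x + 2 * pi * real_of_int k - h) = sin (x - h)"
      using sin_periodic_int[of "x - h" k] by (simp add: algebra_simps)
    moreover have "sin (\<psi> - (x + 2 * pi * real_of_int k) - h) = sin (\<psi> - x - h)"
      using sin_periodic_int[of "\<psi> - x - h" "- k"] by (simp add: algebra_simps)
    ultimately show ?thesis by (simp add: S_def)
  qed
  \<comment> \<open>Chosen so that \<open>y\<close> is the representative of
    \<open>\<psi> - 2 * h\<close> in \<open>[- pi, pi)\<close>.\<close>
  define k where "k = \<lfloor>(\<psi> - 2 * h + pi) / (2 * pi)\<rfloor>"
  define y where "y = \<psi> - 2 * h - 2 * pi * real_of_int k"
  have "real_of_int k \<le> (\<psi> - 2 * h + pi) / (2 * pi)" "(\<psi> - 2 * h + pi) / (2 * pi) < real_of_int k + 1"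
    unfolding k_def by linarith+
  then have y: "- pi \<le> y" "y < pi" by (simp_all add: y_def field_simps)
  have \<psi>: "\<psi> - 2 * h = y + 2 * pi * real_of_int k" by (simp add: y_def)
  have cy: "cos (\<psi> - 2 * h) = cos y"
    unfolding \<psi> by (rule cos_periodic_int)
  have mem: "\<theta> \<in> S \<longleftrightarrow> \<theta> < h + pi \<and> (if 0 \<le> y then \<theta> < h + y else h + y + pi < \<theta>)"
    if "\<theta> \<in> {h<..h + 2 * pi}" for \<theta>
  proof -
    have 1: "sin (\<theta> - h) > 0 \<longleftrightarrow> \<theta> < h + pi"
      using that sin_gt_zero[of "\<theta> - h"] sin_le_zero[of "\<theta> - h"] by (cases "\<theta> < h + pi"; cases "\<theta> = h + 2 * pi") auto
    have 2: "sin (\<psi> - \<theta> - h) = sin (y - (\<theta> - h))"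
      using sin_periodic_int[of "y - (\<theta> - h)" k] \<psi> by (simp add: algebra_simps)
    have 3: "sin (y - (\<theta> - h)) > 0 \<longleftrightarrow> (if 0 \<le> y then \<theta> < h + y else h + y + pi < \<theta>)" if "\<theta> < h + pi"
    proof (cases "0 \<le> y")
      case True
      then show ?thesis using sin_pos_iff[of "y - (\<theta> - h)"] that y \<open>\<theta> \<in> {h<..h + 2 * pi}\<close> by auto
    next
      case False
      \<comment> \<open>For negative \<open>y\<close> the argument ranges over (-2pi, 0); adding pi
        brings it into the interval where the sign of the sine is the sign of its argument.\<close>
      have "sin (y - (\<theta> - h)) = - sin (y - (\<theta> - h) + pi)" by simp
      also have "\<dots> > 0 \<longleftrightarrow> sin (- (y - (\<theta> - h) + pi)) > 0" by (simp only: sin_minus)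
      also have "\<dots> \<longleftrightarrow> - (y - (\<theta> - h) + pi) > 0"
        using False that y \<open>\<theta> \<in> {h<..h + 2 * pi}\<close> by (intro sin_pos_iff) auto
      finally show ?thesis using False by auto
    qed
    show ?thesis using 1 2 3 by (auto simp: S_def)
  qed
  have "{\<theta>\<in>{0<..2 * pi}. sin (\<theta> - h) > 0 \<and> sin (\<psi> - \<theta> - h) > 0} = S \<inter> {0<..2 * pi}" by (auto simp: S_def)
  also have "emeasure lborel \<dots> = emeasure lborel (S \<inter> {h<..h + 2 * pi})"
    by (rule emeasure_periodic_window[OF S per, symmetric])
  also have "S \<inter> {h<..h + 2 * pi} = (if 0 \<le> y then {h<..<h + y} else {h + y + pi<..<h + pi})"
    using mem y pi_gt_zero by (auto split: if_splits)
  also have "emeasure lborel \<dots> = ennreal \<bar>y\<bar>" by simp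
  also have "\<bar>y\<bar> = arccos (cos y)" using y by (cases "0 \<le> y") (auto simp: arccos_cos arccos_cos2)
  finally show ?thesis by (simp add: cy)
qed

abbreviation half_sector :: "(real \<Rightarrow> real) \<Rightarrow> (real^2) set" where
  "half_sector h \<equiv> sector h (\<lambda>\<rho>. h \<rho> + pi)"

text \<open>The sign of a sine does not depend on the representative of the angle, which frees later
  arguments from choosing windows.\<close>

lemma polar_in_half_sector:
  assumes "0 < \<rho>" "\<rho> \<le> R"
  shows "polar (\<theta>, \<rho>) \<in> half_sector h \<longleftrightarrow> sin (\<theta> - h \<rho>) > 0"
proof
  assume "polar (\<theta>, \<rho>) \<in> half_sector h"
  then obtain \<theta>' where \<theta>': "polar (\<theta>, \<rho>) = polar (\<theta>', \<rho>)" "h \<rho> < \<theta>'" "\<theta>' < h \<rho> + pi"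
    using sectorE[of "polar (\<theta>, \<rho>)"] assms by fastforce
  then obtain k :: int where k: "\<theta> = \<theta>' + 2 * pi * k" using polar_eq_iff[OF assms(1)] by blast
  then have "sin (\<theta> - h \<rho>) = sin (\<theta>' - h \<rho>)"
    using sin_periodic_int[of "\<theta>' - h \<rho>" k] by (simp add: algebra_simps)
  then show "sin (\<theta> - h \<rho>) > 0" using \<theta>' by (simp add: sin_gt_zero)
next
  assume s: "sin (\<theta> - h \<rho>) > 0"
  obtain \<theta>' where \<theta>': "h \<rho> \<le> \<theta>'" "\<theta>' < h \<rho> + 2 * pi" "polar (\<theta>, \<rho>) = polar (\<theta>', \<rho>)"
    using polar_exists_from[of "h \<rho>" "polar (\<theta>, \<rho>)"] assms by auto
  then obtain k :: int where k: "\<theta> = \<theta>' + 2 * pi * k" using polar_eq_iff[OF assms(1)] by blast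
  then have "sin (\<theta> - h \<rho>) = sin (\<theta>' - h \<rho>)"
    using sin_periodic_int[of "\<theta>' - h \<rho>" k] by (simp add: algebra_simps)
  then have "\<theta>' \<noteq> h \<rho>" "\<theta>' < h \<rho> + pi"
    using s sin_le_zero[of "\<theta>' - h \<rho>"] \<theta>' by (auto simp: not_le[symmetric])
  then show "polar (\<theta>, \<rho>) \<in> half_sector h" unfolding \<theta>'(3) using \<theta>' assms by (intro sectorI) auto
qed

lemma half_sector_subset_disk: "half_sector h \<subseteq> disk"
  by (auto simp: sector_def disk_def)

lemma radius_of_area: "\<tau> \<in> {0<..pi} \<Longrightarrow> 0 < sqrt \<tau> / pi \<and> sqrt \<tau> / pi \<le> R"
proof -
  assume \<tau>: "\<tau> \<in> {0<..pi}"
  then have "sqrt \<tau> / pi \<le> sqrt pi / pi" by (simp add: divide_right_mono)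
  also have "\<dots> = R" by (simp add: field_simps)
  finally show ?thesis using \<tau> by simp
qed

context
  fixes h :: "real \<Rightarrow> real"
  assumes cont: "continuous_on {0..R} h"
begin

text \<open>It is the disk minus a closed set: the opposite sector together with both
  branches.\<close>

lemma half_sector_borel: "half_sector h \<in> sets borel"
proof -
  have cont': "continuous_on {0..R} (\<lambda>\<rho>. h \<rho> + pi)" "continuous_on {0..R} (\<lambda>\<rho>. h \<rho> + 2 * pi)"
    by (intro continuous_intros cont)+
  note f = sectors_facts[of h "\<lambda>\<rho>. h \<rho> + pi", OF cont cont'(1), simplified]
  let ?tb = "two_branches h (\<lambda>\<rho>. h \<rho> + pi)" and ?L = "closed_sector (\<lambda>\<rho>. h \<rho> + pi) (\<lambda>\<rho>. h \<rho> + 2 * pi)"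
  have "?tb \<subseteq> ?L"
  proof
    fix x assume "x \<in> ?tb"
    then obtain \<rho> where \<rho>: "\<rho> \<in> {0..R}" "x = polar (h \<rho>, \<rho>) \<or> x = polar (h \<rho> + pi, \<rho>)"
      unfolding two_branches_def by blast
    have "polar (h \<rho>, \<rho>) = polar (h \<rho> + 2 * pi, \<rho>)" by (simp add: vec2_eq_iff)
    then have "x = polar (h \<rho> + 2 * pi, \<rho>) \<or> x = polar (h \<rho> + pi, \<rho>)" using \<rho>(2) by simp
    then obtain \<theta> where "x = polar (\<theta>, \<rho>)" "h \<rho> + pi \<le> \<theta>" "\<theta> \<le> h \<rho> + 2 * pi"
      using pi_ge_zero by (metis add_le_cancel_left le_add_same_cancel1 mult_2 order_refl)
    then show "x \<in> ?L" using \<rho>(1) unfolding closed_sector_def by auto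
  qed
  then have "half_sector h = disk - ?L" using f by blast
  moreover have "closed ?L" by (rule closed_sector_closed[OF cont']) simp
  moreover have "closed disk" by (simp add: disk_def)
  ultimately show ?thesis by simp
qed

lemma continuous_on_radius_of_area: "continuous_on {0..pi} (\<lambda>\<tau>. h (sqrt \<tau> / pi))"
proof (rule continuous_on_compose2[OF cont])
  show "(\<lambda>\<tau>. sqrt \<tau> / pi) ` {0..pi} \<subseteq> {0..R}"
  proof
    fix x assume "x \<in> (\<lambda>\<tau>. sqrt \<tau> / pi) ` {0..pi}"
    then obtain \<tau> where \<tau>: "0 \<le> \<tau>" "\<tau> \<le> pi" "x = sqrt \<tau> / pi" by auto
    then have "x \<le> sqrt pi / pi" by (simp add: divide_right_mono)
    also have "\<dots> = R" by (simp add: field_simps)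
    finally show "x \<in> {0..R}" using \<tau> by simp
  qed
qed (intro continuous_intros; simp)

text \<open>The reflection is an involution, so its image is a preimage and hence Borel; on each
  circle the overlap is that of a half circle with its mirror image.\<close>

lemma reflection_overlap_measure:
  assumes s: "isometry s" "s 0 = 0" "\<And>\<theta> r. s (polar (\<theta>, r)) = polar (\<psi> - \<theta>, r)"
  shows "half_sector h \<inter> s ` half_sector h \<in> sets borel"
    "measure lebesgue (half_sector h \<inter> s ` half_sector h) =
      integral {0..pi} (\<lambda>\<tau>. arccos (cos (\<psi> - 2 * h (sqrt \<tau> / pi)))) / (2 * pi\<^sup>2)"
proof -
  have ss: "s (s x) = x" for x
    using polar_exists[of x] s(3) by (metis diff_diff_eq2 add_diff_cancel_left' diff_add_cancel)
  have img: "s ` X = s -` X" for X using ss by (auto simp: image_iff) metis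
  have "s -` half_sector h \<inter> space borel \<in> sets borel"
    by (rule measurable_sets[OF borel_measurable_continuous_onI half_sector_borel])
      (rule isometry_continuous[OF s(1)])
  then show B: "half_sector h \<inter> s ` half_sector h \<in> sets borel"
    using half_sector_borel img by auto
  show "measure lebesgue (half_sector h \<inter> s ` half_sector h) =
      integral {0..pi} (\<lambda>\<tau>. arccos (cos (\<psi> - 2 * h (sqrt \<tau> / pi)))) / (2 * pi\<^sup>2)"
  proof (rule polar_measure[OF B])
    show "half_sector h \<inter> s ` half_sector h \<subseteq> disk" using half_sector_subset_disk by blast
    show "continuous_on {0..pi} (\<lambda>\<tau>. arccos (cos (\<psi> - 2 * h (sqrt \<tau> / pi))))"
      by (intro continuous_on_arccos continuous_on_cos continuous_on_diff continuous_on_const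
          continuous_on_mult continuous_on_radius_of_area) auto
    show "0 \<le> arccos (cos (\<psi> - 2 * h (sqrt \<tau> / pi)))" for \<tau> by (simp add: arccos_lbound)
    fix \<tau> assume \<tau>: "\<tau> \<in> {0<..pi}"
    have "polar (\<theta>, sqrt \<tau> / pi) \<in> half_sector h \<inter> s ` half_sector h \<longleftrightarrow>
        sin (\<theta> - h (sqrt \<tau> / pi)) > 0 \<and> sin (\<psi> - \<theta> - h (sqrt \<tau> / pi)) > 0" for \<theta>
      using radius_of_area[OF \<tau>] unfolding img by (simp add: polar_in_half_sector s(3))
    then show "emeasure lborel {\<theta> \<in> {0<..2 * pi}. polar (\<theta>, sqrt \<tau> / pi) \<in> half_sector h \<inter> s ` half_sector h} =
        ennreal (arccos (cos (\<psi> - 2 * h (sqrt \<tau> / pi))))"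
      using reflected_arcs_overlap[of "h (sqrt \<tau> / pi)" \<psi>] by simp
  qed
qed

lemma half_sector_measure: "measure lebesgue (half_sector h) = 1/2"
proof -
  have "measure lebesgue (half_sector h) = integral {0..pi} (\<lambda>\<tau>. pi) / (2 * pi\<^sup>2)"
  proof (rule polar_measure[OF half_sector_borel half_sector_subset_disk])
    fix \<tau> assume \<tau>: "\<tau> \<in> {0<..pi}"
    define c where "c = h (sqrt \<tau> / pi)"
    \<comment> \<open>The reflection with parameter \<open>pi + 2 * c\<close> maps the half circle
      to itself, so the overlap formula returns its full length \<open>pi\<close>.\<close>
    have "sin (pi + 2 * c - \<theta> - c) = sin (\<theta> - c)" for \<theta>
      using sin_pi_minus[of "\<theta> - c"] by (simp add: algebra_simps)
    then have "{\<theta> \<in> {0<..2 * pi}. polar (\<theta>, sqrt \<tau> / pi) \<in> half_sector h} =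
        {\<theta> \<in> {0<..2 * pi}. sin (\<theta> - c) > 0 \<and> sin (pi + 2 * c - \<theta> - c) > 0}"
      using radius_of_area[OF \<tau>] by (auto simp: polar_in_half_sector c_def)
    then show "emeasure lborel {\<theta> \<in> {0<..2 * pi}. polar (\<theta>, sqrt \<tau> / pi) \<in> half_sector h} = ennreal pi"
      using reflected_arcs_overlap[of c "pi + 2 * c"] by simp
  qed auto
  then show ?thesis by (simp add: power2_eq_square)
qed

end

section \<open>The distance \<open>arccos (cos y)\<close> from \<open>y\<close> to the multiples of
  \<open>2 * pi\<close>\<close>

lemma arccos_cos_shift_pi: "arccos (cos y) + arccos (cos (y + pi)) = pi"
  by (simp add: arccos_minus)

lemma arccos_cos_periodic: "arccos (cos (y + 2 * pi * real_of_int k)) = arccos (cos y)"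
  by (simp only: cos_periodic_int)

lemma arccos_cos_eq_abs: "\<bar>y\<bar> \<le> pi \<Longrightarrow> arccos (cos y) = \<bar>y\<bar>"
  by (cases "0 \<le> y") (auto simp: arccos_cos arccos_cos2)

lemma arccos_cos_le_abs: "arccos (cos y) \<le> \<bar>y\<bar>"
  by (cases "\<bar>y\<bar> \<le> pi") (auto simp: arccos_cos_eq_abs intro: order_trans[OF arccos_ubound])

text \<open>As for any distance to a set: the multiple of \<open>2 * pi\<close> nearest to
  \<open>y\<close> is a competitor for \<open>x\<close>.\<close>

lemma arccos_cos_lipschitz: "\<bar>arccos (cos x) - arccos (cos y)\<bar> \<le> \<bar>x - y\<bar>"
proof -
  have *: "arccos (cos x) \<le> arccos (cos y) + \<bar>x - y\<bar>" for x y
  proof -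
    define k where "k = \<lfloor>(y + pi) / (2 * pi)\<rfloor>"
    have "real_of_int k \<le> (y + pi) / (2 * pi)" "(y + pi) / (2 * pi) < real_of_int k + 1"
      unfolding k_def by linarith+
    then have y: "\<bar>y - 2 * pi * real_of_int k\<bar> \<le> pi" by (simp add: field_simps abs_le_iff)
    have "arccos (cos x) = arccos (cos (x - 2 * pi * real_of_int k))"
      using arccos_cos_periodic[of x "- k"] by simp
    also have "\<dots> \<le> \<bar>x - 2 * pi * real_of_int k\<bar>" by (rule arccos_cos_le_abs)
    also have "\<dots> \<le> \<bar>y - 2 * pi * real_of_int k\<bar> + \<bar>x - y\<bar>" by linarith
    also have "\<bar>y - 2 * pi * real_of_int k\<bar> = arccos (cos y)"
      using arccos_cos_eq_abs[OF y] arccos_cos_periodic[of y "- k"] by simp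
    finally show ?thesis .
  qed
  show ?thesis using *[of x y] *[of y x] by linarith
qed

lemma continuous_arccos_cos:
  fixes f :: "real \<Rightarrow> real"
  assumes "continuous_on S f" shows "continuous_on S (\<lambda>t. arccos (cos (f t)))"
  using assms by (intro continuous_on_arccos continuous_on_cos) auto

lemma integral_step3:
  fixes t1 t2 b :: real
  assumes "0 \<le> t1" "t1 \<le> t2" "t2 \<le> b"
  shows "((\<lambda>t. if t \<le> t1 then 1 else if t \<le> t2 then -1 else 1) has_integral (2 * t1 - 2 * t2 + b)) {0..b}"
    (is "(?g has_integral _) _")
proof -
  have "((\<lambda>t. 1) has_integral (t1 - 0)) {0..t1}" using has_integral_const_real[of "1::real" 0 t1] assms by simp
  then have 1: "(?g has_integral (t1 - 0)) {0..t1}"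
    by (rule has_integral_eq[rotated]) auto
  have "((\<lambda>t. -1) has_integral (- (t2 - t1))) {t1..t2}" using has_integral_const_real[of "-1::real" t1 t2] assms by simp
  then have 2: "(?g has_integral (- (t2 - t1))) {t1..t2}"
    by (rule has_integral_spike_finite[of "{t1}", rotated 2]) auto
  have "((\<lambda>t. 1) has_integral (b - t2)) {t2..b}" using has_integral_const_real[of "1::real" t2 b] assms by simp
  then have 3: "(?g has_integral (b - t2)) {t2..b}"
    by (rule has_integral_spike_finite[of "{t2}", rotated 2]) (use assms in auto)
  have "(?g has_integral ((t1 - 0) + (- (t2 - t1)))) {0..t2}"
    by (rule has_integral_combine[OF assms(1,2) 1 2])
  then have "(?g has_integral ((t1 - 0) + (- (t2 - t1)) + (b - t2))) {0..b}"
    using assms by (intro has_integral_combine[OF _ _ _ 3]) auto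
  then show ?thesis by (simp add: algebra_simps)
qed

text \<open>Differentiate the constant integral in \<psi> at \<open>2 * a\<close>. The distance
  function has slope +1 where 2a - 2k is in [0, pi), slope -1 in [-pi, 0) and slope +1 in [-2pi,
  -pi). As \<open>k\<close> increases, these ranges are the intervals cut out by \<open>t1\<close>
  and \<open>t2\<close>, so t1 - (t2 - t1) + (pi - t2) = 0.\<close>

lemma quarter_period_shift:
  fixes k :: "real \<Rightarrow> real"
  assumes cont: "continuous_on {0..pi} k" and mono: "strict_mono_on {0..pi} k"
    and k0: "k 0 = 0" and kpi: "k pi = pi"
    and M: "\<And>\<psi>. integral {0..pi} (\<lambda>\<tau>. arccos (cos (\<psi> - 2 * k \<tau>))) = M"
    and a: "0 < a" "a < pi / 2"
    and t: "t1 \<in> {0..pi}" "t2 \<in> {0..pi}" "k t1 = a" "k t2 = a + pi / 2"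
  shows "t2 = t1 + pi / 2"
proof -
  have less: "k x < k y \<longleftrightarrow> x < y" if "x \<in> {0..pi}" "y \<in> {0..pi}" for x y
    using that mono by (meson strict_mono_on_less)
  have t12: "t1 < t2" using less[OF t(1,2)] t a by simp
  \<comment> \<open>Difference quotients in \<psi> with positive step \<open>1 / Suc n\<close>.
    Being one-sided, they are eventually equal to their limit at every point, also at the kinks 0
    and -pi, where \<open>g\<close> takes the right-hand slope; the Lipschitz bound 1 dominates
    them.\<close>
  define f where "f n \<tau> = real (Suc n) * (arccos (cos (2 * a + 1 / real (Suc n) - 2 * k \<tau>)) - arccos (cos (2 * a - 2 * k \<tau>)))" for n :: nat and \<tau>
  define g where "g = (\<lambda>t. if t \<le> t1 then 1 else if t \<le> t2 then -1 else (1::real))"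
  have ac: "continuous_on {0..pi} (\<lambda>\<tau>. arccos (cos (\<psi> - 2 * k \<tau>)))" for \<psi>
    by (intro continuous_arccos_cos continuous_intros cont)
  have "(\<lambda>n. integral {0..pi} (f n)) \<longlonglongrightarrow> integral {0..pi} g"
  proof (rule dominated_convergence(2)[where h = "\<lambda>_. 1"])
    show "f n integrable_on {0..pi}" for n
      unfolding f_def by (intro integrable_continuous_real continuous_intros ac)
    show "(\<lambda>_. 1::real) integrable_on {0..pi}" by (rule integrable_const_ivl)
    show "norm (f n \<tau>) \<le> 1" for n \<tau>
    proof -
      have "\<bar>arccos (cos (2 * a + 1 / real (Suc n) - 2 * k \<tau>)) - arccos (cos (2 * a - 2 * k \<tau>))\<bar> \<le> 1 / real (Suc n)"
        using arccos_cos_lipschitz[of "2 * a + 1 / real (Suc n) - 2 * k \<tau>" "2 * a - 2 * k \<tau>"] by simp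
      then have "real (Suc n) * \<bar>arccos (cos (2 * a + 1 / real (Suc n) - 2 * k \<tau>)) - arccos (cos (2 * a - 2 * k \<tau>))\<bar>
          \<le> real (Suc n) * (1 / real (Suc n))" by (intro mult_left_mono) auto
      then show ?thesis by (simp add: f_def abs_mult)
    qed
    show "(\<lambda>n. f n \<tau>) \<longlonglongrightarrow> g \<tau>" if \<tau>: "\<tau> \<in> {0..pi}" for \<tau>
    proof (rule tendsto_eventually)
      define y where "y = 2 * a - 2 * k \<tau>"
      have kr: "0 \<le> k \<tau>" "k \<tau> \<le> pi"
        using less[of \<tau> 0] less[of pi \<tau>] \<tau> k0 kpi by auto
      have small: "\<forall>\<^sub>F n in sequentially. 1 / real (Suc n) < e" if "e > 0" for e :: real
        using that order_tendstoD(2)[OF LIMSEQ_inverse_real_of_nat] by (simp add: inverse_eq_divide)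
      have f: "f n \<tau> = real (Suc n) * (arccos (cos (y + 1 / real (Suc n))) - arccos (cos y))" for n
        unfolding f_def y_def by (simp add: algebra_simps)
      consider "\<tau> \<le> t1" | "t1 < \<tau>" "\<tau> \<le> t2" | "t2 < \<tau>" by linarith
      then show "\<forall>\<^sub>F n in sequentially. f n \<tau> = g \<tau>"
      proof cases
        case 1
        then have y: "0 \<le> y" "y < pi" using less[OF t(1) \<tau>] t(3) kr a by (auto simp: y_def)
        have "\<forall>\<^sub>F n in sequentially. 1 / real (Suc n) < pi - y" using y by (intro small) simp
        then show ?thesis
        proof eventually_elim
          case (elim n)
          then have "arccos (cos (y + 1 / real (Suc n))) = y + 1 / real (Suc n)" "arccos (cos y) = y"
            using y by (auto intro!: arccos_cos)
          then show ?case unfolding f using 1 by (simp add: g_def)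
        qed
      next
        case 2
        then have y: "- pi \<le> y" "y < 0" using less[OF t(1) \<tau>] less[OF t(2) \<tau>] t kr a by (auto simp: y_def)
        have "\<forall>\<^sub>F n in sequentially. 1 / real (Suc n) < - y" using y by (intro small) simp
        then show ?thesis
        proof eventually_elim
          case (elim n)
          have "1 / real (Suc n) > 0" by simp
          then have "y + 1 / real (Suc n) \<le> 0" "- pi \<le> y + 1 / real (Suc n)" using y elim by linarith+
          then have "arccos (cos (y + 1 / real (Suc n))) = - (y + 1 / real (Suc n))" "arccos (cos y) = - y"
            using y by (intro arccos_cos2; simp)+
          then show ?case unfolding f using 2 by (simp add: g_def)
        qed
      next
        case 3
        then have y: "- 2 * pi \<le> y" "y < - pi" using less[OF t(2) \<tau>] t kr a by (auto simp: y_def)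
        have "\<forall>\<^sub>F n in sequentially. 1 / real (Suc n) < - pi - y" using y by (intro small) simp
        then show ?thesis
        proof eventually_elim
          case (elim n)
          have "1 / real (Suc n) > 0" by simp
          then have "0 \<le> y + 1 / real (Suc n) + 2 * pi" "y + 1 / real (Suc n) + 2 * pi \<le> pi" using y elim by linarith+
          then have "arccos (cos (y + 1 / real (Suc n) + 2 * pi)) = y + 1 / real (Suc n) + 2 * pi" "arccos (cos (y + 2 * pi)) = y + 2 * pi"
            using y by (intro arccos_cos; simp)+
          then have "arccos (cos (y + 1 / real (Suc n))) = y + 1 / real (Suc n) + 2 * pi" "arccos (cos y) = y + 2 * pi"
            by simp_all
          then show ?case unfolding f using 3 t12 by (simp add: g_def)
        qed
      qed
    qed
  qed
  moreover have "integral {0..pi} (f n) = 0" for n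
  proof -
    have "integral {0..pi} (f n) = real (Suc n) * (M - M)"
      unfolding f_def integral_mult_right
      by (subst integral_diff) (auto simp only: M intro!: integrable_continuous_real ac)
    then show ?thesis by simp
  qed
  ultimately have "integral {0..pi} g = 0" by (simp add: LIMSEQ_const_iff)
  moreover have "integral {0..pi} g = 2 * t1 - 2 * t2 + pi"
    unfolding g_def using integral_step3[of t1 t2 pi] t t12 by (intro integral_unique) auto
  ultimately show ?thesis by simp
qed

context
  fixes h :: "real \<Rightarrow> real"
  assumes cont: "continuous_on {0..R} h"
begin

text \<open>Pointwise the integrands add up to pi: opposite points of the circle have supplementary
  distances from the point of angle 0.\<close>

lemma reflection_overlap_sum:
  "integral {0..pi} (\<lambda>\<tau>. arccos (cos (\<psi> - 2 * h (sqrt \<tau> / pi)))) +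
   integral {0..pi} (\<lambda>\<tau>. arccos (cos (\<psi> + pi - 2 * h (sqrt \<tau> / pi)))) = pi\<^sup>2"
proof -
  have i: "(\<lambda>\<tau>. arccos (cos (\<psi> - 2 * h (sqrt \<tau> / pi)))) integrable_on {0..pi}" for \<psi>
    by (intro integrable_continuous_real continuous_arccos_cos continuous_on_diff continuous_on_const
        continuous_on_mult continuous_on_radius_of_area[OF cont])
  have "integral {0..pi} (\<lambda>\<tau>. arccos (cos (\<psi> - 2 * h (sqrt \<tau> / pi)))) +
   integral {0..pi} (\<lambda>\<tau>. arccos (cos (\<psi> + pi - 2 * h (sqrt \<tau> / pi)))) =
    integral {0..pi} (\<lambda>\<tau>. arccos (cos (\<psi> - 2 * h (sqrt \<tau> / pi))) + arccos (cos (\<psi> + pi - 2 * h (sqrt \<tau> / pi))))"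
    by (rule integral_add[symmetric]) (rule i)+
  also have "\<dots> = integral {0..pi} (\<lambda>\<tau>. pi)"
  proof (rule integral_cong)
    fix \<tau>
    show "arccos (cos (\<psi> - 2 * h (sqrt \<tau> / pi))) + arccos (cos (\<psi> + pi - 2 * h (sqrt \<tau> / pi))) = pi"
      using arccos_cos_shift_pi[of "\<psi> - 2 * h (sqrt \<tau> / pi)"] by (simp add: algebra_simps)
  qed
  also have "\<dots> = pi\<^sup>2" by (simp add: power2_eq_square)
  finally show ?thesis .
qed

text \<open>The half sector meets its mirror image in a symmetric set, so perfection bounds the
  integral by pi^2/2 for \<psi> and also for \<psi> + pi. The two integrals add up to pi^2, so both
  bounds are attained.\<close>

lemma perfect_half_sector_overlap:
  assumes perf: "perfect (half_sector h)"
  shows "integral {0..pi} (\<lambda>\<tau>. arccos (cos (\<psi> - 2 * h (sqrt \<tau> / pi)))) = pi\<^sup>2 / 2"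
proof -
  have le: "integral {0..pi} (\<lambda>\<tau>. arccos (cos (\<psi> - 2 * h (sqrt \<tau> / pi)))) \<le> pi\<^sup>2 / 2" for \<psi>
  proof -
    obtain s where s: "isometry s" "s 0 = 0" "\<And>\<theta> r. s (polar (\<theta>, r)) = polar (\<psi> + (-1) * \<theta>, r)"
      using polar_map_isometry[of "-1" \<psi>] by blast
    then have sp: "\<And>\<theta> r. s (polar (\<theta>, r)) = polar (\<psi> - \<theta>, r)" by simp
    have ss: "s (s x) = x" for x
    proof -
      obtain \<theta> where x: "x = polar (\<theta>, norm x)" using polar_exists by blast
      have "s (s (polar (\<theta>, norm x))) = polar (\<theta>, norm x)" by (simp add: sp)
      then show ?thesis using x by simp
    qed
    let ?X = "half_sector h \<inter> s ` half_sector h"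
    have "s ` ?X = ?X"
    proof -
      have "inj s" by (rule isometry_inj[OF s(1,2)])
      then have "s ` ?X = s ` half_sector h \<inter> s ` s ` half_sector h" by (rule image_Int)
      also have "s ` s ` half_sector h = half_sector h" by (simp add: image_image ss)
      finally show ?thesis by blast
    qed
    moreover have "s \<noteq> id"
    proof
      assume "s = id"
      \<comment> \<open>This point lies on the line perpendicular to the axis of the reflection, so
        it is sent to its opposite.\<close>
      then have "polar ((\<psi> - pi) / 2, 1) = polar (\<psi> - (\<psi> - pi) / 2, 1)" using sp by (metis id_apply)
      also have "\<psi> - (\<psi> - pi) / 2 = (\<psi> - pi) / 2 + pi" by (simp add: field_simps)
      finally have "polar ((\<psi> - pi) / 2, 1) = - polar ((\<psi> - pi) / 2, 1)" by (simp only: polar_plus_pi)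
      then have "polar ((\<psi> - pi) / 2, 1) = 0" by (simp add: vec2_eq_iff)
      then show False by (metis norm_polar norm_zero abs_one zero_neq_one)
    qed
    moreover have "s \<in> disk_symmetries"
      using s isometry_image_disk[OF s(1,2)] by (simp add: disk_symmetries_def)
    moreover have "?X \<subseteq> disk" using half_sector_subset_disk by blast
    ultimately have sy: "symmetric_subset ?X" unfolding symmetric_subset_def by blast
    have "?X \<in> sets lebesgue" using reflection_overlap_measure(1)[OF cont s(1,2) sp] by simp
    then have "measure lebesgue ?X \<le> 1 / 4" using perf sy unfolding perfect_def by blast
    then have "integral {0..pi} (\<lambda>\<tau>. arccos (cos (\<psi> - 2 * h (sqrt \<tau> / pi)))) / (2 * pi\<^sup>2) \<le> 1 / 4"
      unfolding reflection_overlap_measure(2)[OF cont s(1,2) sp] .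
    then show ?thesis by (simp add: field_simps)
  qed
  show ?thesis using le[of \<psi>] le[of "\<psi> + pi"] reflection_overlap_sum[of \<psi>] by linarith
qed

end

section \<open>Fermat's spiral\<close>

text \<open>The integrand has period pi in \<tau>, and replacing \<psi> by \<psi> + pi amounts to
  shifting \<tau> by pi/2. Over a full period the two integrals agree, and they add up to
  pi^2.\<close>

lemma spiral_overlap:
  "integral {0..pi} (\<lambda>\<tau>. arccos (cos (\<psi> - 2 * \<tau>))) = pi\<^sup>2 / 2"
proof -
  define f where "f \<psi> \<tau> = arccos (cos (\<psi> - 2 * \<tau>))" for \<psi> \<tau> :: real
  have c: "continuous_on S (f \<psi>)" for \<psi> S
    unfolding f_def by (intro continuous_arccos_cos continuous_intros)
  then have i: "f \<psi> integrable_on {a..b}" for \<psi> a b by (rule integrable_continuous_real)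
  have per: "f \<psi> (\<tau> + pi) = f \<psi> \<tau>" for \<psi> \<tau>
    using arccos_cos_periodic[of "\<psi> - 2 * \<tau>" "-1"] by (simp add: f_def algebra_simps)
  have sh: "f (\<psi> + pi) (\<tau> + pi / 2) = f \<psi> \<tau>" for \<psi> \<tau> by (simp add: f_def algebra_simps)
  have shift: "integral {a - c..b - c} (\<lambda>x. g (x + c)) = integral {a..b} g" for a b c :: real and g :: "real \<Rightarrow> real"
    by (rule integral_shift_real_ivl)
  have "integral {0..pi} (f (\<psi> + pi)) = integral {0 - pi / 2..pi - pi / 2} (f \<psi>)"
    using shift[where a = 0 and b = pi and c = "pi / 2" and g = "f (\<psi> + pi)"] by (simp only: sh)
  also have "\<dots> = integral {- (pi / 2)..0} (f \<psi>) + integral {0..pi / 2} (f \<psi>)"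
    using Henstock_Kurzweil_Integration.integral_combine[where a = "- (pi / 2)" and c = 0 and b = "pi / 2" and f = "f \<psi>"] i by simp
  also have "integral {- (pi / 2)..0} (f \<psi>) = integral {pi / 2..pi} (f \<psi>)"
    using shift[where a = "pi / 2" and b = pi and c = pi and g = "f \<psi>"] by (simp add: per)
  also have "integral {pi / 2..pi} (f \<psi>) + integral {0..pi / 2} (f \<psi>) = integral {0..pi} (f \<psi>)"
    using Henstock_Kurzweil_Integration.integral_combine[where a = 0 and c = "pi / 2" and b = pi and f = "f \<psi>"] i by simp
  finally have "integral {0..pi} (f (\<psi> + pi)) = integral {0..pi} (f \<psi>)" .
  moreover have "integral {0..pi} (f \<psi>) + integral {0..pi} (f (\<psi> + pi)) = integral {0..pi} (\<lambda>\<tau>. pi)"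
  proof -
    have "integral {0..pi} (f \<psi>) + integral {0..pi} (f (\<psi> + pi)) = integral {0..pi} (\<lambda>\<tau>. f \<psi> \<tau> + f (\<psi> + pi) \<tau>)"
      by (rule integral_add[symmetric]) (rule i)+
    moreover have "f \<psi> \<tau> + f (\<psi> + pi) \<tau> = pi" for \<tau>
      using arccos_cos_shift_pi[of "\<psi> - 2 * \<tau>"] by (simp add: f_def algebra_simps)
    ultimately show ?thesis by simp
  qed
  ultimately show ?thesis unfolding f_def by (simp add: power2_eq_square)
qed

section \<open>Perfection of the two halves cut out by the spiral\<close>

text \<open>The recurrence a(k+2) + a(k) = 2 cos \<alpha> a(k+1) makes a positive sequence concave.
  A concave sequence that once decreases becomes negative, so this one increases; being bounded, it
  has a positive limit, which the recurrence allows only for cos \<alpha> = 1. The argument covers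
  rotations of infinite order as well.\<close>

lemma rotation_orbit_not_in_half_plane:
  assumes "\<And>k::nat. sin (b + real k * \<alpha>) > 0"
  shows "cos \<alpha> = 1"
proof (rule ccontr)
  assume "cos \<alpha> \<noteq> 1"
  then have c: "cos \<alpha> < 1" using cos_le_one[of \<alpha>] by linarith
  define a where "a k = sin (b + real k * \<alpha>)" for k :: nat
  have pos: "a k > 0" for k using assms by (simp add: a_def)
  have rec: "a (Suc (Suc k)) + a k = 2 * cos \<alpha> * a (Suc k)" for k
  proof -
    define y where "y = b + real (Suc k) * \<alpha>"
    have "a (Suc (Suc k)) = sin (y + \<alpha>)" "a k = sin (y - \<alpha>)" "a (Suc k) = sin y"
      unfolding a_def y_def by (simp_all add: algebra_simps)
    then show ?thesis by (simp add: sin_add sin_diff)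
  qed
  have dec: "a (Suc (Suc k)) - a (Suc k) \<le> a (Suc k) - a k" for k
  proof -
    have "cos \<alpha> * a (Suc k) \<le> 1 * a (Suc k)" using c pos[of "Suc k"] by (intro mult_right_mono) auto
    then show ?thesis using rec[of k] by simp
  qed
  have "a k \<le> a (Suc k)" for k
  proof (rule ccontr)
    assume "\<not> a k \<le> a (Suc k)"
    define d where "d = a k - a (Suc k)"
    have d: "d > 0" using \<open>\<not> a k \<le> a (Suc k)\<close> by (simp add: d_def)
    have step: "a (Suc (k + j)) - a (k + j) \<le> - d" for j
    proof (induction j)
      case (Suc j) then show ?case using dec[of "k + j"] by simp
    qed (simp add: d_def)
    have "a (k + j) \<le> a k - real j * d" for j
    proof (induction j)
      case (Suc j) then show ?case using step[of j] by (simp add: algebra_simps)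
    qed simp
    moreover obtain j :: nat where "a k < real j * d" using reals_Archimedean3[OF d] by blast
    ultimately show False using pos[of "k + j"] by (metis diff_less_0_iff_less less_asym order_le_less_trans)
  qed
  then have inc: "incseq a" by (simp add: incseq_Suc_iff)
  have "a k \<le> 1" for k by (simp add: a_def)
  then obtain L where L: "a \<longlonglongrightarrow> L" "\<forall>i. a i \<le> L" using incseq_convergent[OF inc] by blast
  have "(\<lambda>k. a (Suc (Suc k)) + a k) \<longlonglongrightarrow> L + L"
    by (intro tendsto_add L(1) LIMSEQ_Suc)
  moreover have "(\<lambda>k. 2 * cos \<alpha> * a (Suc k)) \<longlonglongrightarrow> 2 * cos \<alpha> * L"
    by (intro tendsto_mult tendsto_const L(1) LIMSEQ_Suc)
  ultimately have "L + L = 2 * cos \<alpha> * L" unfolding rec using LIMSEQ_unique by blast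
  moreover have "L > 0" using L(2) pos[of 0] by (meson less_le_trans)
  ultimately show False using \<open>cos \<alpha> \<noteq> 1\<close> by simp
qed

definition spiral_angle :: "real \<Rightarrow> real \<Rightarrow> real" where
  "spiral_angle c \<rho> = pi\<^sup>2 * \<rho>\<^sup>2 + c"

lemma continuous_spiral_angle: "continuous_on S (spiral_angle c)"
  unfolding spiral_angle_def by (intro continuous_intros)

text \<open>A nontrivial rotation would keep a whole orbit on one open half circle, so a set in the
  sector that is invariant under it is empty. A set invariant under a reflection lies in the overlap
  of the sector with its mirror image, whose area is exactly 1/4.\<close>

lemma perfect_spiral_sector: "perfect (half_sector (spiral_angle c))"
  unfolding perfect_def
proof (intro conjI allI impI)
  let ?A = "half_sector (spiral_angle c)"
  note cont = continuous_spiral_angle[of "{0..R}" c]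
  show A: "?A \<subseteq> disk" by (rule half_sector_subset_disk)
  show "?A \<in> sets lebesgue" using half_sector_borel[OF cont] by simp
  show "measure lebesgue ?A = 1 / 2" by (rule half_sector_measure[OF cont])
  fix X assume X: "X \<subseteq> ?A \<and> X \<in> sets lebesgue \<and> symmetric_subset X"
  then obtain s where s: "s \<in> disk_symmetries" "s \<noteq> id" "s ` X = X" by (auto simp: symmetric_subset_def)
  then have si: "isometry s" "s 0 = 0" using disk_symmetry_fixes_origin by auto
  then obtain \<alpha> \<sigma> where \<sigma>: "\<sigma> = 1 \<or> \<sigma> = -1" and sp: "\<And>\<theta> r. s (polar (\<theta>, r)) = polar (\<alpha> + \<sigma> * \<theta>, r)"
    using isometry_polar by blast
  from \<sigma> show "measure lebesgue X \<le> 1 / 4"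
  proof
    assume \<sigma>1: "\<sigma> = 1"
    have "X = {}"
    proof (rule ccontr)
      assume "X \<noteq> {}"
      then obtain x where x: "x \<in> X" by blast
      then obtain \<theta> where \<theta>: "x = polar (\<theta>, norm x)" "0 < norm x" "norm x \<le> R"
        using sectorE[of x] X by blast
      have it: "polar (\<theta> + real k * \<alpha>, norm x) \<in> X" for k :: nat
      proof (induction k)
        case (Suc k)
        then have "s (polar (\<theta> + real k * \<alpha>, norm x)) \<in> X" using s(3) by blast
        then show ?case using sp \<sigma>1 by (simp add: algebra_simps)
      qed (use x \<theta>(1) in simp)
      have "sin (\<theta> - spiral_angle c (norm x) + real k * \<alpha>) > 0" for k
        using polar_in_half_sector[OF \<theta>(2,3), of "\<theta> + real k * \<alpha>" "spiral_angle c"] it[of k] X by (auto simp: algebra_simps)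
      then have "cos \<alpha> = 1" by (rule rotation_orbit_not_in_half_plane)
      moreover from this have "sin \<alpha> = 0" by (simp add: cos_one_sin_zero)
      ultimately have "polar (\<alpha> + \<theta>, r) = polar (\<theta>, r)" for \<theta> r
        by (simp add: vec2_eq_iff cos_add sin_add)
      then have "s x = x" for x using sp \<sigma>1 polar_exists[of x] by (metis mult_1)
      then show False using s(2) by auto
    qed
    then show ?thesis by simp
  next
    assume "\<sigma> = -1"
    then have sp': "\<And>\<theta> r. s (polar (\<theta>, r)) = polar (\<alpha> - \<theta>, r)" using sp by simp
    let ?Y = "?A \<inter> s ` ?A"
    have "X \<subseteq> ?Y" using X s(3) by blast
    have "measure lebesgue ?Y = integral {0..pi} (\<lambda>\<tau>. arccos (cos (\<alpha> - 2 * spiral_angle c (sqrt \<tau> / pi)))) / (2 * pi\<^sup>2)"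
      by (rule reflection_overlap_measure(2)[OF cont si sp'])
    also have "integral {0..pi} (\<lambda>\<tau>. arccos (cos (\<alpha> - 2 * spiral_angle c (sqrt \<tau> / pi)))) =
        integral {0..pi} (\<lambda>\<tau>. arccos (cos (\<alpha> - 2 * c - 2 * \<tau>)))"
    proof (rule integral_cong)
      fix \<tau> assume "\<tau> \<in> {0..pi}"
      then have "spiral_angle c (sqrt \<tau> / pi) = \<tau> + c" by (simp add: spiral_angle_def power_divide)
      then show "arccos (cos (\<alpha> - 2 * spiral_angle c (sqrt \<tau> / pi))) = arccos (cos (\<alpha> - 2 * c - 2 * \<tau>))"
        by (simp add: algebra_simps)
    qed
    also have "\<dots> / (2 * pi\<^sup>2) = 1 / 4" by (simp add: spiral_overlap)
    finally have "measure lebesgue ?Y = 1 / 4" .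
    moreover have "measure lebesgue X \<le> measure lebesgue ?Y"
    proof (rule measure_mono_fmeasurable[OF \<open>X \<subseteq> ?Y\<close>])
      show "X \<in> sets lebesgue" using X by blast
      show "?Y \<in> lmeasurable"
        using A reflection_overlap_measure(1)[OF cont si sp']
        by (intro bounded_set_imp_lmeasurable) (auto simp: disk_def intro: bounded_subset[OF bounded_cball])
    qed
    ultimately show ?thesis by simp
  qed
qed

section \<open>The six conditions for the spiral and its congruent copies\<close>

lemma pi_square_radius: "\<bar>r\<bar> \<le> R \<longleftrightarrow> pi\<^sup>2 * r\<^sup>2 \<le> pi"
proof -
  have "\<bar>r\<bar> \<le> R \<longleftrightarrow> r\<^sup>2 \<le> R\<^sup>2" using abs_le_square_iff[of r R] by simp
  also have "\<dots> \<longleftrightarrow> pi\<^sup>2 * r\<^sup>2 \<le> pi" unfolding R_square by (simp add: power2_eq_square field_simps)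
  finally show ?thesis .
qed

lemma fermat_spiral_alt: "fermat_spiral = (\<lambda>r. polar (pi\<^sup>2 * r\<^sup>2, r)) ` {-R..R}"
proof -
  have "{(\<phi>, r). pi\<^sup>2 * r\<^sup>2 = \<phi> \<and> 0 \<le> \<phi> \<and> \<phi> \<le> pi} = (\<lambda>r. (pi\<^sup>2 * r\<^sup>2, r)) ` {-R..R}"
  proof (intro set_eqI iffI)
    fix z assume "z \<in> {(\<phi>, r). pi\<^sup>2 * r\<^sup>2 = \<phi> \<and> 0 \<le> \<phi> \<and> \<phi> \<le> pi}"
    then obtain r where r: "z = (pi\<^sup>2 * r\<^sup>2, r)" "pi\<^sup>2 * r\<^sup>2 \<le> pi" by auto
    then have "\<bar>r\<bar> \<le> R" using pi_square_radius by blast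
    then show "z \<in> (\<lambda>r. (pi\<^sup>2 * r\<^sup>2, r)) ` {-R..R}" using r(1) by (simp add: abs_le_iff)
  next
    fix z assume "z \<in> (\<lambda>r. (pi\<^sup>2 * r\<^sup>2, r)) ` {-R..R}"
    then obtain r where r: "z = (pi\<^sup>2 * r\<^sup>2, r)" "\<bar>r\<bar> \<le> R" by (auto simp: abs_le_iff)
    then show "z \<in> {(\<phi>, r). pi\<^sup>2 * r\<^sup>2 = \<phi> \<and> 0 \<le> \<phi> \<and> \<phi> \<le> pi}" using pi_square_radius by auto
  qed
  then show ?thesis by (simp add: fermat_spiral_def image_image)
qed

lemma fermat_spiral_two_branches:
  "fermat_spiral = two_branches (spiral_angle 0) (\<lambda>\<rho>. spiral_angle 0 \<rho> + pi)"
proof -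
  have "{-R..R} = {0..R} \<union> uminus ` {0..R}" by (auto simp: image_iff)
  then have "fermat_spiral = (\<lambda>r. polar (pi\<^sup>2 * r\<^sup>2, r)) ` {0..R} \<union> (\<lambda>r. polar (pi\<^sup>2 * (- r)\<^sup>2, - r)) ` {0..R}"
    unfolding fermat_spiral_alt by (simp only: image_Un image_image)
  moreover have "polar (pi\<^sup>2 * (- \<rho>)\<^sup>2, - \<rho>) = polar (spiral_angle 0 \<rho> + pi, \<rho>)" for \<rho>
    by (simp add: polar_plus_pi polar_minus spiral_angle_def)
  ultimately show ?thesis
    unfolding two_branches_def by (simp only: spiral_angle_def add_0_right)
qed

lemma fermat_spiral_splits:
  "splits_disk_into fermat_spiral (half_sector (spiral_angle 0)) (half_sector (spiral_angle pi))"
proof -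
  have "splits_disk_into fermat_spiral (half_sector (spiral_angle 0))
      (sector (\<lambda>\<rho>. spiral_angle 0 \<rho> + pi) (\<lambda>\<rho>. spiral_angle 0 \<rho> + 2 * pi))"
    unfolding fermat_spiral_two_branches
    by (rule splits_two_branches) (auto intro!: continuous_intros continuous_spiral_angle)
  moreover have "(\<lambda>\<rho>. spiral_angle 0 \<rho> + pi) = spiral_angle pi" "(\<lambda>\<rho>. spiral_angle 0 \<rho> + 2 * pi) = (\<lambda>\<rho>. spiral_angle pi \<rho> + pi)"
    by (auto simp: spiral_angle_def)
  ultimately show ?thesis by simp
qed

lemma half_sector_opposite: "uminus ` half_sector h = half_sector (\<lambda>\<rho>. h \<rho> + pi)"
proof (intro set_eqI iffI)
  fix x assume "x \<in> uminus ` half_sector h"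
  then obtain \<theta> \<rho> where *: "x = - polar (\<theta>, \<rho>)" "0 < \<rho>" "\<rho> \<le> R" "h \<rho> < \<theta>" "\<theta> < h \<rho> + pi"
    unfolding sector_def by blast
  then have "x = polar (\<theta> + pi, \<rho>)" by (simp add: polar_plus_pi)
  then show "x \<in> half_sector (\<lambda>\<rho>. h \<rho> + pi)" using * by (auto intro!: sectorI)
next
  fix x assume "x \<in> half_sector (\<lambda>\<rho>. h \<rho> + pi)"
  then obtain \<theta> \<rho> where *: "x = polar (\<theta>, \<rho>)" "0 < \<rho>" "\<rho> \<le> R" "h \<rho> + pi < \<theta>" "\<theta> < h \<rho> + pi + pi"
    unfolding sector_def by blast
  then have "x = - polar (\<theta> - pi, \<rho>)" using polar_plus_pi[of "\<theta> - pi" \<rho>] by simp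
  moreover have "polar (\<theta> - pi, \<rho>) \<in> half_sector h" using * by (intro sectorI) auto
  ultimately show "x \<in> uminus ` half_sector h" by blast
qed

lemma fermat_spiral_splits_congruent: "splits_congruent fermat_spiral"
proof -
  have "isometry uminus" by (simp add: isometry_def dist_norm norm_minus_commute)
  moreover have "uminus ` half_sector (spiral_angle 0) = half_sector (spiral_angle pi)"
    unfolding half_sector_opposite by (simp add: spiral_angle_def[abs_def])
  ultimately have "congruent_sets (half_sector (spiral_angle 0)) (half_sector (spiral_angle pi))"
    unfolding congruent_sets_def by blast
  then show ?thesis using fermat_spiral_splits unfolding splits_congruent_def by blast
qed

lemma fermat_spiral_splits_perfect: "splits_perfect fermat_spiral"
  using fermat_spiral_splits perfect_spiral_sector unfolding splits_perfect_def by blast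

lemma fermat_spiral_crosses_circles: "crosses_circles_twice fermat_spiral"
  unfolding crosses_circles_twice_def
proof (intro allI impI)
  fix \<rho> assume \<rho>: "0 < \<rho> \<and> \<rho> \<le> R"
  define x where "x = polar (pi\<^sup>2 * \<rho>\<^sup>2, \<rho>)"
  have "fermat_spiral \<inter> sphere 0 \<rho> = {x, - x}"
  proof (intro set_eqI iffI)
    fix z assume "z \<in> fermat_spiral \<inter> sphere 0 \<rho>"
    then obtain r where r: "z = polar (pi\<^sup>2 * r\<^sup>2, r)" "norm z = \<rho>" unfolding fermat_spiral_alt by auto
    then have "r = \<rho> \<or> r = - \<rho>" by auto
    then show "z \<in> {x, - x}" using r by (auto simp: x_def polar_minus)
  next
    fix z assume "z \<in> {x, - x}"
    then have "\<exists>r\<in>{\<rho>, - \<rho>}. z = polar (pi\<^sup>2 * r\<^sup>2, r)" by (auto simp: x_def polar_minus)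
    moreover have "{\<rho>, - \<rho>} \<subseteq> {-R..R}" using \<rho> by auto
    ultimately have "z \<in> fermat_spiral" unfolding fermat_spiral_alt by blast
    moreover have "norm z = \<rho>" using \<open>z \<in> {x, - x}\<close> \<rho> by (auto simp: x_def)
    ultimately show "z \<in> fermat_spiral \<inter> sphere 0 \<rho>" by simp
  qed
  moreover have "x \<noteq> - x"
  proof
    assume "x = - x"
    then have "x = 0" by (simp add: vec2_eq_iff)
    then show False using \<rho> by (metis x_def norm_polar norm_zero abs_0_eq less_irrefl)
  qed
  ultimately show "card (fermat_spiral \<inter> sphere 0 \<rho>) = 2" by simp
qed

lemma radius_points:
  assumes "0 < R'" shows "closed_segment 0 (polar (\<theta>, R')) - {0} = {polar (\<theta>, r) |r. 0 < r \<and> r \<le> R'}"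
proof (intro set_eqI iffI)
  fix z assume z: "z \<in> closed_segment 0 (polar (\<theta>, R')) - {0}"
  then obtain c where c: "0 \<le> c" "c \<le> 1" "z = c *\<^sub>R polar (\<theta>, R')" by (auto simp: closed_segment_def)
  then have "c \<noteq> 0" using z by auto
  then show "z \<in> {polar (\<theta>, r) |r. 0 < r \<and> r \<le> R'}"
    using c assms by (auto simp: polar_scaleR[symmetric] intro!: exI[of _ "c * R'"] mult_left_le_one_le)
next
  fix z assume "z \<in> {polar (\<theta>, r) |r. 0 < r \<and> r \<le> R'}"
  then obtain r where r: "0 < r" "r \<le> R'" "z = polar (\<theta>, r)" by blast
  then have "z = (r / R') *\<^sub>R polar (\<theta>, R')" using assms by (simp flip: polar_scaleR)
  moreover have "z \<noteq> 0" using r by (metis norm_polar norm_zero abs_0_eq less_irrefl)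
  ultimately show "z \<in> closed_segment 0 (polar (\<theta>, R')) - {0}"
    using r assms by (auto simp: closed_segment_def intro!: exI[of _ "r / R'"])
qed

lemma fermat_spiral_crosses_radii: "crosses_radii_once fermat_spiral"
  unfolding crosses_radii_once_def
proof
  fix u :: "real^2" assume u: "u \<in> sphere 0 R"
  obtain \<theta>' where "- u = polar (\<theta>', norm (- u))" "- pi \<le> \<theta>'" "\<theta>' < - pi + 2 * pi" using polar_exists_from by blast
  \<comment> \<open>The angle is taken in \<open>(0, 2 * pi]\<close>: apart from the centre, the
    spiral meets the ray of angle 0 only at the outer end of its second branch, where the angle is
    \<open>2 * pi\<close>.\<close>
  define \<theta> where "\<theta> = (if \<theta>' + pi = 0 then 2 * pi else \<theta>' + pi)"
  have "u = polar (\<theta>' + pi, R)" using \<open>- u = polar (\<theta>', norm (- u))\<close> u unfolding polar_plus_pi by (metis mem_sphere_0 minus_minus norm_minus_cancel)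
  moreover have "polar (2 * pi, R) = polar (0, R)" by (simp add: vec2_eq_iff)
  ultimately have \<theta>: "u = polar (\<theta>, R)" "0 < \<theta>" "\<theta> \<le> 2 * pi"
    using \<open>- pi \<le> \<theta>'\<close> \<open>\<theta>' < - pi + 2 * pi\<close> unfolding \<theta>_def by simp_all
  \<comment> \<open>The value of pi^2 r^2 at the crossing: the first branch has angle \<tau> and
    serves angles up to pi, the second has angle \<tau> + pi.\<close>
  define \<tau> where "\<tau> = (if \<theta> \<le> pi then \<theta> else \<theta> - pi)"
  have \<tau>: "0 < \<tau>" "\<tau> \<le> pi" using \<theta> by (auto simp: \<tau>_def)
  define r0 where "r0 = sqrt \<tau> / pi"
  have r0: "0 < r0" "r0 \<le> R" "pi\<^sup>2 * r0\<^sup>2 = \<tau>"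
    using radius_of_area[of \<tau>] \<tau> by (auto simp: r0_def power_divide)
  have "fermat_spiral \<inter> closed_segment 0 u - {0} = fermat_spiral \<inter> (closed_segment 0 u - {0})" by blast
  also have "\<dots> = fermat_spiral \<inter> {polar (\<theta>, r) |r. 0 < r \<and> r \<le> R}" unfolding \<theta>(1) by (subst radius_points) auto
  also have "\<dots> = {polar (\<theta>, r0)}"
  proof (intro set_eqI iffI)
    fix z assume z: "z \<in> fermat_spiral \<inter> {polar (\<theta>, r) |r. 0 < r \<and> r \<le> R}"
    then obtain r where r: "z = polar (\<theta>, r)" "0 < r" "r \<le> R" by blast
    obtain \<rho> where \<rho>: "0 \<le> \<rho>" "z = polar (pi\<^sup>2 * \<rho>\<^sup>2, \<rho>) \<or> z = polar (pi\<^sup>2 * \<rho>\<^sup>2 + pi, \<rho>)"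
      using z unfolding fermat_spiral_two_branches two_branches_def by (auto simp: spiral_angle_def)
    then have "norm z = \<rho>" by auto
    then have "\<rho> = r" using r by simp
    define \<eta> where "\<eta> = pi\<^sup>2 * r\<^sup>2"
    have \<eta>: "0 < \<eta>" "\<eta> \<le> pi" using r pi_square_radius[of r] by (auto simp: \<eta>_def)
    have "\<eta> = \<tau>"
    proof -
      have "polar (\<theta>, r) = polar (\<eta>, r) \<or> polar (\<theta>, r) = polar (\<eta> + pi, r)"
        using \<rho>(2) r(1) \<open>\<rho> = r\<close> by (simp add: \<eta>_def)
      then obtain k :: int where "\<theta> = \<eta> + 2 * pi * k \<or> \<theta> = \<eta> + pi + 2 * pi * k"
        using polar_eq_iff[OF r(2)] by blast
      moreover from this have "\<bar>2 * pi * k\<bar> < 2 * pi" using \<theta> \<eta> by linarith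
      then have "k = 0" by (rule int_multiple_2pi_small)
      ultimately show ?thesis using \<theta> \<eta> by (auto simp: \<tau>_def)
    qed
    then have "pi\<^sup>2 * r\<^sup>2 = pi\<^sup>2 * r0\<^sup>2" using r0(3) by (simp only: \<eta>_def)
    then have "r\<^sup>2 = r0\<^sup>2" by simp
    then have "r = r0" using r(2) r0(1) by (simp add: power2_eq_iff)
    then show "z \<in> {polar (\<theta>, r0)}" using r by simp
  next
    fix z assume "z \<in> {polar (\<theta>, r0)}"
    then have z: "z = polar (\<theta>, r0)" by simp
    have "z = polar (spiral_angle 0 r0, r0) \<or> z = polar (spiral_angle 0 r0 + pi, r0)"
      unfolding z spiral_angle_def r0(3) by (simp add: \<tau>_def)
    then have "z \<in> fermat_spiral" unfolding fermat_spiral_two_branches two_branches_def using r0 by auto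
    then show "z \<in> fermat_spiral \<inter> {polar (\<theta>, r) |r. 0 < r \<and> r \<le> R}" using z r0 by blast
  qed
  finally show "card (fermat_spiral \<inter> closed_segment 0 u - {0}) = 1" by simp
qed

definition spiral_param :: "real \<Rightarrow> real^2" where
  "spiral_param t = polar (pi * (2 * t - 1)\<^sup>2, R * (2 * t - 1))"

lemma spiral_param_image: "path_image spiral_param = fermat_spiral"
proof -
  have "pi\<^sup>2 * (R * (2 * t - 1))\<^sup>2 = pi * (2 * t - 1)\<^sup>2" for t
    by (simp add: power_mult_distrib R_square power2_eq_square)
  then have 1: "spiral_param = (\<lambda>r. polar (pi\<^sup>2 * r\<^sup>2, r)) \<circ> (\<lambda>t. R * (2 * t - 1))"
    by (auto simp: spiral_param_def)
  have 2: "(\<lambda>t. R * (2 * t - 1)) ` {0..1} = {-R..R}"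
  proof (intro set_eqI iffI)
    fix x assume "x \<in> (\<lambda>t. R * (2 * t - 1)) ` {0..1}"
    then obtain t where t: "0 \<le> t" "t \<le> 1" "x = R * (2 * t - 1)" by auto
    have "R * (2 * t - 1) \<le> R * 1" "R * (-1) \<le> R * (2 * t - 1)" using t by (intro mult_left_mono; simp)+
    then show "x \<in> {-R..R}" using t by simp
  next
    fix x assume "x \<in> {-R..R}"
    then have x: "- R \<le> x" "x \<le> R" by auto
    have "x = R * (2 * ((x / R + 1) / 2) - 1)" by (simp add: field_simps)
    moreover have "0 \<le> (x / R + 1) / 2" "(x / R + 1) / 2 \<le> 1"
      using x R_pos by (simp_all add: field_simps)
    ultimately show "x \<in> (\<lambda>t. R * (2 * t - 1)) ` {0..1}"
      by (intro image_eqI[of _ _ "(x / R + 1) / 2"]) simp_all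
  qed
  show ?thesis unfolding path_image_def fermat_spiral_alt 1 image_comp[symmetric] 2 ..
qed

lemma spiral_param_arc: "arc spiral_param"
  unfolding arc_def path_def
proof
  show "continuous_on {0..1} spiral_param"
    unfolding spiral_param_def by (intro continuous_intros)
  show "inj_on spiral_param {0..1}"
  proof (rule inj_onI)
    fix s t assume eq: "spiral_param s = spiral_param t"
    then have "\<bar>R * (2 * s - 1)\<bar> = \<bar>R * (2 * t - 1)\<bar>" unfolding spiral_param_def by (metis norm_polar)
    then have "\<bar>2 * s - 1\<bar> = \<bar>2 * t - 1\<bar>" by (simp add: abs_mult)
    then consider "s = t" | "2 * s - 1 = - (2 * t - 1)" by linarith
    then show "s = t"
    proof cases
      case 2
      then have "spiral_param s = - spiral_param t" unfolding spiral_param_def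
        by (simp only: 2 power2_minus mult_minus_right polar_minus)
      then have "spiral_param t = 0" using eq by (simp add: vec2_eq_iff)
      then have "\<bar>R * (2 * t - 1)\<bar> = 0" unfolding spiral_param_def by (metis norm_polar norm_zero)
      then show ?thesis using 2 by simp
    qed
  qed
qed

text \<open>Combinations of the cosine and sine of the phase pi (2t - 1)^2 with polynomial
  coefficients are closed under differentiation, which makes all derivatives of the parameterization
  explicit. The phase has derivative 4 pi (2t - 1).\<close>

definition trig_poly :: "real poly \<times> real poly \<Rightarrow> real \<Rightarrow> real" where
  "trig_poly pq t = poly (fst pq) t * cos (pi * (2 * t - 1)\<^sup>2) + poly (snd pq) t * sin (pi * (2 * t - 1)\<^sup>2)"

definition trig_deriv :: "real poly \<times> real poly \<Rightarrow> real poly \<times> real poly" where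
  "trig_deriv pq = (pderiv (fst pq) + smult (4 * pi) ([:-1, 2:] * snd pq),
                    pderiv (snd pq) - smult (4 * pi) ([:-1, 2:] * fst pq))"

lemma trig_poly_deriv: "(trig_poly pq has_real_derivative trig_poly (trig_deriv pq) t) (at t within S)"
proof -
  have 1: "((\<lambda>t. pi * (2 * t - 1)\<^sup>2) has_real_derivative 4 * pi * (2 * t - 1)) (at t within S)"
    by (auto intro!: derivative_eq_intros simp: algebra_simps)
  have 2: "((\<lambda>t. cos (pi * (2 * t - 1)\<^sup>2)) has_real_derivative - sin (pi * (2 * t - 1)\<^sup>2) * (4 * pi * (2 * t - 1))) (at t within S)"
    "((\<lambda>t. sin (pi * (2 * t - 1)\<^sup>2)) has_real_derivative cos (pi * (2 * t - 1)\<^sup>2) * (4 * pi * (2 * t - 1))) (at t within S)"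
    by (rule DERIV_fun_cos DERIV_fun_sin DERIV_chain2[OF DERIV_cos 1] DERIV_chain2[OF DERIV_sin 1])+
  have "(trig_poly pq has_real_derivative
      (poly (pderiv (fst pq)) t * cos (pi * (2 * t - 1)\<^sup>2) + (- sin (pi * (2 * t - 1)\<^sup>2) * (4 * pi * (2 * t - 1))) * poly (fst pq) t)
      + (poly (pderiv (snd pq)) t * sin (pi * (2 * t - 1)\<^sup>2) + (cos (pi * (2 * t - 1)\<^sup>2) * (4 * pi * (2 * t - 1))) * poly (snd pq) t)) (at t within S)"
    unfolding trig_poly_def
    by (intro DERIV_add DERIV_mult 2 has_field_derivative_at_within[OF poly_DERIV])
  then show ?thesis by (rule DERIV_cong) (simp add: trig_poly_def trig_deriv_def algebra_simps)
qed

lemma fermat_spiral_smooth: "smooth_curve fermat_spiral"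
proof -
  define P Q where "P k = (trig_deriv ^^ k) ([:- R, 2 * R:], 0)" and "Q k = (trig_deriv ^^ k) (0, [:- R, 2 * R:])" for k
  define F where "F k t = trig_poly (P k) t *\<^sub>R axis 1 1 + trig_poly (Q k) t *\<^sub>R (axis 2 1 :: real^2)" for k t
  have F0: "F 0 = spiral_param"
    by (rule ext) (simp add: F_def P_def Q_def trig_poly_def spiral_param_def vec2_eq_iff axis_def algebra_simps)
  have F: "(F k has_vector_derivative F (Suc k) t) (at t within S)" for k t S
  proof -
    have PQ: "P (Suc k) = trig_deriv (P k)" "Q (Suc k) = trig_deriv (Q k)" by (simp_all add: P_def Q_def)
    have *: "((\<lambda>t. trig_poly p t *\<^sub>R a) has_vector_derivative trig_poly (trig_deriv p) t *\<^sub>R a) (at t within S)" for p and a :: "real^2"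
      using has_vector_derivative_scaleR[OF trig_poly_deriv[of p t S] has_vector_derivative_const[of a]] by simp
    show ?thesis unfolding F_def PQ by (intro has_vector_derivative_add *)
  qed
  have "vector_derivative spiral_param (at t within {0..1}) \<noteq> 0" if t: "t \<in> {0..1}" for t
  proof
    assume "vector_derivative spiral_param (at t within {0..1}) = 0"
    moreover have "vector_derivative spiral_param (at t within {0..1}) = F 1 t"
      using F[of 0] F0 t by (intro smooth_vector_derivative) auto
    ultimately have z: "F 1 t $ 1 = 0" "F 1 t $ 2 = 0" by auto
    define C S where "C = cos (pi * (2 * t - 1)\<^sup>2)" and "S = sin (pi * (2 * t - 1)\<^sup>2)"
    have cs: "S\<^sup>2 + C\<^sup>2 = 1" unfolding C_def S_def by (rule sin_cos_squared_add)
    define d where "d = R * (2 * t - 1) * (4 * pi * (2 * t - 1))"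
    have "F 1 t $ 1 = 2 * R * C - d * S" "F 1 t $ 2 = d * C + 2 * R * S"
      by (simp_all add: F_def P_def Q_def trig_deriv_def trig_poly_def axis_def pderiv_pCons d_def
          flip: C_def S_def) (simp_all add: algebra_simps add_divide_distrib diff_divide_distrib)
    then have "2 * R * C - d * S = 0" "d * C + 2 * R * S = 0" using z by simp_all
    \<comment> \<open>This combination is the radial component of the derivative; it equals
      \<open>2 * R\<close> and never vanishes.\<close>
    then have "(2 * R * C - d * S) * C + (d * C + 2 * R * S) * S = 0" by (simp only: mult_zero_left add_0_left)
    then have "2 * R * (S\<^sup>2 + C\<^sup>2) = 0" by (simp only: power2_eq_square ring_distribs) (simp add: algebra_simps)
    then show False using cs R_pos by simp
  qed
  moreover have "infinitely_differentiable_on spiral_param {0..1}"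
    unfolding infinitely_differentiable_on_def using F0 F by blast
  ultimately show ?thesis
    unfolding smooth_curve_def using spiral_param_arc spiral_param_image by blast
qed

lemma fermat_spiral_algebraic: "algebraic_in_polar fermat_spiral"
proof -
  define g where "g t = (pi * (2 * t - 1)\<^sup>2, R * (2 * t - 1))" for t :: real
  have "arc g"
    unfolding arc_def path_def
  proof
    show "continuous_on {0..1} g" unfolding g_def by (intro continuous_intros)
    show "inj_on g {0..1}" by (auto simp: inj_on_def g_def)
  qed
  then have "is_curve (path_image g)" unfolding is_curve_def by blast
  moreover define P where "P = [:[:0, 0, - pi\<^sup>2:], 1:]"
  have "P \<noteq> 0" by (simp add: P_def)
  moreover have "\<forall>(\<phi>, r)\<in>path_image g. poly2 P \<phi> r = 0"
    by (auto simp: path_image_def g_def P_def poly2_def power_mult_distrib R_square power2_eq_square)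
  ultimately have "algebraic_curve (path_image g)" unfolding algebraic_curve_def by blast
  moreover have "fermat_spiral = polar ` path_image g"
    unfolding spiral_param_image[symmetric] path_image_def by (simp add: image_image spiral_param_def[abs_def] g_def)
  ultimately show ?thesis unfolding algebraic_in_polar_def by blast
qed

text \<open>The end points of the spiral are antipodal on the boundary circle. Their preimages lie
  in the disk at the same distance, the diameter, so they are antipodal too and the congruence fixes
  the centre.\<close>

lemma congruent_to_fermat_spiral:
  assumes "\<beta> \<subseteq> disk" "congruent_sets \<beta> fermat_spiral"
  shows "\<exists>g. isometry g \<and> g 0 = 0 \<and> \<beta> = g ` fermat_spiral"
proof -
  obtain f where f: "isometry f" "f ` \<beta> = fermat_spiral" using assms(2) by (auto simp: congruent_sets_def)
  have sp: "polar (pi\<^sup>2 * R\<^sup>2, R) \<in> fermat_spiral" "polar (pi\<^sup>2 * (- R)\<^sup>2, - R) \<in> fermat_spiral"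
    unfolding fermat_spiral_alt by (rule imageI, simp)+
  define e where "e = polar (pi\<^sup>2 * R\<^sup>2, R)"
  have "e \<in> fermat_spiral" "- e \<in> fermat_spiral" using sp unfolding e_def by (simp_all add: polar_minus)
  then obtain p q where pq: "p \<in> \<beta>" "q \<in> \<beta>" "f p = e" "f q = - e" using f(2) by (metis imageE)
  have e: "norm e = R" by (simp add: e_def)
  have n: "norm p \<le> R" "norm q \<le> R" using pq assms(1) by (auto simp: disk_def)
  have "dist p q = dist e (- e)" using f(1) pq unfolding isometry_def by metis
  also have "\<dots> = norm (2 *\<^sub>R e)" by (simp add: dist_norm scaleR_2)
  finally have "norm (p - q) = 2 * R" using e by (simp add: dist_norm)
  then have "q = - p" "norm p = R" using diametral_points[OF n] by auto
  then have f0: "f 0 = 0" using isometry_fixes_origin[OF f(1), of p R] pq e by simp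
  obtain g where g: "isometry g" "g 0 = 0" "\<And>x. g (f x) = x" "\<And>x. f (g x) = x"
    using isometry_inverse[OF f(1) f0] by blast
  have "g ` fermat_spiral = \<beta>" unfolding f(2)[symmetric] by (simp add: image_image g(3))
  then show ?thesis using g by blast
qed

lemma congruent_to_fermat_spiral_conditions:
  assumes "\<beta> \<subseteq> disk" "congruent_sets \<beta> fermat_spiral"
  shows "splits_congruent \<beta> \<and> crosses_circles_twice \<beta> \<and> crosses_radii_once \<beta> \<and>
    splits_perfect \<beta> \<and> smooth_curve \<beta> \<and> algebraic_in_polar \<beta>"
proof -
  obtain g where g: "isometry g" "g 0 = 0" "\<beta> = g ` fermat_spiral"
    using congruent_to_fermat_spiral[OF assms] by blast
  show ?thesis unfolding g(3)
    by (intro conjI splits_congruent_image crosses_circles_twice_image crosses_radii_once_image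
        splits_perfect_image smooth_curve_image algebraic_in_polar_image g(1,2)
        fermat_spiral_splits_congruent fermat_spiral_crosses_circles fermat_spiral_crosses_radii
        fermat_spiral_splits_perfect fermat_spiral_smooth fermat_spiral_algebraic)
qed

section \<open>The shape of the curve\<close>

lemma card_2_three:
  assumes "card S = 2" "a \<in> S" "b \<in> S" "c \<in> S" "a \<noteq> b" "a \<noteq> c" "b \<noteq> c" shows False
proof -
  have "finite S" using assms(1) card.infinite by fastforce
  then have "card {a, b, c} \<le> card S" using assms by (intro card_mono) auto
  then show False using assms by simp
qed

lemma IVT_strict:
  fixes f :: "real \<Rightarrow> real"
  assumes "continuous_on {a..b} f" "a \<le> b" "f a < v \<and> v < f b \<or> f b < v \<and> v < f a"
  shows "\<exists>x. a < x \<and> x < b \<and> f x = v"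
proof -
  have "\<exists>x. a \<le> x \<and> x \<le> b \<and> f x = v"
    using IVT'[of f a v b] IVT2'[of f b v a] assms by auto
  then obtain x where x: "a \<le> x" "x \<le> b" "f x = v" by blast
  moreover have "x \<noteq> a" "x \<noteq> b" using x assms(3) by auto
  ultimately show ?thesis by force
qed

text \<open>Applied to the norm along the curve. The maximum \<open>r\<close> is attained at
  \<open>p < q\<close>, and a value slightly below \<open>r\<close> is attained twice between them;
  a zero outside that interval would force a third time. With the zero between \<open>p\<close> and
  \<open>q\<close>, every value in (0, r) is used up once on each side of it, which leaves no
  parameters outside \<open>[p, q]\<close> and no repetition within a side.\<close>

lemma takes_values_twice_shape:
  fixes n :: "real \<Rightarrow> real"
  assumes cont: "continuous_on {0..1} n" and r: "0 < r"
    and bd: "\<And>t. t \<in> {0..1} \<Longrightarrow> 0 \<le> n t \<and> n t \<le> r"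
    and two: "\<And>\<rho>. 0 < \<rho> \<Longrightarrow> \<rho> \<le> r \<Longrightarrow> card {t\<in>{0..1}. n t = \<rho>} = 2"
    and zero: "\<And>s t. s \<in> {0..1} \<Longrightarrow> t \<in> {0..1} \<Longrightarrow> n s = 0 \<Longrightarrow> n t = 0 \<Longrightarrow> s = t"
  shows "\<exists>t0. 0 < t0 \<and> t0 < 1 \<and> n t0 = 0 \<and> n 0 = r \<and> n 1 = r \<and> inj_on n {0..t0} \<and> inj_on n {t0..1}"
proof -
  have c: "continuous_on {a..b} n" if "0 \<le> a" "b \<le> 1" for a b
    using that by (intro continuous_on_subset[OF cont]) auto
  have three: False if "0 < \<rho>" "\<rho> \<le> r" "a \<in> {0..1}" "b \<in> {0..1}" "c \<in> {0..1}" "n a = \<rho>" "n b = \<rho>" "n c = \<rho>"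
    "a < b" "b < c" for a b c \<rho>
    using card_2_three[OF two[OF that(1,2)], of a b c] that by auto
  obtain t0 where t0: "t0 \<in> {0..1}" "\<And>t. t \<in> {0..1} \<Longrightarrow> n t0 \<le> n t"
    using continuous_attains_inf[OF _ _ cont] by (metis atLeastAtMost_iff compact_Icc empty_iff order_refl zero_le_one)
  have n0: "n t0 = 0"
  proof (rule ccontr)
    assume "n t0 \<noteq> 0"
    then have *: "0 < n t0 / 2" "n t0 / 2 \<le> r" "n t0 / 2 < n t0" using bd[OF t0(1)] by auto
    then have "{t\<in>{0..1}. n t = n t0 / 2} \<noteq> {}" using two[OF *(1,2)] by (metis card.empty zero_neq_numeral)
    then obtain t where "t \<in> {0..1}" "n t = n t0 / 2" by blast
    then show False using t0(2)[of t] * by simp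
  qed
  obtain p q where pq: "p < q" "{t\<in>{0..1}. n t = r} = {p, q}"
    using two[OF r order_refl] unfolding card_2_iff by (metis insert_commute linorder_neqE_linordered_idom)
  have p: "p \<in> {0..1}" "n p = r" and q: "q \<in> {0..1}" "n q = r" using pq(2) by auto
  have only: "t = p \<or> t = q" if "t \<in> {0..1}" "n t = r" for t using pq(2) that by blast
  have mid: "n ((p + q) / 2) < r"
    using only[of "(p + q) / 2"] bd[of "(p + q) / 2"] pq(1) p q by force
  \<comment> \<open>Above the value at the midpoint and below the maximum, so \<open>v\<close> is
    attained on both sides of the midpoint.\<close>
  define v where "v = (n ((p + q) / 2) + r) / 2"
  have mI: "(p + q) / 2 \<in> {0..1}" using p q by auto
  have v: "n ((p + q) / 2) < v" "v < r" "0 < v" using mid bd[OF mI] by (auto simp: v_def)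
  obtain x2 where x2: "p < x2" "x2 < (p + q) / 2" "n x2 = v"
    using IVT_strict[of p "(p + q) / 2" n v] c[of p "(p + q) / 2"] v p q pq(1) by auto
  obtain x3 where x3: "(p + q) / 2 < x3" "x3 < q" "n x3 = v"
    using IVT_strict[of "(p + q) / 2" q n v] c[of "(p + q) / 2" q] v p q pq(1) by auto
  have pt: "p < t0"
  proof (rule ccontr)
    assume "\<not> p < t0"
    then obtain x1 where "t0 < x1" "x1 < p" "n x1 = v"
      using IVT_strict[of t0 p n v] c[of t0 p] v p t0 n0 by auto
    then show False using three[of v x1 x2 x3] x2 x3 v p q t0 by auto
  qed
  have tq: "t0 < q"
  proof (rule ccontr)
    assume "\<not> t0 < q"
    then obtain x1 where "q < x1" "x1 < t0" "n x1 = v"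
      using IVT_strict[of q t0 n v] c[of q t0] v q t0 n0 by auto
    then show False using three[of v x2 x3 x1] x2 x3 v p q t0 by auto
  qed
  have left: "\<exists>x. p < x \<and> x < t0 \<and> n x = \<rho>" if "0 < \<rho>" "\<rho> < r" for \<rho>
    using that p t0 n0 pt by (intro IVT_strict c) auto
  have right: "\<exists>x. t0 < x \<and> x < q \<and> n x = \<rho>" if "0 < \<rho>" "\<rho> < r" for \<rho>
    using that q t0 n0 tq by (intro IVT_strict c) auto
  have p0: "p = 0"
  proof (rule ccontr)
    assume "p \<noteq> 0"
    then have "0 < p" using p by auto
    have "n 0 \<noteq> 0" using zero[of 0 t0] n0 t0 \<open>0 < p\<close> pt by auto
    moreover have "n 0 \<noteq> r" using only[of 0] \<open>0 < p\<close> pq(1) by auto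
    ultimately have "0 < n 0" "n 0 < r" using bd[of 0] by auto
    then obtain x1 x2 where "p < x1" "x1 < t0" "n x1 = n 0" "t0 < x2" "x2 < q" "n x2 = n 0" using left right by blast
    then show False using three[of "n 0" 0 x1 x2] \<open>0 < p\<close> \<open>0 < n 0\<close> \<open>n 0 < r\<close> t0 p q by auto
  qed
  have q1: "q = 1"
  proof (rule ccontr)
    assume "q \<noteq> 1"
    then have "q < 1" using q by auto
    have "n 1 \<noteq> 0" using zero[of 1 t0] n0 t0 \<open>q < 1\<close> tq by auto
    moreover have "n 1 \<noteq> r" using only[of 1] \<open>q < 1\<close> pq(1) by auto
    ultimately have "0 < n 1" "n 1 < r" using bd[of 1] by auto
    then obtain x1 x2 where "p < x1" "x1 < t0" "n x1 = n 1" "t0 < x2" "x2 < q" "n x2 = n 1" using left right by blast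
    then show False using three[of "n 1" x1 x2 1] \<open>q < 1\<close> \<open>0 < n 1\<close> \<open>n 1 < r\<close> t0 p q by auto
  qed
  have "inj_on n {0..t0}"
  proof (rule linorder_inj_onI)
    fix s t assume st: "s < t" "s \<in> {0..t0}" "t \<in> {0..t0}"
    show "n s \<noteq> n t"
    proof
      assume eq: "n s = n t"
      have I: "s \<in> {0..1}" "t \<in> {0..1}" using st t0 by auto
      have "n s \<noteq> 0" using zero[OF I] eq st by auto
      moreover have "n s \<noteq> r" using only[OF I(1)] only[OF I(2)] eq st tq by auto
      ultimately have "0 < n s" "n s < r" using bd[OF I(1)] by auto
      then obtain x where "t0 < x" "x < q" "n x = n s" using right by blast
      then show False using three[of "n s" s t x] I st eq[symmetric] \<open>0 < n s\<close> \<open>n s < r\<close> q t0 by auto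
    qed
  qed auto
  moreover have "inj_on n {t0..1}"
  proof (rule linorder_inj_onI)
    fix s t assume st: "s < t" "s \<in> {t0..1}" "t \<in> {t0..1}"
    show "n s \<noteq> n t"
    proof
      assume eq: "n s = n t"
      have I: "s \<in> {0..1}" "t \<in> {0..1}" using st t0 by auto
      have "n s \<noteq> 0" using zero[OF I] eq st by auto
      moreover have "n s \<noteq> r" using only[OF I(1)] only[OF I(2)] eq st pt by auto
      ultimately have "0 < n s" "n s < r" using bd[OF I(1)] by auto
      then obtain x where "p < x" "x < t0" "n x = n s" using left by blast
      then show False using three[of "n s" x s t] I st eq[symmetric] \<open>0 < n s\<close> \<open>n s < r\<close> p t0 by auto
    qed
  qed auto
  ultimately show ?thesis using pt tq p0 q1 n0 p q by blast
qed

lemma strict_mono_on_continuous_inj: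
  fixes f :: "real \<Rightarrow> real"
  assumes cont: "continuous_on {a..b} f" and inj: "inj_on f {a..b}" and ab: "f a < f b"
  shows "strict_mono_on {a..b} f"
proof (rule strict_mono_onI)
  have tri: "(f x < f y \<and> f y < f z) \<or> (f z < f y \<and> f y < f x)" if "a \<le> x" "x < y" "y < z" "z \<le> b" for x y z
    using that by (intro continuous_inj_imp_mono) (auto intro: continuous_on_subset[OF cont] inj_on_subset[OF inj])
  fix x y assume xy: "x \<in> {a..b}" "y \<in> {a..b}" "x < y"
  have xb: "f x < f b"
  proof (cases "x = a")
    case False then show ?thesis using tri[of a x b] xy ab by auto
  qed (use ab in simp)
  show "f x < f y"
  proof (cases "y = b")
    case False then show ?thesis using tri[of x y b] xy xb by auto
  qed (use xb in simp)
qed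

text \<open>If \<open>f\<close> returned to \<open>f a\<close> at some \<open>s\<close>, an
  intermediate value would be attained both before and after the midpoint. The left end point will
  be the passage through the centre, about which the crossings with radii say nothing.\<close>

lemma inj_on_closed_interval:
  fixes f :: "real \<Rightarrow> real"
  assumes cont: "continuous_on {a..b} f" and inj: "inj_on f {a<..b}"
  shows "inj_on f {a..b}"
proof -
  have ne: "f s \<noteq> f a" if s: "a < s" "s \<le> b" for s
  proof
    assume eq: "f s = f a"
    define m where "m = (a + s) / 2"
    have m: "a < m" "m < s" using s by (auto simp: m_def)
    have mne: "f m \<noteq> f s" using inj_on_eq_iff[OF inj, of m s] m s by auto
    define v where "v = (f m + f a) / 2"
    have v: "f a < v \<and> v < f m \<or> f m < v \<and> v < f a" using mne eq by (auto simp: v_def field_simps)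
    have c: "continuous_on {a..m} f" "continuous_on {m..s} f"
      using m s by (auto intro: continuous_on_subset[OF cont])
    obtain x where x: "a < x" "x < m" "f x = v" using IVT_strict[OF c(1), of v] v m by auto
    obtain y where y: "m < y" "y < s" "f y = v" using IVT_strict[OF c(2), of v] v m eq by auto
    show False using inj_on_eq_iff[OF inj, of x y] x y m s by auto
  qed
  show ?thesis
  proof (rule linorder_inj_onI)
    fix x y assume "x < y" "x \<in> {a..b}" "y \<in> {a..b}"
    then show "f x \<noteq> f y" using ne[of y] inj_on_eq_iff[OF inj, of x y] by (cases "x = a") auto
  qed auto
qed

section \<open>Turning of the curve on either side of the centre\<close>

text \<open>The polar angle for positive radius. The continuous angle \<open>\<theta>\<close>
  follows the tangent through the centre, so before \<open>t0\<close> the point lies on the opposite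
  ray.\<close>

definition branch_angle :: "real \<Rightarrow> (real \<Rightarrow> real) \<Rightarrow> real \<Rightarrow> real" where
  "branch_angle t0 \<theta> t = (if t0 < t then \<theta> t else \<theta> t + pi)"

lemma int_multiple_in_window:
  fixes x c :: real shows "\<exists>k::int. c < x + 2 * pi * k \<and> x + 2 * pi * k \<le> c + 2 * pi"
proof -
  define k where "k = \<lfloor>(c + 2 * pi - x) / (2 * pi)\<rfloor>"
  have "real_of_int k \<le> (c + 2 * pi - x) / (2 * pi)" "(c + 2 * pi - x) / (2 * pi) < real_of_int k + 1"
    unfolding k_def by linarith+
  then have "x + 2 * pi * k \<le> c + 2 * pi" "c < x + 2 * pi * k" by (simp_all add: field_simps)
  then show ?thesis by blast
qed

text \<open>The hypotheses on \<open>D\<close> say that every ray is hit exactly once. With a =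
  \<theta> 1 and b = \<theta> 0, the right half sweeps (0, a] and the left half sweeps pi + (0, b],
  or pi + [b, 0) for negative b. These arcs must tile the circle, which forces a = b = pi.\<close>

lemma branch_angle_shape:
  fixes \<theta> :: "real \<Rightarrow> real" and t0 :: real
  defines "D \<equiv> branch_angle t0 \<theta>"
  assumes cont: "continuous_on {0..1} \<theta>" and t0: "0 < t0" "t0 < 1" "\<theta> t0 = 0"
    and inj: "\<And>s t k::int. s \<in> {0..1} - {t0} \<Longrightarrow> t \<in> {0..1} - {t0} \<Longrightarrow> D s = D t + 2 * pi * k \<Longrightarrow> s = t"
    and surj: "\<And>x. \<exists>t\<in>{0..1} - {t0}. \<exists>k::int. D t = x + 2 * pi * k"
    and pos: "\<theta> 1 > 0"
  shows "\<theta> 1 = pi" "\<theta> 0 = pi" "strict_mono_on {t0..1} \<theta>" "strict_mono_on {0..t0} (\<lambda>t. - \<theta> t)"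
proof -
  have DR: "D t = \<theta> t" if "t0 < t" for t using that by (simp add: D_def branch_angle_def)
  have DL: "D t = \<theta> t + pi" if "t < t0" for t using that by (simp add: D_def branch_angle_def)
  have cR: "continuous_on {t0..1} \<theta>" and cL: "continuous_on {0..t0} \<theta>"
    using t0 by (auto intro: continuous_on_subset[OF cont])
  have "inj_on \<theta> {t0<..1}"
  proof (rule inj_onI)
    fix s t assume "s \<in> {t0<..1}" "t \<in> {t0<..1}" "\<theta> s = \<theta> t"
    then show "s = t" using inj[of s t 0] DR t0 by auto
  qed
  then have injR: "inj_on \<theta> {t0..1}" by (rule inj_on_closed_interval[OF cR])
  then show smR: "strict_mono_on {t0..1} \<theta>"
    using pos t0 by (intro strict_mono_on_continuous_inj cR) auto
  have "inj_on (\<lambda>s. \<theta> (- s)) {- t0..0}"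
  proof (rule inj_on_closed_interval)
    show "continuous_on {- t0..0} (\<lambda>s. \<theta> (- s))"
      by (rule continuous_on_compose2[OF cL]) (auto intro: continuous_intros)
    show "inj_on (\<lambda>s. \<theta> (- s)) {- t0<..0}"
    proof (rule inj_onI)
      fix s t assume "s \<in> {- t0<..0}" "t \<in> {- t0<..0}" "\<theta> (- s) = \<theta> (- t)"
      then show "s = t" using inj[of "- s" "- t" 0] DL[of "- s"] DL[of "- t"] t0 by auto
    qed
  qed
  then have injL: "inj_on \<theta> {0..t0}"
  proof (intro inj_onI)
    fix s t assume *: "inj_on (\<lambda>s. \<theta> (- s)) {- t0..0}" "s \<in> {0..t0}" "t \<in> {0..t0}" "\<theta> s = \<theta> t"
    show "s = t" using inj_onD[OF *(1), of "- s" "- t"] * by auto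
  qed
  define a b where "a = \<theta> 1" and "b = \<theta> 0"
  have a: "a > 0" using pos by (simp add: a_def)
  have b: "b \<noteq> 0" using inj_onD[OF injL, of 0 t0] t0 by (auto simp: b_def)
  have onR: "\<exists>t. t0 < t \<and> t \<le> 1 \<and> \<theta> t = y" if y: "0 < y" "y \<le> a" for y
  proof -
    have "\<exists>t\<ge>t0. t \<le> 1 \<and> \<theta> t = y" using y t0 by (intro IVT' cR) (auto simp: a_def)
    then obtain t where t: "t0 \<le> t" "t \<le> 1" "\<theta> t = y" by blast
    moreover have "t \<noteq> t0" using t y t0 by auto
    ultimately show ?thesis by force
  qed
  have rangeR: "0 < \<theta> t" "\<theta> t \<le> a" if "t0 < t" "t \<le> 1" for t
  proof -
    show "0 < \<theta> t" using strict_mono_onD[OF smR, of t0 t] that t0 by auto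
    show "\<theta> t \<le> a" using strict_mono_onD[OF smR, of t 1] that t0 by (cases "t = 1") (auto simp: a_def)
  qed
  have onL: "\<exists>t. 0 \<le> t \<and> t < t0 \<and> \<theta> t = y" if y: "0 < y \<and> y \<le> b \<or> y < 0 \<and> b \<le> y" for y
  proof -
    have "\<exists>t. 0 \<le> t \<and> t \<le> t0 \<and> \<theta> t = y"
      using IVT'[of \<theta> 0 y t0] IVT2'[of \<theta> t0 y 0] cL y t0 by (auto simp: b_def)
    then obtain t where t: "0 \<le> t" "t \<le> t0" "\<theta> t = y" by blast
    moreover have "t \<noteq> t0" using t y t0 by auto
    ultimately show ?thesis by force
  qed
  have rangeL: "\<bar>\<theta> t\<bar> \<le> \<bar>b\<bar>" "\<theta> t \<noteq> 0" "\<theta> t * b > 0" if t: "0 \<le> t" "t < t0" for t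
  proof -
    show ne: "\<theta> t \<noteq> 0" using inj_onD[OF injL, of t t0] t t0 by auto
    have "\<theta> t = b \<or> \<theta> 0 < \<theta> t \<and> \<theta> t < \<theta> t0 \<or> \<theta> t0 < \<theta> t \<and> \<theta> t < \<theta> 0"
    proof (cases "t = 0")
      case False
      then show ?thesis using continuous_inj_imp_mono[of 0 t t0 \<theta>] cL injL t by auto
    qed (simp add: b_def)
    then have "0 < b \<and> 0 < \<theta> t \<and> \<theta> t \<le> b \<or> b < 0 \<and> \<theta> t < 0 \<and> b \<le> \<theta> t"
      using b t0 ne by (auto simp: b_def)
    then show "\<bar>\<theta> t\<bar> \<le> \<bar>b\<bar>" "\<theta> t * b > 0" by (auto simp: mult_pos_pos mult_neg_neg)
  qed
  \<comment> \<open>Otherwise the right half alone would hit every ray, including the one through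
    the starting point; likewise for \<open>b\<close> with the roles exchanged.\<close>
  have a2: "a < 2 * pi"
  proof (rule ccontr)
    assume "\<not> a < 2 * pi"
    obtain k :: int where "0 < D 0 + 2 * pi * k" "D 0 + 2 * pi * k \<le> 0 + 2 * pi" using int_multiple_in_window by blast
    then obtain t where "t0 < t" "t \<le> 1" "\<theta> t = D 0 + 2 * pi * k" using onR[of "D 0 + 2 * pi * k"] \<open>\<not> a < 2 * pi\<close> by auto
    then show False using inj[of t 0 k] DR[of t] t0 by auto
  qed
  have b2: "\<bar>b\<bar> < 2 * pi"
  proof (rule ccontr)
    assume nb: "\<not> \<bar>b\<bar> < 2 * pi"
    have "\<exists>k::int. 0 < D 1 - pi + 2 * pi * k \<and> D 1 - pi + 2 * pi * k \<le> b \<or> D 1 - pi + 2 * pi * k < 0 \<and> b \<le> D 1 - pi + 2 * pi * k"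
    proof (cases "b > 0")
      case True
      then show ?thesis using int_multiple_in_window[of 0 "D 1 - pi"] nb by force
    next
      case False
      obtain k :: int where "0 < - (D 1 - pi) + 2 * pi * k" "- (D 1 - pi) + 2 * pi * k \<le> 0 + 2 * pi" using int_multiple_in_window by blast
      then show ?thesis using False nb by (intro exI[of _ "- k"]) auto
    qed
    then obtain k :: int and t where "0 \<le> t" "t < t0" "\<theta> t = D 1 - pi + 2 * pi * k" using onL by blast
    then show False using inj[of t 1 k] DL[of t] t0 by auto
  qed
  have small: "k = 0" if "\<bar>2 * pi * real_of_int k\<bar> < 2 * pi" for k using that by (rule int_multiple_2pi_small)
  \<comment> \<open>The left half cannot hit the ray of angle pi, since there
    \<open>\<theta>\<close> would be a multiple of \<open>2 * pi\<close>; so the right half must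
    reach it.\<close>
  have api: "pi \<le> a"
  proof -
    obtain t and k :: int where t: "t \<in> {0..1} - {t0}" "D t = pi + 2 * pi * k" using surj[of pi] by blast
    have "t0 < t"
    proof (rule ccontr)
      assume "\<not> t0 < t"
      then have "0 \<le> t" "t < t0" using t by auto
      then have "\<theta> t = 2 * pi * k" "\<theta> t \<noteq> 0" "\<bar>\<theta> t\<bar> < 2 * pi" using t DL[of t] rangeL[of t] b2 by auto
      then show False using small[of k] by simp
    qed
    then have "\<theta> t = pi + 2 * pi * k" "0 < \<theta> t" "\<theta> t \<le> a" using t DR rangeR[of t] by auto
    moreover have "k = 0" by (rule small) (use calculation a2 in linarith)
    ultimately show ?thesis by simp
  qed
  \<comment> \<open>Symmetrically, the ray of angle 0 is left to the left half, where it requires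
    \<open>\<theta>\<close> to be an odd multiple of pi.\<close>
  have bpi: "pi \<le> \<bar>b\<bar>"
  proof -
    obtain t and k :: int where t: "t \<in> {0..1} - {t0}" "D t = 0 + 2 * pi * k" using surj[of 0] by blast
    have "t < t0"
    proof (rule ccontr)
      assume "\<not> t < t0"
      then have "t0 < t" "t \<le> 1" using t by auto
      then have "\<theta> t = 2 * pi * k" using t(2) DR by simp
      moreover have "0 < \<theta> t" "\<theta> t < 2 * pi" using rangeR[OF \<open>t0 < t\<close> \<open>t \<le> 1\<close>] a2 by auto
      ultimately show False using small[of k] by simp
    qed
    then have *: "\<theta> t = 2 * pi * k - pi" "\<bar>\<theta> t\<bar> \<le> \<bar>b\<bar>" using t DL rangeL[of t] by auto
    have "\<bar>2 * pi * real_of_int k - pi\<bar> \<ge> pi"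
    proof -
      have "\<bar>2 * real_of_int k - 1\<bar> \<ge> 1" by (cases "k \<ge> 1") auto
      then have "pi * 1 \<le> pi * \<bar>2 * real_of_int k - 1\<bar>" by (intro mult_left_mono) auto
      also have "\<dots> = \<bar>pi * (2 * real_of_int k - 1)\<bar>" by (simp add: abs_mult)
      also have "pi * (2 * real_of_int k - 1) = 2 * pi * real_of_int k - pi" by (simp add: algebra_simps)
      finally show ?thesis by simp
    qed
    then show ?thesis using * by simp
  qed
  \<comment> \<open>If the left half turned the other way, both halves would hit the ray of angle
    pi/2.\<close>
  have bpos: "b > 0"
  proof (rule ccontr)
    assume "\<not> b > 0"
    then obtain s where "0 \<le> s" "s < t0" "\<theta> s = - (pi / 2)" using onL[of "- (pi / 2)"] bpi by auto
    moreover have "0 < pi / 2" "pi / 2 \<le> a" using api pi_gt_zero by linarith+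
    then obtain t where "t0 < t" "t \<le> 1" "\<theta> t = pi / 2" using onR by blast
    ultimately show False using inj[of s t 0] DL[of s] DR[of t] t0 by auto
  qed
  \<comment> \<open>Turning beyond pi would make the right half enter the arc just after angle pi,
    where the left half begins.\<close>
  have "\<not> a > pi"
  proof
    assume "a > pi"
    define e where "e = min (a - pi) b"
    have e: "0 < e" "e \<le> b" "pi + e \<le> a" using \<open>a > pi\<close> bpos by (auto simp: e_def)
    obtain s where "0 \<le> s" "s < t0" "\<theta> s = e" using onL[of e] e by auto
    moreover obtain t where "t0 < t" "t \<le> 1" "\<theta> t = pi + e" using onR[of "pi + e"] e by (auto simp: add_pos_pos)
    ultimately show False using inj[of s t 0] DL[of s] DR[of t] t0 by auto
  qed
  then have api': "a = pi" using api by simp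
  then show "\<theta> 1 = pi" by (simp add: a_def)
  have "\<not> b > pi"
  proof
    assume "b > pi"
    define e where "e = min (b - pi) pi"
    have e: "0 < e" "e \<le> a" "pi + e \<le> b" using \<open>b > pi\<close> api' by (auto simp: e_def)
    obtain s where "0 \<le> s" "s < t0" "\<theta> s = pi + e" using onL[of "pi + e"] e by (auto simp: add_pos_pos)
    moreover obtain t where "t0 < t" "t \<le> 1" "\<theta> t = e" using onR[of e] e by auto
    ultimately show False using inj[of s t 1] DL[of s] DR[of t] t0 by auto
  qed
  then show "\<theta> 0 = pi" using bpi bpos by (simp add: b_def)
  moreover have "inj_on (\<lambda>t. - \<theta> t) {0..t0}"
  proof (rule inj_onI)
    fix s t assume "s \<in> {0..t0}" "t \<in> {0..t0}" "- \<theta> s = - \<theta> t"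
    then show "s = t" using inj_onD[OF injL, of s t] by linarith
  qed
  ultimately show "strict_mono_on {0..t0} (\<lambda>t. - \<theta> t)"
    using t0 by (intro strict_mono_on_continuous_inj continuous_on_minus cL) auto
qed

lemma branch_angle_shape_oriented:
  fixes \<theta> :: "real \<Rightarrow> real"
  assumes cont: "continuous_on {0..1} \<theta>" and t0: "0 < t0" "t0 < 1" "\<theta> t0 = 0"
    and inj: "\<And>s t k::int. s \<in> {0..1} - {t0} \<Longrightarrow> t \<in> {0..1} - {t0} \<Longrightarrow>
      branch_angle t0 \<theta> s = branch_angle t0 \<theta> t + 2 * pi * k \<Longrightarrow> s = t"
    and surj: "\<And>x. \<exists>t\<in>{0..1} - {t0}. \<exists>k::int. branch_angle t0 \<theta> t = x + 2 * pi * k"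
  shows "\<exists>\<sigma>. (\<sigma> = 1 \<or> \<sigma> = -1) \<and> \<sigma> * \<theta> 1 = pi \<and> \<sigma> * \<theta> 0 = pi \<and>
     strict_mono_on {t0..1} (\<lambda>t. \<sigma> * \<theta> t) \<and> strict_mono_on {0..t0} (\<lambda>t. - (\<sigma> * \<theta> t))"
proof (cases "\<theta> 1 > 0")
  case True
  have "\<theta> 1 = pi" by (rule branch_angle_shape(1)[OF cont t0 inj surj True])
  moreover have "\<theta> 0 = pi" by (rule branch_angle_shape(2)[OF cont t0 inj surj True])
  moreover have "strict_mono_on {t0..1} \<theta>" by (rule branch_angle_shape(3)[OF cont t0 inj surj True])
  moreover have "strict_mono_on {0..t0} (\<lambda>t. - \<theta> t)" by (rule branch_angle_shape(4)[OF cont t0 inj surj True])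
  ultimately show ?thesis by (intro exI[of _ 1]) simp
next
  case False
  have "\<theta> 1 \<noteq> 0"
  proof
    assume "\<theta> 1 = 0"
    have "inj_on \<theta> {t0<..1}"
    proof (rule inj_onI)
      fix s t assume "s \<in> {t0<..1}" "t \<in> {t0<..1}" "\<theta> s = \<theta> t"
      then show "s = t" using inj[of s t 0] t0 by (auto simp: branch_angle_def)
    qed
    then have "inj_on \<theta> {t0..1}"
      using t0 by (intro inj_on_closed_interval continuous_on_subset[OF cont]) auto
    then show False using inj_onD[of \<theta> "{t0..1}" t0 1] \<open>\<theta> 1 = 0\<close> t0 by auto
  qed
  then have pos: "- \<theta> 1 > 0" using False by simp
  \<comment> \<open>Changing the sign of \<open>\<theta>\<close> does not change that of the added
    pi; the defect on the left half is a full turn, harmless for both hypotheses.\<close>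
  have D: "branch_angle t0 (\<lambda>t. - \<theta> t) t = - branch_angle t0 \<theta> t + 2 * pi * real_of_int (if t0 < t then 0 else 1)" for t
    by (simp add: branch_angle_def)
  note r = branch_angle_shape[of "\<lambda>t. - \<theta> t" t0]
  have "- \<theta> 1 = pi \<and> - \<theta> 0 = pi \<and> strict_mono_on {t0..1} (\<lambda>t. - \<theta> t) \<and> strict_mono_on {0..t0} (\<lambda>t. - (- \<theta> t))"
  proof (intro conjI)
    have c: "continuous_on {0..1} (\<lambda>t. - \<theta> t)" by (intro continuous_intros cont)
    have i: "s = t" if st: "s \<in> {0..1} - {t0}" "t \<in> {0..1} - {t0}"
      and eq: "branch_angle t0 (\<lambda>t. - \<theta> t) s = branch_angle t0 (\<lambda>t. - \<theta> t) t + 2 * pi * real_of_int k" for s t and k :: int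
    proof (rule inj[OF st])
      let ?m = "(if t0 < s then 0 else 1) - (if t0 < t then 0 else 1) - k"
      show "branch_angle t0 \<theta> s = branch_angle t0 \<theta> t + 2 * pi * real_of_int ?m"
        using eq unfolding D by (simp add: algebra_simps)
    qed
    have u: "\<exists>t\<in>{0..1} - {t0}. \<exists>k::int. branch_angle t0 (\<lambda>t. - \<theta> t) t = x + 2 * pi * real_of_int k" for x
    proof -
      obtain t and k :: int where t: "t \<in> {0..1} - {t0}" "branch_angle t0 \<theta> t = - x + 2 * pi * k" using surj by blast
      have "branch_angle t0 (\<lambda>t. - \<theta> t) t = x + 2 * pi * real_of_int ((if t0 < t then 0 else 1) - k)"
        unfolding D t(2) by (simp add: algebra_simps)
      then show ?thesis using t(1) by blast
    qed
    have z: "- \<theta> t0 = 0" using t0 by simp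
    show "- \<theta> 1 = pi" by (rule r(1)[OF c t0(1,2) z i u pos])
    show "- \<theta> 0 = pi" by (rule r(2)[OF c t0(1,2) z i u pos])
    show "strict_mono_on {t0..1} (\<lambda>t. - \<theta> t)" by (rule r(3)[OF c t0(1,2) z i u pos])
    show "strict_mono_on {0..t0} (\<lambda>t. - (- \<theta> t))" by (rule r(4)[OF c t0(1,2) z i u pos])
  qed
  then show ?thesis by (intro exI[of _ "-1"]) simp
qed

section \<open>Smooth algebraic arcs\<close>

lemma poly2_add: "poly2 (P + Q) x y = poly2 P x y + poly2 Q x y"
  by (simp add: poly2_def)

lemma poly2_diff: "poly2 (P - Q) x y = poly2 P x y - poly2 Q x y"
  by (simp add: poly2_def)

lemma poly2_mult: "poly2 (P * Q) x y = poly2 P x y * poly2 Q x y"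
  by (simp add: poly2_def)

lemma poly2_power: "poly2 (P ^ n) x y = poly2 P x y ^ n"
  by (simp add: poly2_def poly_power)

lemma poly2_smult: "poly2 (smult c P) x y = poly c y * poly2 P x y"
  by (simp add: poly2_def)

lemma poly2_0: "poly2 0 x y = 0"
  by (simp add: poly2_def)

lemma poly2_const: "poly2 [:c:] x y = poly c y"
  by (simp add: poly2_def)

lemma poly2_pCons: "poly2 (pCons c P) x y = poly c y + x * poly2 P x y"
  by (simp add: poly2_def)

lemma poly2_altdef: "poly2 P x y = (\<Sum>i\<le>degree P. poly (coeff P i) y * x ^ i)"
  by (simp add: poly2_def poly_altdef[of P] poly_sum poly_power)

lemma poly2_eq_0_iff: "(\<forall>x y. poly2 P x y = 0) \<longleftrightarrow> P = 0"
proof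
  assume *: "\<forall>x y. poly2 P x y = 0"
  have "poly (map_poly (\<lambda>c. poly c y) P) x = 0" for x y
  proof -
    have "poly (map_poly (\<lambda>c. poly c y) P) x = poly2 P x y"
      by (induction P) (auto simp: map_poly_pCons poly2_pCons poly2_0)
    then show ?thesis using * by simp
  qed
  then have "map_poly (\<lambda>c. poly c y) P = 0" for y
    by (meson poly_all_0_iff_0)
  then have "poly (coeff P i) y = 0" for i y
    by (metis coeff_0 coeff_map_poly poly_0)
  then show "P = 0"
    by (meson leading_coeff_0_iff poly_all_0_iff_0)
qed (simp add: poly2_0)

section \<open>Continuously differentiable functions and flat points\<close>

text \<open>The class C^n, with two-sided derivatives; it is applied to open intervals. The
  recursion on \<open>n\<close> lets the closure rules be proved by induction.\<close>

primrec c_diff :: "nat \<Rightarrow> real set \<Rightarrow> (real \<Rightarrow> real) \<Rightarrow> bool" where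
  "c_diff 0 S f \<longleftrightarrow> continuous_on S f"
| "c_diff (Suc n) S f \<longleftrightarrow>
     (\<exists>f'. (\<forall>t\<in>S. (f has_real_derivative f' t) (at t)) \<and> c_diff n S f')"

lemma c_diff_imp_continuous: "c_diff n S f \<Longrightarrow> continuous_on S f"
  by (cases n) (auto simp: continuous_on_eq_continuous_within
      intro: has_field_derivative_at_within DERIV_continuous)

lemma c_diff_Suc_imp: "c_diff (Suc n) S f \<Longrightarrow> c_diff n S f"
proof (induction n arbitrary: f)
  case 0 then show ?case using c_diff_imp_continuous[of "Suc 0"] by simp
next
  case (Suc n)
  from Suc.prems obtain f' where f': "\<forall>t\<in>S. (f has_real_derivative f' t) (at t)" "c_diff (Suc n) S f'"
    by (subst (asm) c_diff.simps(2)) blast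
  then have "c_diff n S f'" using Suc.IH by blast
  then show ?case using f'(1) by auto
qed

lemma c_diff_const: "c_diff n S (\<lambda>t. c)"
proof (induction n arbitrary: c)
  case (Suc n)
  have "\<forall>t\<in>S. ((\<lambda>t. c) has_real_derivative (\<lambda>_. 0) t) (at t)" by auto
  then show ?case using Suc[of 0] by (auto intro!: exI[of _ "\<lambda>_. 0"])
qed auto

lemma c_diff_add:
  assumes "c_diff n S f" "c_diff n S g" shows "c_diff n S (\<lambda>t. f t + g t)"
  using assms
proof (induction n arbitrary: f g)
  case (Suc n)
  then obtain f' g' where *: "\<forall>t\<in>S. (f has_real_derivative f' t) (at t)" "c_diff n S f'"
    "\<forall>t\<in>S. (g has_real_derivative g' t) (at t)" "c_diff n S g'" by auto
  have "\<forall>t\<in>S. ((\<lambda>t. f t + g t) has_real_derivative (\<lambda>t. f' t + g' t) t) (at t)"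
    using * by (auto intro!: derivative_intros)
  then show ?case using Suc.IH[OF *(2,4)] by auto
qed (auto intro: continuous_intros)

lemma c_diff_mult:
  assumes "c_diff n S f" "c_diff n S g" shows "c_diff n S (\<lambda>t. f t * g t)"
  using assms
proof (induction n arbitrary: f g)
  case (Suc n)
  then obtain f' g' where *: "\<forall>t\<in>S. (f has_real_derivative f' t) (at t)" "c_diff n S f'"
    "\<forall>t\<in>S. (g has_real_derivative g' t) (at t)" "c_diff n S g'" by auto
  have "\<forall>t\<in>S. ((\<lambda>t. f t * g t) has_real_derivative (\<lambda>t. f' t * g t + g' t * f t) t) (at t)"
    using * by (auto intro!: derivative_eq_intros)
  moreover have "c_diff n S (\<lambda>t. f' t * g t + g' t * f t)"
    using * Suc c_diff_Suc_imp by (intro c_diff_add Suc.IH) blast+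
  ultimately show ?case by auto
qed (auto intro: continuous_intros)

lemma c_diff_minus: "c_diff n S f \<Longrightarrow> c_diff n S (\<lambda>t. - f t)"
  using c_diff_mult[OF c_diff_const[of n S "-1"], of f] by simp

lemma c_diff_diff: "c_diff n S f \<Longrightarrow> c_diff n S g \<Longrightarrow> c_diff n S (\<lambda>t. f t - g t)"
  using c_diff_add[OF _ c_diff_minus, of n S f g] by simp

lemma c_diff_inverse:
  assumes "c_diff n S f" "\<And>t. t \<in> S \<Longrightarrow> f t \<noteq> 0" shows "c_diff n S (\<lambda>t. inverse (f t))"
  using assms
proof (induction n)
  case (Suc n)
  then obtain f' where *: "\<forall>t\<in>S. (f has_real_derivative f' t) (at t)" "c_diff n S f'" by auto
  have "\<forall>t\<in>S. ((\<lambda>t. inverse (f t)) has_real_derivative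
      (\<lambda>t. - (inverse (f t) * f' t * inverse (f t))) t) (at t)"
    using * Suc.prems by (auto intro!: derivative_eq_intros)
  moreover have "c_diff n S (\<lambda>t. inverse (f t))"
    using Suc c_diff_Suc_imp by blast
  then have "c_diff n S (\<lambda>t. - (inverse (f t) * f' t * inverse (f t)))"
    using * by (intro c_diff_minus c_diff_mult)
  ultimately show ?case by auto
qed (auto intro: continuous_intros)

lemma c_diff_poly: "c_diff n S f \<Longrightarrow> c_diff n S (\<lambda>t. poly p (f t))"
  by (induction p) (auto intro!: c_diff_const c_diff_add c_diff_mult)

lemma c_diff_poly2:
  "c_diff n S f \<Longrightarrow> c_diff n S g \<Longrightarrow> c_diff n S (\<lambda>t. poly2 P (f t) (g t))"
  by (induction P) (auto intro!: c_diff_const c_diff_add c_diff_mult c_diff_poly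
        simp: poly2_0 poly2_pCons)

text \<open>All derivatives vanish on \<open>U\<close> as well, and by continuity at its boundary
  point \<open>b\<close>. The mean value inequality turns a bound of order \<open>n\<close> for the
  derivative into one of order \<open>n + 1\<close> for the function.\<close>

lemma flat_bound:
  assumes "c_diff n S f" "open S" "open U" "U \<subseteq> S" "b \<in> S" "b \<in> closure U"
    and "\<And>t. t \<in> U \<Longrightarrow> f t = 0"
  shows "\<exists>C>0. \<exists>d>0. \<forall>t. \<bar>t - b\<bar> < d \<longrightarrow> t \<in> S \<and> \<bar>f t\<bar> \<le> C * \<bar>t - b\<bar> ^ n"
  using assms
proof (induction n arbitrary: f)
  case 0
  have "isCont f b"
    using 0 by (simp add: continuous_on_eq_continuous_at)
  then obtain d1 where d1: "d1 > 0" "\<And>t. \<bar>t - b\<bar> < d1 \<Longrightarrow> \<bar>f t - f b\<bar> < 1"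
    unfolding continuous_at_eps_delta by (auto simp: dist_real_def) (meson zero_less_one)
  obtain d2 where d2: "d2 > 0" "\<And>t. \<bar>t - b\<bar> < d2 \<Longrightarrow> t \<in> S"
    using 0(2,5) by (auto simp: open_dist dist_real_def)
  have "\<bar>t - b\<bar> < min d1 d2 \<Longrightarrow> t \<in> S \<and> \<bar>f t\<bar> \<le> (1 + \<bar>f b\<bar>) * \<bar>t - b\<bar> ^ 0" for t
    using d1(2)[of t] d2(2)[of t] by auto
  moreover have "min d1 d2 > 0" "1 + \<bar>f b\<bar> > 0" using d1 d2 by auto
  ultimately show ?case by blast
next
  case (Suc n)
  then obtain f' where f': "\<And>t. t \<in> S \<Longrightarrow> (f has_real_derivative f' t) (at t)" "c_diff n S f'"
    unfolding c_diff.simps by blast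
  have "f' t = 0" if "t \<in> U" for t
  proof -
    have "((\<lambda>_. 0) has_real_derivative f' t) (at t)"
      by (rule has_field_derivative_transform_within_open[of f _ _ U])
        (use f' that Suc.prems in auto)
    then show ?thesis by (metis DERIV_const DERIV_unique)
  qed
  then obtain C d where C: "C > 0" "d > 0"
    "\<And>t. \<bar>t - b\<bar> < d \<Longrightarrow> t \<in> S \<and> \<bar>f' t\<bar> \<le> C * \<bar>t - b\<bar> ^ n"
    using Suc.IH[OF f'(2) Suc.prems(2-6)] by blast
  have fb: "f b = 0"
  proof -
    have "isCont f b" using f'(1) Suc.prems by (blast intro: DERIV_isCont)
    obtain x where x: "\<And>n. x n \<in> U" "x \<longlonglongrightarrow> b"
      using Suc.prems(6) closure_sequential by blast
    then have "(\<lambda>n. f (x n)) \<longlonglongrightarrow> f b"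
      using \<open>isCont f b\<close> by (simp add: isCont_tendsto_compose)
    moreover have "(\<lambda>n. f (x n)) = (\<lambda>n. 0)" using x Suc.prems by auto
    ultimately show ?thesis by (simp add: LIMSEQ_const_iff)
  qed
  have "\<bar>f t\<bar> \<le> C * \<bar>t - b\<bar> ^ Suc n" if t: "\<bar>t - b\<bar> < d" for t
  proof -
    have "norm (f t - f b) \<le> (C * \<bar>t - b\<bar> ^ n) * norm (t - b)"
    proof (rule field_differentiable_bound[where S = "closed_segment b t" and f' = f'])
      fix z assume z: "z \<in> closed_segment b t"
      then have zb: "\<bar>z - b\<bar> \<le> \<bar>t - b\<bar>" 
        by (auto simp: closed_segment_eq_real_ivl split: if_splits)
      then show "(f has_field_derivative f' z) (at z within closed_segment b t)"
        using C t f' by (meson has_field_derivative_at_within le_less_trans)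
      have "\<bar>f' z\<bar> \<le> C * \<bar>z - b\<bar> ^ n" using C(3)[of z] zb t by auto
      also have "\<dots> \<le> C * \<bar>t - b\<bar> ^ n"
        using zb C(1) by (intro mult_left_mono power_mono) auto
      finally show "norm (f' z) \<le> C * \<bar>t - b\<bar> ^ n" by simp
    qed auto
    then show ?thesis using fb by (simp add: mult_ac)
  qed
  then show ?case using C by blast
qed

section \<open>Polynomials over a ring of polynomials\<close>

text \<open>The coefficients are themselves polynomials, so division with remainder works only after
  multiplying by a power of the leading coefficient.\<close>

lemma pseudo_division:
  fixes f g :: "real poly poly"
  assumes "g \<noteq> 0"
  shows "\<exists>c q r. c \<noteq> 0 \<and> smult c f = g * q + r \<and> (r = 0 \<or> degree r < degree g)"
proof -
  obtain q r where qr: "pseudo_divmod f g = (q, r)" by force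
  show ?thesis
    using pseudo_divmod[OF assms qr] assms
    by (metis leading_coeff_0_iff power_not_zero)
qed

text \<open>The quotient p/l is a periodic rational function. Along an arithmetic progression that
  avoids the roots of \<open>l\<close> it is a constant, so \<open>p\<close> and a multiple of
  \<open>l\<close> agree at infinitely many points.\<close>

lemma shift_invariant_ratio_const:
  fixes p l :: "real poly"
  assumes l: "l \<noteq> 0" and c: "c \<noteq> 0"
    and eq: "\<And>y. poly l y * poly p (y + c) = poly l (y + c) * poly p y"
  shows "\<exists>\<kappa>. p = smult \<kappa> l"
proof -
  have "finite {x. poly l x = 0}" using l by (simp add: poly_roots_finite)
  then obtain M where M: "\<And>x. poly l x = 0 \<Longrightarrow> \<bar>x\<bar> < M" "M > 0"
    using bounded_pos_less[of "{x. poly l x = 0}"] finite_imp_bounded by auto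
  \<comment> \<open>Starting at distance \<open>M\<close> from 0 and moving away from 0, the
    progression stays clear of all roots of \<open>l\<close>.\<close>
  define y where "y k = sgn c * M + real k * c" for k :: nat
  have "\<bar>y k\<bar> = M + real k * \<bar>c\<bar>" for k
  proof -
    have "y k = sgn c * (M + real k * \<bar>c\<bar>)"
      by (auto simp: y_def algebra_simps sgn_if abs_if)
    then show ?thesis using c M(2) by (simp add: abs_mult sgn_if)
  qed
  then have "\<bar>y k\<bar> \<ge> M" for k by simp
  then have nz: "poly l (y k) \<noteq> 0" for k using M by (meson not_less)
  define \<kappa> where "\<kappa> = poly p (y 0) / poly l (y 0)"
  have pk: "poly p (y k) = \<kappa> * poly l (y k)" for k
  proof (induction k)
    case 0 then show ?case using nz[of 0] by (simp add: \<kappa>_def)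
  next
    case (Suc k)
    have "y (Suc k) = y k + c" by (simp add: y_def algebra_simps)
    then have "poly l (y k) * poly p (y (Suc k)) = poly l (y k) * (\<kappa> * poly l (y (Suc k)))"
      using eq[of "y k"] Suc by (simp add: mult_ac)
    then show ?case using nz[of k] by simp
  qed
  have "inj y" using c by (auto simp: inj_on_def y_def)
  then have "infinite (range y)" by (simp add: finite_image_iff)
  moreover have "range y \<subseteq> {x. poly (p - smult \<kappa> l) x = 0}" using pk by auto
  ultimately have "p - smult \<kappa> l = 0"
    using poly_roots_finite[of "p - smult \<kappa> l"] finite_subset by blast
  then show ?thesis by auto
qed

text \<open>Continuous functions have zero divisors; on a smaller open set one of the two factors
  vanishes all the same.\<close>

lemma zero_product_on_open:
  fixes f g :: "'a::topological_space \<Rightarrow> real"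
  assumes "open U" "U \<noteq> {}" "continuous_on U f" "\<And>t. t \<in> U \<Longrightarrow> f t * g t = 0"
  shows "\<exists>V. open V \<and> V \<noteq> {} \<and> V \<subseteq> U \<and> ((\<forall>t\<in>V. f t = 0) \<or> (\<forall>t\<in>V. g t = 0))"
proof (cases "\<forall>t\<in>U. f t = 0")
  case True then show ?thesis using assms by blast
next
  case False
  have "open (U \<inter> f -` (- {0}))"
    using assms(1,3) by (intro continuous_open_preimage) auto
  moreover have "U \<inter> f -` (- {0}) \<noteq> {}" using False by auto
  moreover have "\<forall>t\<in>U \<inter> f -` (- {0}). g t = 0" using assms(4) by auto
  ultimately show ?thesis by blast
qed

section \<open>The minimal polynomial of an algebraic arc\<close>

text \<open>Here \<open>u\<close> serves as a regular parameter, and the outer variable of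
  \<open>T\<close> is \<open>w\<close>: degrees are degrees in \<open>w\<close>, coefficients are
  polynomials in \<open>u\<close>.\<close>

locale algebraic_arc =
  fixes a b :: real and u w :: "real \<Rightarrow> real" and T :: "real poly poly"
  assumes ab: "a < b"
    and smooth_u: "\<And>n. c_diff n {a<..<b} u"
    and smooth_w: "\<And>n. c_diff n {a<..<b} w"
    and u_deriv_pos: "\<And>t. t \<in> {a<..<b} \<Longrightarrow> \<exists>d>0. (u has_real_derivative d) (at t)"
    and T_nonzero: "T \<noteq> 0"
    and T_vanishes: "\<And>t. t \<in> {a<..<b} \<Longrightarrow> poly2 T (w t) (u t) = 0"
begin

abbreviation "ev Q t \<equiv> poly2 Q (w t) (u t)"

lemma u_inj: "inj_on u {a<..<b}"
proof -
  have "u x < u y" if "x \<in> {a<..<b}" "y \<in> {a<..<b}" "x < y" for x y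
  proof (rule DERIV_pos_imp_increasing[OF \<open>x < y\<close>])
    fix z assume "x \<le> z" "z \<le> y"
    then have "z \<in> {a<..<b}" using that by simp
    then show "\<exists>d. (u has_real_derivative d) (at z) \<and> 0 < d" using u_deriv_pos by blast
  qed
  then show ?thesis by (metis inj_onI less_irrefl linorder_less_linear)
qed

lemma poly_u_finite_zeros: "D \<noteq> 0 \<Longrightarrow> finite {t\<in>{a<..<b}. poly D (u t) = 0}"
proof (rule inj_on_finite[of u _ "{y. poly D y = 0}"])
  show "inj_on u {t \<in> {a<..<b}. poly D (u t) = 0}" using u_inj by (rule inj_on_subset) auto
qed (auto simp: poly_roots_finite)

lemma poly_u_vanishes:
  assumes "open U" "U \<noteq> {}" "U \<subseteq> {a<..<b}" "\<And>t. t \<in> U \<Longrightarrow> poly D (u t) = 0"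
  shows "D = 0"
proof (rule ccontr)
  assume "D \<noteq> 0"
  then have "finite {t\<in>{a<..<b}. poly D (u t) = 0}" by (rule poly_u_finite_zeros)
  moreover have "U \<subseteq> {t\<in>{a<..<b}. poly D (u t) = 0}" using assms by auto
  ultimately have "finite U" by (rule rev_finite_subset)
  then show False using assms(1,2) finite_imp_not_open by blast
qed

lemma ev_smooth: "c_diff n {a<..<b} (ev Q)"
  by (intro c_diff_poly2 smooth_u smooth_w)

lemma ev_continuous: "continuous_on {a<..<b} (ev Q)"
  using ev_smooth[of 0] by simp

text \<open>Vanishing is required on one piece \<open>U\<close>, but minimality ranges over all open
  pieces of the arc. It therefore survives shrinking \<open>U\<close> and can be used elsewhere on
  the arc.\<close>

definition minimal_on :: "real poly poly \<Rightarrow> real set \<Rightarrow> bool" where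
  "minimal_on P U \<longleftrightarrow> P \<noteq> 0 \<and> open U \<and> U \<noteq> {} \<and> U \<subseteq> {a<..<b} \<and> (\<forall>t\<in>U. ev P t = 0) \<and>
     (\<forall>Q V. open V \<and> V \<noteq> {} \<and> V \<subseteq> {a<..<b} \<and> (\<forall>t\<in>V. ev Q t = 0) \<and> degree Q < degree P
        \<longrightarrow> Q = 0)"

lemma minimal_exists: "\<exists>P U. minimal_on P U"
proof -
  define S where "S d \<longleftrightarrow> (\<exists>U Q. open U \<and> U \<noteq> {} \<and> U \<subseteq> {a<..<b} \<and> Q \<noteq> 0 \<and> degree Q = d \<and>
    (\<forall>t\<in>U. ev Q t = 0))" for d
  have "S (degree T)"
    unfolding S_def using ab T_nonzero T_vanishes
    by (intro exI[of _ "{a<..<b}"] exI[of _ T]) auto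
  then have S1: "S (LEAST d. S d)" by (rule LeastI)
  then obtain U Q where Q: "open U" "U \<noteq> {}" "U \<subseteq> {a<..<b}" "Q \<noteq> 0" "degree Q = (LEAST d. S d)"
    "\<forall>t\<in>U. ev Q t = 0" unfolding S_def by blast
  have "minimal_on Q U"
    unfolding minimal_on_def
  proof (intro conjI Q allI impI)
    fix Q' V assume *: "open V \<and> V \<noteq> {} \<and> V \<subseteq> {a<..<b} \<and> (\<forall>t\<in>V. ev Q' t = 0) \<and> degree Q' < degree Q"
    then have "\<not> S (degree Q')" using not_less_Least[of "degree Q'" S] Q(5) by simp
    then show "Q' = 0" using * unfolding S_def by blast
  qed
  then show ?thesis by blast
qed

context
  fixes P U assumes P: "minimal_on P U"
begin

lemma P_facts: "P \<noteq> 0" "open U" "U \<noteq> {}" "U \<subseteq> {a<..<b}" "\<And>t. t \<in> U \<Longrightarrow> ev P t = 0"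
  using P unfolding minimal_on_def by auto

lemma P_minimal:
  assumes "open V" "V \<noteq> {}" "V \<subseteq> {a<..<b}" "\<And>t. t \<in> V \<Longrightarrow> ev Q t = 0" "degree Q < degree P"
  shows "Q = 0"
  using P assms unfolding minimal_on_def by blast

text \<open>A nonzero polynomial in \<open>u\<close> alone has finitely many zeros on the arc, since
  \<open>u\<close> is injective.\<close>

lemma P_degree_pos: "degree P > 0"
proof (rule ccontr)
  assume "\<not> degree P > 0"
  then obtain D where D: "P = [:D:]" by (metis degree_eq_zeroE not_gr_zero)
  then have "poly D (u t) = 0" if "t \<in> U" for t
    using P_facts(5)[OF that] by (simp add: poly2_const)
  then have "D = 0" using poly_u_vanishes P_facts(2-4) by blast
  then show False using D P_facts(1) by simp
qed

text \<open>Divisibility by \<open>P\<close> over the field of rational functions in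
  \<open>u\<close>, with denominators cleared by \<open>c\<close>.\<close>

definition pdvd :: "real poly poly \<Rightarrow> bool" where
  "pdvd Q \<longleftrightarrow> (\<exists>c q. c \<noteq> 0 \<and> smult c Q = P * q)"

text \<open>Minimality makes \<open>P\<close> act as an irreducible element. An element
  \<open>G\<close> of least degree in the ideal of \<open>P\<close> and \<open>Q\<close> divides
  both up to factors in \<open>u\<close>. In the factorization of \<open>P\<close> by
  \<open>G\<close>, a factor vanishing on an open piece has the full degree of \<open>P\<close>, so
  either \<open>G\<close> is free of \<open>w\<close>, or \<open>P\<close> itself divides
  \<open>Q\<close>.\<close>

lemma bezout:
  assumes "\<not> pdvd Q"
  shows "\<exists>A B D. D \<noteq> 0 \<and> A * P + B * Q = [:D:]"
proof -
  define I where "I = {G. \<exists>A B. G = A * P + B * Q}"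
  have "P \<in> I" unfolding I_def by (rule CollectI, rule exI[of _ 1], rule exI[of _ 0]) simp
  then obtain G where G: "G \<in> I" "G \<noteq> 0" "\<And>G'. G' \<in> I \<Longrightarrow> G' \<noteq> 0 \<Longrightarrow> degree G \<le> degree G'"
    using ex_has_least_nat[of "\<lambda>G. G \<in> I \<and> G \<noteq> 0" P degree] P_facts(1) by blast
  obtain A B where AB: "G = A * P + B * Q" using G(1) I_def by auto
  have div: "\<exists>c q. c \<noteq> 0 \<and> smult c F = G * q" if F: "F \<in> I" for F
  proof -
    obtain c q r where cqr: "c \<noteq> 0" "smult c F = G * q + r" "r = 0 \<or> degree r < degree G"
      using pseudo_division[OF G(2)] by blast
    obtain A' B' where AB': "F = A' * P + B' * Q" using F I_def by auto
    have "r = smult c F - G * q" using cqr by simp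
    also have "\<dots> = (smult c A' - A * q) * P + (smult c B' - B * q) * Q"
      unfolding AB AB' by (simp add: algebra_simps smult_add_right)
    finally have "r \<in> I" unfolding I_def by blast
    then have "r = 0" using cqr(3) G(3) by (meson not_less)
    then show ?thesis using cqr by auto
  qed
  have "Q \<in> I" unfolding I_def by (rule CollectI, rule exI[of _ 0], rule exI[of _ 1]) simp
  then obtain c' q' where q': "c' \<noteq> 0" "smult c' Q = G * q'" using div by blast
  obtain c q where q: "c \<noteq> 0" "smult c P = G * q" using div[OF \<open>P \<in> I\<close>] by blast
  then have "q \<noteq> 0" using P_facts(1) by auto
  have deg: "degree P = degree G + degree q"
    using q(1) q(2) G(2) \<open>q \<noteq> 0\<close> by (metis degree_mult_eq degree_smult_eq)
  \<comment> \<open>Up to a factor in \<open>u\<close>, this product is \<open>P\<close>.\<close>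
  have "ev G t * ev q t = 0" if "t \<in> U" for t
    using P_facts(5)[OF that] q(2) by (metis mult_zero_right poly2_mult poly2_smult)
  then obtain V where V: "open V" "V \<noteq> {}" "V \<subseteq> U" "(\<forall>t\<in>V. ev G t = 0) \<or> (\<forall>t\<in>V. ev q t = 0)"
    using zero_product_on_open[of U "ev G" "ev q"] P_facts continuous_on_subset[OF ev_continuous] by blast
  have VI: "V \<subseteq> {a<..<b}" using V P_facts by blast
  from V(4) show ?thesis
  proof
    assume "\<forall>t\<in>V. ev q t = 0"
    then have "\<not> degree q < degree P" using P_minimal[OF V(1,2) VI] \<open>q \<noteq> 0\<close> by blast
    then have "degree G = 0" using deg by simp
    then obtain D where "G = [:D:]" by (metis degree_eq_zeroE)
    then show ?thesis using AB G(2) by (metis pCons_0_0)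
  next
    assume "\<forall>t\<in>V. ev G t = 0"
    then have "\<not> degree G < degree P" using P_minimal[OF V(1,2) VI] G(2) by blast
    then have "degree q = 0" using deg by simp
    then obtain q0 where q0: "q = [:q0:]" by (metis degree_eq_zeroE)
    have "smult (c' * q0) Q = smult q0 (G * q')"
      using q'(2) by (metis mult.commute smult_smult)
    also have "\<dots> = (G * q) * q'" by (simp add: q0)
    also have "\<dots> = P * smult c q'" using q(2) by (metis mult_smult_left mult_smult_right)
    finally have "pdvd Q" unfolding pdvd_def using q'(1) \<open>q \<noteq> 0\<close> q0
      by (metis mult_eq_0_iff pCons_0_0)
    then show ?thesis using assms by blast
  qed
qed

text \<open>Division by \<open>P\<close> lowers the degree in \<open>w\<close>, so it stops. The
  cofactor \<open>V1\<close> of \<open>T\<close> is then subject to the Bezout identity.\<close>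

lemma strip:
  assumes "V \<noteq> 0"
  shows "\<exists>m c V1. c \<noteq> 0 \<and> smult c V = P ^ m * V1 \<and> \<not> pdvd V1"
  using assms
proof (induction "degree V" arbitrary: V rule: less_induct)
  case less
  show ?case
  proof (cases "pdvd V")
    case False
    then show ?thesis by (intro exI[of _ 0] exI[of _ 1] exI[of _ V]) auto
  next
    case True
    then obtain c q where q: "c \<noteq> 0" "smult c V = P * q" unfolding pdvd_def by blast
    then have "q \<noteq> 0" using less.prems by auto
    moreover have "degree V = degree P + degree q"
      using q \<open>q \<noteq> 0\<close> P_facts(1) by (metis degree_mult_eq degree_smult_eq)
    ultimately obtain m c2 V1 where *: "c2 \<noteq> 0" "smult c2 q = P ^ m * V1" "\<not> pdvd V1"
      using less.hyps[of q] P_degree_pos by auto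
    have "smult (c2 * c) V = P * smult c2 q" using q(2) by (metis mult_smult_right smult_smult)
    also have "\<dots> = P ^ Suc m * V1" using *(2) by (simp add: mult.assoc)
    finally show ?thesis using * q(1) by (metis mult_eq_0_iff)
  qed
qed

text \<open>Off the zeros of \<open>P\<close> the cofactor \<open>V1\<close> of \<open>T\<close>
  must vanish, and the Bezout identity reduces to D(u) = A P. At a boundary point of an open set of
  zeros, \<open>P\<close> vanishes to every order, while D(u) has a zero of finite order because
  \<open>u\<close> has positive derivative. So points with P nonzero cannot accumulate
  there.\<close>

lemma zero_near_flat_point:
  assumes b0: "b0 \<in> {a<..<b}" and W: "open W" "W \<subseteq> {a<..<b}" "b0 \<in> closure W"
    and zero: "\<And>t. t \<in> W \<Longrightarrow> ev P t = 0"
  shows "\<forall>\<^sub>F t in nhds b0. ev P t = 0"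
proof -
  obtain m c V1 where V1: "c \<noteq> 0" "smult c T = P ^ m * V1" "\<not> pdvd V1"
    using strip[OF T_nonzero] by blast
  obtain A B D where D: "D \<noteq> 0" "A * P + B * V1 = [:D:]" using bezout[OF V1(3)] by blast
  have key: "poly D (u t) = ev A t * ev P t" if "t \<in> {a<..<b}" "ev P t \<noteq> 0" for t
  proof -
    have "ev P t ^ m * ev V1 t = 0"
      using V1(2) T_vanishes[OF that(1)] by (metis mult_zero_right poly2_mult poly2_power poly2_smult)
    then have "ev V1 t = 0" using that by simp
    moreover have "ev A t * ev P t + ev B t * ev V1 t = poly D (u t)"
      using D(2) by (metis poly2_add poly2_const poly2_mult)
    ultimately show ?thesis by simp
  qed
  \<comment> \<open>The finite order to beat; \<open>P\<close> is bounded to order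
    \<open>n + 1\<close>.\<close>
  define n where "n = order (u b0) D"
  obtain E where E: "D = [:- u b0, 1:] ^ n * E" "\<not> [:- u b0, 1:] dvd E"
    using order_decomp[OF D(1)] n_def by blast
  have E0: "poly E (u b0) \<noteq> 0" using E(2) by (simp add: poly_eq_0_iff_dvd)
  obtain C d where C: "C > 0" "d > 0"
    "\<And>t. \<bar>t - b0\<bar> < d \<Longrightarrow> t \<in> {a<..<b} \<and> \<bar>ev P t\<bar> \<le> C * \<bar>t - b0\<bar> ^ Suc n"
    using flat_bound[OF ev_smooth[of "Suc n" P] _ W(1,2) b0 W(3) zero] by auto
  have P0: "ev P b0 = 0" using C(3)[of b0] C(2) by simp
  obtain u' where u': "u' > 0" "(u has_real_derivative u') (at b0)" using u_deriv_pos[OF b0] by blast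
  have q: "((\<lambda>t. (u t - u b0) / (t - b0)) \<longlongrightarrow> u') (at b0)"
    using u'(2) by (simp add: has_field_derivative_iff)
  have ucont: "(u \<longlongrightarrow> u b0) (at b0)" using u'(2) DERIV_isCont isCont_def by blast
  \<comment> \<open>After division by the n-th power of |t - b0|, the side of \<open>D\<close> has a
    positive limit and the bound for the side of \<open>A\<close> and \<open>P\<close> tends to
    0.\<close>
  have L1: "((\<lambda>t. \<bar>poly E (u t)\<bar> * \<bar>(u t - u b0) / (t - b0)\<bar> ^ n) \<longlongrightarrow> \<bar>poly E (u b0)\<bar> * \<bar>u'\<bar> ^ n) (at b0)"
    by (intro tendsto_mult tendsto_rabs tendsto_power q isCont_tendsto_compose[OF poly_isCont] ucont)
  have "isCont (ev A) b0" using ev_continuous b0 by (simp add: continuous_on_eq_continuous_at)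
  then have L2: "((\<lambda>t. \<bar>ev A t\<bar> * C * \<bar>t - b0\<bar>) \<longlongrightarrow> \<bar>ev A b0\<bar> * C * \<bar>b0 - b0\<bar>) (at b0)"
    unfolding isCont_def by (intro tendsto_intros)
  have "((\<lambda>t. \<bar>poly E (u t)\<bar> * \<bar>(u t - u b0) / (t - b0)\<bar> ^ n - \<bar>ev A t\<bar> * C * \<bar>t - b0\<bar>) \<longlongrightarrow>
      \<bar>poly E (u b0)\<bar> * \<bar>u'\<bar> ^ n - \<bar>ev A b0\<bar> * C * \<bar>b0 - b0\<bar>) (at b0)"
    by (rule tendsto_diff[OF L1 L2])
  moreover have "\<bar>poly E (u b0)\<bar> * \<bar>u'\<bar> ^ n - \<bar>ev A b0\<bar> * C * \<bar>b0 - b0\<bar> > 0"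
    using E0 u'(1) by simp
  ultimately have ev1: "\<forall>\<^sub>F t in at b0. \<bar>poly E (u t)\<bar> * \<bar>(u t - u b0) / (t - b0)\<bar> ^ n -
      \<bar>ev A t\<bar> * C * \<bar>t - b0\<bar> > 0"
    by (rule order_tendstoD(1))
  have ev2: "\<forall>\<^sub>F t in at b0. \<bar>t - b0\<bar> < d \<and> t \<noteq> b0"
    using C(2) by (auto simp: eventually_at dist_real_def)
  have "\<forall>\<^sub>F t in at b0. ev P t = 0"
    using ev1 ev2
  proof eventually_elim
    case (elim t)
    show "ev P t = 0"
    proof (rule ccontr)
      assume nz: "ev P t \<noteq> 0"
      have tn: "\<bar>t - b0\<bar> > 0" using elim by simp
      have "\<bar>poly D (u t)\<bar> = \<bar>ev A t\<bar> * \<bar>ev P t\<bar>" using key nz C(3) elim by (simp add: abs_mult)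
      also have "\<dots> \<le> \<bar>ev A t\<bar> * (C * \<bar>t - b0\<bar> ^ Suc n)"
        using C(3) elim by (intro mult_left_mono) auto
      finally have 1: "\<bar>poly D (u t)\<bar> \<le> \<bar>ev A t\<bar> * C * \<bar>t - b0\<bar> * \<bar>t - b0\<bar> ^ n"
        by (simp add: algebra_simps)
      have "\<bar>poly D (u t)\<bar> = \<bar>u t - u b0\<bar> ^ n * \<bar>poly E (u t)\<bar>"
        by (simp add: E(1) poly_power abs_mult power_abs)
      also have "\<dots> = \<bar>poly E (u t)\<bar> * \<bar>(u t - u b0) / (t - b0)\<bar> ^ n * \<bar>t - b0\<bar> ^ n"
        using tn by (simp add: abs_divide power_divide)
      finally have "\<bar>poly E (u t)\<bar> * \<bar>(u t - u b0) / (t - b0)\<bar> ^ n * \<bar>t - b0\<bar> ^ n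
          \<le> \<bar>ev A t\<bar> * C * \<bar>t - b0\<bar> * \<bar>t - b0\<bar> ^ n" using 1 by simp
      then have "\<bar>poly E (u t)\<bar> * \<bar>(u t - u b0) / (t - b0)\<bar> ^ n \<le> \<bar>ev A t\<bar> * C * \<bar>t - b0\<bar>"
        using tn by (simp add: mult_le_cancel_right)
      then show False using elim by simp
    qed
  qed
  then show ?thesis using P0 by (simp add: eventually_nhds_conv_at)
qed

text \<open>The interior of the zero set is open by construction and relatively closed by flatness
  at its boundary points, and the arc is connected.\<close>

lemma P_vanishes:
  assumes "t \<in> {a<..<b}" shows "ev P t = 0"
proof -
  define Z where "Z = interior {t\<in>{a<..<b}. ev P t = 0}"
  have Z: "open Z" "Z \<subseteq> {a<..<b}" "\<And>t. t \<in> Z \<Longrightarrow> ev P t = 0"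
    using interior_subset[of "{t\<in>{a<..<b}. ev P t = 0}"] by (auto simp: Z_def)
  have "U \<subseteq> Z" unfolding Z_def using P_facts by (intro interior_maximal) auto
  have "{a<..<b} \<inter> closure Z \<subseteq> Z"
  proof
    fix s assume s: "s \<in> {a<..<b} \<inter> closure Z"
    then have "\<forall>\<^sub>F t in nhds s. ev P t = 0"
      using zero_near_flat_point[OF _ Z(1,2) _ Z(3)] by blast
    moreover have "\<forall>\<^sub>F t in nhds s. t \<in> {a<..<b}"
      using s by (intro eventually_nhds_in_open) auto
    ultimately have "\<forall>\<^sub>F t in nhds s. t \<in> {t\<in>{a<..<b}. ev P t = 0}"
      by eventually_elim auto
    then show "s \<in> Z" unfolding Z_def eventually_nhds by (meson interiorI subsetI)
  qed
  then have "closedin (top_of_set {a<..<b}) Z"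
    using Z(2) closure_subset[of Z] by (metis Int_greatest closedin_closed closed_closure inf.absorb_iff2 subset_antisym)
  moreover have "openin (top_of_set {a<..<b}) Z" using Z by (simp add: open_openin_trans)
  ultimately have "Z = {} \<or> Z = {a<..<b}"
    using connected_clopen[of "{a<..<b}"] by auto
  then show ?thesis using Z assms \<open>U \<subseteq> Z\<close> P_facts(3) by auto
qed

text \<open>\<open>P\<close> vanishes along the whole arc, so its shift by \<open>c\<close> in
  \<open>u\<close> vanishes on \<open>V\<close>. Eliminating the leading term from the two leaves a
  polynomial of smaller degree, hence zero: the ratios of the coefficients to the leading one are
  periodic, thus constant. \<open>P\<close> then splits as l(u) \<tau>(w).\<close>

lemma w_constant_aux:
  assumes c: "c \<noteq> 0" and V: "open V" "V \<noteq> {}" "V \<subseteq> {a<..<b}"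
    and shift: "\<And>t. t \<in> V \<Longrightarrow> \<exists>t'\<in>{a<..<b}. w t' = w t \<and> u t' = u t + c"
  shows "\<exists>k. \<forall>t\<in>{a<..<b}. w t = k"
proof -
  define s where "s p = p \<circ>\<^sub>p [:c, 1:]" for p :: "real poly"
  have s: "poly (s p) y = poly p (y + c)" for p y by (simp add: s_def poly_pcompose add.commute)
  have s0: "s 0 = 0" by (simp add: s_def)
  define l where "l = lead_coeff P"
  have l: "l \<noteq> 0" using P_facts(1) by (simp add: l_def)
  define Ps where "Ps = map_poly s P"
  have cPs: "coeff Ps i = s (coeff P i)" for i by (simp add: Ps_def coeff_map_poly s0)
  have "poly2 (map_poly s R) x y = poly2 R x (y + c)" for R x y
    by (induction R) (auto simp: map_poly_pCons s0 poly2_pCons s poly2_0)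
  then have Ps: "poly2 Ps x y = poly2 P x (y + c)" for x y by (simp add: Ps_def)
  \<comment> \<open>Cross-multiplication by the two leading coefficients cancels the top power of
    \<open>w\<close>.\<close>
  define Q where "Q = smult l Ps - smult (s l) P"
  have "ev Q t = 0" if tV: "t \<in> V" for t
  proof -
    obtain t' where t': "t' \<in> {a<..<b}" "w t' = w t" "u t' = u t + c" using shift[OF tV] by blast
    have "ev Ps t = 0" using P_vanishes[OF t'(1)] t' by (simp add: Ps)
    then show ?thesis using P_vanishes[of t] tV V by (auto simp: Q_def poly2_diff poly2_smult)
  qed
  moreover have "degree Q < degree P"
  proof (rule degree_lessI)
    show "Q \<noteq> 0 \<or> 0 < degree P" using P_degree_pos by simp
    show "\<forall>k\<ge>degree P. coeff Q k = 0"
    proof (intro allI impI)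
      fix k assume "degree P \<le> k"
      then show "coeff Q k = 0"
        by (cases "k = degree P") (auto simp: Q_def cPs l_def coeff_eq_0 s0)
    qed
  qed
  ultimately have "Q = 0" using P_minimal[OF V] by blast
  then have "l * s (coeff P i) = s l * coeff P i" for i
    using cPs[of i] by (metis Q_def coeff_smult eq_iff_diff_eq_0)
  then have "poly l y * poly (coeff P i) (y + c) = poly l (y + c) * poly (coeff P i) y" for i y
    by (metis poly_mult s)
  then have "\<exists>\<kappa>. coeff P i = smult \<kappa> l" for i using shift_invariant_ratio_const[OF l c] by blast
  then obtain \<kappa> where \<kappa>: "\<And>i. coeff P i = smult (\<kappa> i) l" by metis
  define \<tau> where "\<tau> = (\<Sum>i\<le>degree P. monom (\<kappa> i) i)"
  have fac: "poly2 P x y = poly l y * poly \<tau> x" for x y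
    by (simp add: poly2_altdef \<kappa> \<tau>_def poly_sum poly_monom sum_distrib_left mult_ac)
  have "\<tau> \<noteq> 0" using fac P_facts(1) poly2_eq_0_iff[of P] by auto
  \<comment> \<open>At these parameters the factorization puts no constraint on \<open>w\<close>,
    but there are only finitely many of them.\<close>
  define N where "N = {t\<in>{a<..<b}. poly l (u t) = 0}"
  have "w ` {a<..<b} \<subseteq> {x. poly \<tau> x = 0} \<union> w ` N"
  proof
    fix x assume "x \<in> w ` {a<..<b}"
    then obtain t where t: "t \<in> {a<..<b}" "x = w t" by blast
    then have "poly l (u t) = 0 \<or> poly \<tau> (w t) = 0" using P_vanishes[OF t(1)] fac by simp
    then show "x \<in> {x. poly \<tau> x = 0} \<union> w ` N" using t by (auto simp: N_def)
  qed
  moreover have "finite ({x. poly \<tau> x = 0} \<union> w ` N)"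
    using \<open>\<tau> \<noteq> 0\<close> poly_u_finite_zeros[OF l] by (simp add: N_def poly_roots_finite)
  ultimately have "finite (w ` {a<..<b})" by (rule finite_subset)
  moreover have "connected (w ` {a<..<b})"
    using smooth_w[of 0] by (intro connected_continuous_image) auto
  ultimately have "w ` {a<..<b} = {} \<or> (\<exists>k. w ` {a<..<b} = {k})"
    using connected_finite_iff_sing by blast
  then show ?thesis by auto
qed

end

theorem w_constant:
  assumes "c \<noteq> 0" "open V" "V \<noteq> {}" "V \<subseteq> {a<..<b}"
    and "\<And>t. t \<in> V \<Longrightarrow> \<exists>t'\<in>{a<..<b}. w t' = w t \<and> u t' = u t + c"
  shows "\<exists>k. \<forall>t\<in>{a<..<b}. w t = k"
proof -
  obtain P U where "minimal_on P U" using minimal_exists by blast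
  then show ?thesis using assms by (rule w_constant_aux)
qed

end

section \<open>A polynomial relation between \<open>w\<close> and \<open>u\<close> from algebraicity
  in polar coordinates\<close>

text \<open>Polynomial functions rather than polynomials, so that substitutions and products can be
  handled by closure rules instead of coefficients.\<close>

definition bipoly :: "(real \<Rightarrow> real \<Rightarrow> real) \<Rightarrow> bool" where
  "bipoly F \<longleftrightarrow> (\<exists>P. \<forall>x y. F x y = poly2 P x y)"

lemma bipoly_poly2: "bipoly (poly2 P)"
  unfolding bipoly_def by blast

lemma bipoly_const: "bipoly (\<lambda>x y. c)"
  unfolding bipoly_def by (rule exI[of _ "[:[:c:]:]"]) (simp add: poly2_def)

lemma bipoly_fst: "bipoly (\<lambda>x y. x)"
  unfolding bipoly_def by (rule exI[of _ "[:0, 1:]"]) (simp add: poly2_def)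

lemma bipoly_snd: "bipoly (\<lambda>x y. y)"
  unfolding bipoly_def by (rule exI[of _ "[:[:0, 1:]:]"]) (simp add: poly2_def)

lemma bipoly_add: "bipoly F \<Longrightarrow> bipoly G \<Longrightarrow> bipoly (\<lambda>x y. F x y + G x y)"
  unfolding bipoly_def by (metis poly2_add)

lemma bipoly_mult: "bipoly F \<Longrightarrow> bipoly G \<Longrightarrow> bipoly (\<lambda>x y. F x y * G x y)"
  unfolding bipoly_def by (metis poly2_mult)

lemma bipoly_diff: "bipoly F \<Longrightarrow> bipoly G \<Longrightarrow> bipoly (\<lambda>x y. F x y - G x y)"
  unfolding bipoly_def by (metis poly2_diff)

lemma bipoly_poly: "bipoly G \<Longrightarrow> bipoly (\<lambda>x y. poly p (G x y))"
  by (induction p) (auto intro!: bipoly_const bipoly_add bipoly_mult)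

lemma bipoly_subst:
  assumes "bipoly F" "bipoly G" "bipoly H" shows "bipoly (\<lambda>x y. F (G x y) (H x y))"
proof -
  obtain P where P: "\<And>x y. F x y = poly2 P x y" using assms(1) bipoly_def by blast
  have "bipoly (\<lambda>x y. poly2 P (G x y) (H x y))"
    by (induction P) (auto simp: poly2_0 poly2_pCons intro!: bipoly_const bipoly_add bipoly_mult bipoly_poly assms)
  then show ?thesis by (simp add: P)
qed

lemma bipoly_nonzero_mult:
  assumes "bipoly F" "bipoly G" "\<exists>x y. F x y \<noteq> 0" "\<exists>x y. G x y \<noteq> 0"
  shows "\<exists>x y. F x y * G x y \<noteq> 0"
proof -
  obtain P where P: "\<And>x y. F x y = poly2 P x y" using assms(1) bipoly_def by blast
  obtain Q where Q: "\<And>x y. G x y = poly2 Q x y" using assms(2) bipoly_def by blast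
  have "P \<noteq> 0" "Q \<noteq> 0" using assms(3,4) P Q by (auto simp: poly2_0)
  then have "P * Q \<noteq> 0" by simp
  then show ?thesis using poly2_eq_0_iff[of "P * Q"] by (auto simp: P Q poly2_mult)
qed

lemma bipoly_prod:
  assumes "finite K" "\<And>k. k \<in> K \<Longrightarrow> bipoly (F k)" "\<And>k. k \<in> K \<Longrightarrow> \<exists>x y. F k x y \<noteq> 0"
  shows "bipoly (\<lambda>x y. \<Prod>k\<in>K. F k x y) \<and> (\<exists>x y. (\<Prod>k\<in>K. F k x y) \<noteq> 0)"
  using assms
proof (induction K rule: finite_induct)
  case empty
  then show ?case by (simp add: bipoly_const)
next
  case (insert k K)
  then have IH: "bipoly (\<lambda>x y. \<Prod>k\<in>K. F k x y)" "\<exists>x y. (\<Prod>k\<in>K. F k x y) \<noteq> 0" by simp_all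
  have k: "bipoly (F k)" "\<exists>x y. F k x y \<noteq> 0" using insert by simp_all
  have "bipoly (\<lambda>x y. F k x y * (\<Prod>k\<in>K. F k x y))" by (rule bipoly_mult[OF k(1) IH(1)])
  moreover have "\<exists>x y. F k x y * (\<Prod>k\<in>K. F k x y) \<noteq> 0" by (rule bipoly_nonzero_mult[OF k(1) IH(1) k(2) IH(2)])
  ultimately show ?case using insert.hyps by simp
qed

lemma poly_even_odd: "\<exists>e q. \<forall>y::real. poly p y = poly e (y\<^sup>2) + y * poly q (y\<^sup>2)"
proof (induction p)
  case 0
  show ?case by (intro exI[of _ 0]) simp
next
  case (pCons a p)
  then obtain e q where "\<forall>y. poly p y = poly e (y\<^sup>2) + y * poly q (y\<^sup>2)" by blast
  then show ?case by (intro exI[of _ "pCons a q"] exI[of _ e]) (simp add: algebra_simps power2_eq_square)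
qed

lemma bipoly_even_odd:
  assumes "bipoly F"
  shows "\<exists>E Q. bipoly E \<and> bipoly Q \<and> (\<forall>x y. F x y = E x (y\<^sup>2) + y * Q x (y\<^sup>2))"
proof -
  obtain P where P: "\<And>x y. F x y = poly2 P x y" using assms bipoly_def by blast
  have "\<exists>E Q. bipoly E \<and> bipoly Q \<and> (\<forall>x y. poly2 P x y = E x (y\<^sup>2) + y * Q x (y\<^sup>2))"
  proof (induction P)
    case 0
    show ?case by (intro exI[of _ "\<lambda>x y. 0"]) (simp add: poly2_0 bipoly_const)
  next
    case (pCons c P)
    then obtain E Q where EQ: "bipoly E" "bipoly Q" "\<And>x y. poly2 P x y = E x (y\<^sup>2) + y * Q x (y\<^sup>2)" by blast
    obtain e q where eq: "\<And>y. poly c y = poly e (y\<^sup>2) + y * poly q (y\<^sup>2)" using poly_even_odd by blast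
    have "bipoly (\<lambda>x y. poly e y + x * E x y)" "bipoly (\<lambda>x y. poly q y + x * Q x y)"
      by (intro bipoly_add bipoly_mult bipoly_fst bipoly_poly bipoly_snd EQ)+
    moreover have "poly2 (pCons c P) x y = (poly e (y\<^sup>2) + x * E x (y\<^sup>2)) + y * (poly q (y\<^sup>2) + x * Q x (y\<^sup>2))" for x y
      by (simp add: poly2_pCons EQ eq algebra_simps)
    ultimately show ?case by blast
  qed
  then show ?thesis by (simp add: P)
qed

text \<open>The curve in the \<open>(\<phi>, r)\<close>-plane is compact, so only finitely many of the representations
  \<open>(x + 2\<pi>k, r)\<close> and \<open>(x - \<pi> + 2\<pi>k, -r)\<close> of a point can occur on it; the product over all of them
  and over both signs of \<open>r\<close> is a polynomial in \<open>x\<close> and \<open>r\<^sup>2\<close>.\<close>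

lemma algebraic_in_polar_relation:
  assumes "algebraic_in_polar \<beta>"
  shows "\<exists>T. T \<noteq> 0 \<and> (\<forall>x r. 0 < r \<and> 0 \<le> x \<and> x \<le> pi \<and> polar (x, r) \<in> \<beta> \<longrightarrow>
           poly2 T (pi\<^sup>2 * r\<^sup>2 - x) (pi\<^sup>2 * r\<^sup>2 + x) = 0)"
proof -
  obtain g P where g: "arc g" "P \<noteq> 0" "\<forall>(\<phi>, r)\<in>path_image g. poly2 P \<phi> r = 0" "\<beta> = polar ` path_image g"
    using assms unfolding algebraic_in_polar_def algebraic_curve_def is_curve_def by blast
  have "bounded (path_image g)" using g(1) by (simp add: arc_imp_path bounded_path_image)
  then obtain K where K: "\<And>z. z \<in> path_image g \<Longrightarrow> norm z \<le> K" unfolding bounded_iff by blast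
  have K': "\<bar>\<phi>\<bar> \<le> K" if "(\<phi>, r) \<in> path_image g" for \<phi> r
  proof -
    have "\<bar>\<phi>\<bar> \<le> norm (\<phi>, r)" using norm_fst_le[of \<phi> r] by simp
    then show ?thesis using K[OF that] by simp
  qed
  \<comment> \<open>Angles on the compact curve are bounded by \<open>K\<close> and \<open>x\<close>
    lies in \<open>[0, pi]\<close>, so \<open>2 * pi * k\<close> is at most
    \<open>K + 2 * pi\<close> in absolute value.\<close>
  define M where "M = \<lceil>(K + 2 * pi) / (2 * pi)\<rceil>"
  have M: "k \<in> {-M..M}" if "\<bar>2 * pi * real_of_int k\<bar> \<le> K + 2 * pi" for k :: int
  proof -
    have "2 * pi * \<bar>real_of_int k\<bar> \<le> K + 2 * pi" using that by (simp add: abs_mult)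
    then have "\<bar>real_of_int k\<bar> \<le> (K + 2 * pi) / (2 * pi)" by (simp add: field_simps)
    also have "\<dots> \<le> M" unfolding M_def by linarith
    finally show ?thesis by auto
  qed
  define G where "G k x y = poly2 P (x + 2 * pi * real_of_int k) y * poly2 P (x - pi + 2 * pi * real_of_int k) (- y)" for k :: int and x y
  define F where "F x y = (\<Prod>k\<in>{-M..M}. G k x y)" for x y
  obtain x0 y0 where nz: "poly2 P x0 y0 \<noteq> 0" using g(2) poly2_eq_0_iff[of P] by blast
  have F: "bipoly F" "\<exists>x y. F x y \<noteq> 0"
  proof -
    have b1: "bipoly (\<lambda>x y. poly2 P (x + 2 * pi * real_of_int k) y)" for k
      by (intro bipoly_subst[OF bipoly_poly2] bipoly_add bipoly_fst bipoly_const bipoly_snd)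
    have b2: "bipoly (\<lambda>x y. poly2 P (x - pi + 2 * pi * real_of_int k) (- y))" for k
    proof -
      have "bipoly (\<lambda>x y. poly2 P (x - pi + 2 * pi * real_of_int k) (0 - y))"
        by (intro bipoly_subst[OF bipoly_poly2] bipoly_add bipoly_diff bipoly_fst bipoly_const bipoly_snd)
      then show ?thesis by simp
    qed
    have n1: "\<exists>x y. poly2 P (x + 2 * pi * real_of_int k) y \<noteq> 0" for k
      using nz by (intro exI[of _ "x0 - 2 * pi * real_of_int k"] exI[of _ y0]) simp
    have n2: "\<exists>x y. poly2 P (x - pi + 2 * pi * real_of_int k) (- y) \<noteq> 0" for k
      using nz by (intro exI[of _ "x0 + pi - 2 * pi * real_of_int k"] exI[of _ "- y0"]) simp
    have "bipoly (G k)" for k unfolding G_def by (rule bipoly_mult[OF b1 b2])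
    moreover have "\<exists>x y. G k x y \<noteq> 0" for k unfolding G_def by (rule bipoly_nonzero_mult[OF b1 b2 n1 n2])
    ultimately show "bipoly F" "\<exists>x y. F x y \<noteq> 0"
      unfolding F_def using bipoly_prod[of "{-M..M}" G] by auto
  qed
  have F0: "F x r = 0" if r: "0 < r" and x: "0 \<le> x" "x \<le> pi" and mem: "polar (x, r) \<in> \<beta>" for x r
  proof -
    obtain \<phi> r' where c: "(\<phi>, r') \<in> path_image g" "polar (x, r) = polar (\<phi>, r')" using mem g(4) by auto
    have P0: "poly2 P \<phi> r' = 0" using c(1) g(3) by blast
    have "\<bar>r'\<bar> = r" using c(2) r by (metis abs_of_pos norm_polar)
    then consider "r' = r" | "r' = - r" by linarith
    then have "\<exists>k\<in>{-M..M}. G k x r = 0"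
    proof cases
      case 1
      then obtain k :: int where k: "\<phi> = x + 2 * pi * k" using c(2) polar_eq_iff[OF r] by metis
      have "k \<in> {-M..M}" using K'[OF c(1)] k x by (intro M) linarith
      moreover have "G k x r = 0" using P0 k 1 by (simp add: G_def)
      ultimately show ?thesis by blast
    next
      case 2
      then have "polar (x, r) = polar (\<phi> + pi, r)" using c(2) by (simp add: polar_minus polar_plus_pi)
      then obtain k :: int where "\<phi> + pi = x + 2 * pi * k" using polar_eq_iff[OF r] by metis
      then have k: "\<phi> = x - pi + 2 * pi * k" by simp
      have "k \<in> {-M..M}" using K'[OF c(1)] k x by (intro M) linarith
      moreover have "G k x r = 0" using P0 k 2 by (simp add: G_def)
      ultimately show ?thesis by blast
    qed
    then show ?thesis unfolding F_def by auto
  qed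
  obtain E Q where EQ: "bipoly E" "bipoly Q" "\<And>x y. F x y = E x (y\<^sup>2) + y * Q x (y\<^sup>2)"
    using bipoly_even_odd[OF F(1)] by blast
  \<comment> \<open>The norm of \<open>F\<close>: its product with the conjugate under y -> -y,
    written in z = y^2.\<close>
  define S where "S x z = E x z * E x z - z * (Q x z * Q x z)" for x z
  have S: "S x (y\<^sup>2) = F x y * F x (- y)" for x y
    by (simp add: S_def EQ(3) algebra_simps power2_eq_square)
  have bS: "bipoly S" unfolding S_def by (intro bipoly_diff bipoly_mult bipoly_snd EQ)
  have nzS: "\<exists>x z. S x z \<noteq> 0"
  proof -
    have "bipoly (\<lambda>x y. F x (0 - y))" by (intro bipoly_subst[OF F(1)] bipoly_fst bipoly_diff bipoly_const bipoly_snd)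
    then have "bipoly (\<lambda>x y. F x (- y))" by simp
    moreover have "\<exists>x y. F x (- y) \<noteq> 0" using F(2) by (metis minus_minus)
    ultimately have "\<exists>x y. F x y * F x (- y) \<noteq> 0" using F bipoly_nonzero_mult by blast
    then show ?thesis using S by metis
  qed
  \<comment> \<open>The substitution inverts w = pi^2 z - x and u = pi^2 z + x, where z stands for
    r^2.\<close>
  have "bipoly (\<lambda>w u. S ((1 / 2) * (u - w)) (1 / (2 * pi\<^sup>2) * (u + w)))"
    by (intro bipoly_subst[OF bS] bipoly_mult bipoly_add bipoly_diff bipoly_fst bipoly_const bipoly_snd)
  then obtain T where T: "\<And>w u. S ((1 / 2) * (u - w)) (1 / (2 * pi\<^sup>2) * (u + w)) = poly2 T w u"
    unfolding bipoly_def by blast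
  have T': "poly2 T (pi\<^sup>2 * z - x) (pi\<^sup>2 * z + x) = S x z" for x z
    unfolding T[symmetric] by simp
  have "T \<noteq> 0" using nzS T' by (metis poly2_0)
  moreover have "poly2 T (pi\<^sup>2 * r\<^sup>2 - x) (pi\<^sup>2 * r\<^sup>2 + x) = 0"
    if "0 < r" "0 \<le> x" "x \<le> pi" "polar (x, r) \<in> \<beta>" for x r
    unfolding T' S using F0[OF that] by simp
  ultimately show ?thesis by blast
qed

section \<open>Recognizing the spiral\<close>

lemma arctan_cot: "0 < x \<Longrightarrow> x < pi \<Longrightarrow> arctan (cos x / sin x) = pi / 2 - x"
proof -
  assume "0 < x" "x < pi"
  moreover have "tan (pi / 2 - x) = cos x / sin x" by (simp add: tan_def sin_diff cos_diff)
  ultimately show ?thesis using arctan_tan[of "pi / 2 - x"] by simp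
qed

lemma closure_of_half_circle:
  assumes "\<And>\<theta>. c < \<theta> \<Longrightarrow> \<theta> < d \<Longrightarrow> polar (\<theta>, r) \<in> X" "c < d"
  shows "polar (c, r) \<in> closure X" "polar (d, r) \<in> closure X"
proof -
  have cont: "continuous_on (closure {c<..<d}) (\<lambda>\<theta>. polar (\<theta>, r))" by (intro continuous_intros)
  have "(\<lambda>\<theta>. polar (\<theta>, r)) ` closure {c<..<d} \<subseteq> closure X"
    by (rule image_closure_subset[OF cont]) (use assms closure_subset[of X] in auto)
  then show "polar (c, r) \<in> closure X" "polar (d, r) \<in> closure X"
    using assms(2) by (auto simp: closure_greaterThanLessThan)
qed

text \<open>Each part of the disk contains only an open half of the boundary circle, so antipodal
  boundary points are found in its closure; continuity keeps their images in the disk.\<close>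

lemma isometry_into_disk_fixes_origin:
  assumes f: "isometry f" "f ` X \<subseteq> disk" and e: "norm e = R" "e \<in> closure X" "- e \<in> closure X"
  shows "f 0 = 0"
proof -
  have "f ` closure X \<subseteq> disk"
    by (rule image_closure_subset[OF isometry_continuous[OF f(1)] _ f(2)]) (simp add: disk_def)
  then have "norm (f e) \<le> R" "norm (f (- e)) \<le> R" using e by (auto simp: disk_def)
  then show ?thesis using isometry_fixes_origin[OF f(1) e(1)] by blast
qed

section \<open>A curve whose tangent at the centre has angle 0\<close>

text \<open>Both halves leave the centre with growing radius and growing angle: from 0 to pi after
  \<open>t0\<close>, and from pi to 2pi when the first half is followed backwards from
  \<open>t0\<close>.\<close>

locale normalized_curve =
  fixes \<gamma> :: "real \<Rightarrow> real^2" and F :: "nat \<Rightarrow> real \<Rightarrow> real^2" and t0 :: real and \<theta> :: "real \<Rightarrow> real"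
  assumes t0: "0 < t0" "t0 < 1"
    and F0: "F 0 = \<gamma>"
    and dF: "\<And>k t. t \<in> {0..1} \<Longrightarrow> (F k has_vector_derivative F (Suc k) t) (at t within {0..1})"
    and regular: "\<And>t. t \<in> {0..1} \<Longrightarrow> F 1 t \<noteq> 0"
    and inj_norm: "inj_on (\<lambda>t. norm (\<gamma> t)) {0..t0}" "inj_on (\<lambda>t. norm (\<gamma> t)) {t0..1}"
    and norm_ends: "norm (\<gamma> 0) = R" "norm (\<gamma> 1) = R" and \<gamma>t0: "\<gamma> t0 = 0"
    and cont_\<theta>: "continuous_on {0..1} \<theta>"
    and \<theta>_vals: "\<theta> t0 = 0" "\<theta> 0 = pi" "\<theta> 1 = pi"
    and \<theta>_mono: "strict_mono_on {t0..1} \<theta>" "strict_mono_on {0..t0} (\<lambda>t. - \<theta> t)"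
    and right: "\<And>t. t \<in> {t0..1} \<Longrightarrow> \<gamma> t = polar (\<theta> t, norm (\<gamma> t))"
    and left: "\<And>t. t \<in> {0..t0} \<Longrightarrow> \<gamma> t = polar (\<theta> t + pi, norm (\<gamma> t))"
begin

definition n :: "real \<Rightarrow> real" where "n t = norm (\<gamma> t)"

lemma n_vals: "n t0 = 0" "n 0 = R" "n 1 = R"
  using norm_ends \<gamma>t0 by (simp_all add: n_def)

lemma cont_\<gamma>: "continuous_on {0..1} \<gamma>"
  unfolding continuous_on_eq_continuous_within F0[symmetric]
  using has_vector_derivative_continuous[OF dF] by blast

lemma cont_n: "continuous_on {0..1} n"
  unfolding n_def by (intro continuous_intros cont_\<gamma>)

lemma cont_halves:
  "continuous_on {t0..1} n" "continuous_on {0..t0} n" "continuous_on {t0..1} \<theta>" "continuous_on {0..t0} \<theta>"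
proof -
  have "{t0..1} \<subseteq> {0..1}" "{0..t0} \<subseteq> {0..1}" using t0 by auto
  then show "continuous_on {t0..1} n" "continuous_on {0..t0} n" "continuous_on {t0..1} \<theta>" "continuous_on {0..t0} \<theta>"
    using continuous_on_subset[OF cont_n] continuous_on_subset[OF cont_\<theta>] by blast+
qed

lemma n_mono: "strict_mono_on {t0..1} n" "strict_mono_on {0..t0} (\<lambda>t. - n t)"
proof -
  show "strict_mono_on {t0..1} n"
    using inj_norm(2) n_vals t0 R_pos by (intro strict_mono_on_continuous_inj cont_halves) (auto simp: n_def[abs_def])
  have "inj_on (\<lambda>t. - n t) {0..t0}"
  proof (rule inj_onI)
    fix s t assume "s \<in> {0..t0}" "t \<in> {0..t0}" "- n s = - n t"
    then show "s = t" using inj_onD[OF inj_norm(1), of s t] by (simp add: n_def)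
  qed
  then show "strict_mono_on {0..t0} (\<lambda>t. - n t)"
    using n_vals t0 R_pos by (intro strict_mono_on_continuous_inj continuous_on_minus cont_halves) auto
qed

lemma n_image: "n ` {t0..1} = {0..R}" "n ` {0..t0} = {0..R}"
proof -
  have 1: "0 \<le> n t \<and> n t \<le> R" if "t \<in> {t0..1}" for t
    using strict_mono_onD[OF n_mono(1), of t 1] that t0 n_vals by (cases "t = 1") (auto simp: n_def)
  have 2: "0 \<le> n t \<and> n t \<le> R" if "t \<in> {0..t0}" for t
    using strict_mono_onD[OF n_mono(2), of 0 t] that t0 n_vals by (cases "t = 0") (auto simp: n_def)
  have 3: "\<rho> \<in> n ` {t0..1}" if "\<rho> \<in> {0..R}" for \<rho>
    using IVT'[of n t0 \<rho> 1] that t0 n_vals cont_halves by auto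
  have 4: "\<rho> \<in> n ` {0..t0}" if "\<rho> \<in> {0..R}" for \<rho>
    using IVT2'[of n t0 \<rho> 0] that t0 n_vals cont_halves by auto
  show "n ` {t0..1} = {0..R}"
  proof (intro subset_antisym subsetI)
    fix x assume "x \<in> n ` {t0..1}" then show "x \<in> {0..R}" using 1 by fastforce
  qed (rule 3)
  show "n ` {0..t0} = {0..R}"
  proof (intro subset_antisym subsetI)
    fix x assume "x \<in> n ` {0..t0}" then show "x \<in> {0..R}" using 2 by fastforce
  qed (rule 4)
qed

text \<open>The polar angle as a function of the radius, \<open>p\<close> on the half after
  \<open>t0\<close> and \<open>q\<close> on the half before it.\<close>

definition p :: "real \<Rightarrow> real" where "p \<rho> = \<theta> (inv_into {t0..1} n \<rho>)"
definition q :: "real \<Rightarrow> real" where "q \<rho> = \<theta> (inv_into {0..t0} n \<rho>) + pi"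

lemma inj_n: "inj_on n {t0..1}" "inj_on n {0..t0}"
  using inj_norm by (simp_all add: n_def[abs_def])

lemma p_n: "t \<in> {t0..1} \<Longrightarrow> p (n t) = \<theta> t"
  by (simp add: p_def inv_into_f_f[OF inj_n(1)])

lemma q_n: "t \<in> {0..t0} \<Longrightarrow> q (n t) = \<theta> t + pi"
  by (simp add: q_def inv_into_f_f[OF inj_n(2)])

lemma obtain_right: assumes "\<rho> \<in> {0..R}" shows "\<exists>t\<in>{t0..1}. n t = \<rho>"
  using assms unfolding n_image(1)[symmetric] by blast

lemma obtain_left: assumes "\<rho> \<in> {0..R}" shows "\<exists>t\<in>{0..t0}. n t = \<rho>"
  using assms unfolding n_image(2)[symmetric] by blast

lemma cont_pq: "continuous_on {0..R} p" "continuous_on {0..R} q"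
proof -
  have "continuous_on (n ` {t0..1}) (inv_into {t0..1} n)"
    by (rule continuous_on_inv[OF cont_halves(1)]) (auto simp: inv_into_f_f[OF inj_n(1)])
  then show "continuous_on {0..R} p"
    unfolding p_def n_image by (rule continuous_on_compose2[OF cont_halves(3)]) (use inv_into_into[of _ n "{t0..1}"] n_image in blast)
  have "continuous_on (n ` {0..t0}) (inv_into {0..t0} n)"
    by (rule continuous_on_inv[OF cont_halves(2)]) (auto simp: inv_into_f_f[OF inj_n(2)])
  then have "continuous_on {0..R} (\<lambda>\<rho>. \<theta> (inv_into {0..t0} n \<rho>))"
    unfolding n_image by (rule continuous_on_compose2[OF cont_halves(4)]) (use inv_into_into[of _ n "{0..t0}"] n_image in blast)
  then show "continuous_on {0..R} q" unfolding q_def by (intro continuous_intros)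
qed

lemma p_mono: "strict_mono_on {0..R} p"
proof (rule strict_mono_onI)
  fix r s assume rs: "r \<in> {0..R}" "s \<in> {0..R}" "r < s"
  obtain t where t: "t \<in> {t0..1}" "n t = r" using obtain_right[OF rs(1)] by blast
  obtain t' where t': "t' \<in> {t0..1}" "n t' = s" using obtain_right[OF rs(2)] by blast
  have "t < t'" using strict_mono_on_less[OF n_mono(1) t(1) t'(1)] t t' rs by simp
  then have "\<theta> t < \<theta> t'" using strict_mono_onD[OF \<theta>_mono(1) t(1) t'(1)] by blast
  then show "p r < p s" using p_n t t' by metis
qed

lemma pq_vals: "p 0 = 0" "p R = pi" "q 0 = pi" "q R = 2 * pi"
proof -
  show "p 0 = 0" using p_n[of t0] n_vals \<theta>_vals t0 by simp
  show "p R = pi" using p_n[of 1] t0 unfolding n_vals \<theta>_vals by simp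
  show "q 0 = pi" using q_n[of t0] n_vals \<theta>_vals t0 by simp
  show "q R = 2 * pi" using q_n[of 0] t0 unfolding n_vals \<theta>_vals by simp
qed

lemma q_range: "\<rho> \<in> {0..R} \<Longrightarrow> pi \<le> q \<rho> \<and> q \<rho> \<le> 2 * pi"
proof -
  assume "\<rho> \<in> {0..R}"
  then obtain t where t: "t \<in> {0..t0}" "n t = \<rho>" using obtain_left by blast
  have "0 \<le> \<theta> t" using strict_mono_onD[OF \<theta>_mono(2), of t t0] t t0 \<theta>_vals by (cases "t = t0") auto
  moreover have "\<theta> t \<le> pi" using strict_mono_onD[OF \<theta>_mono(2), of 0 t] t t0 \<theta>_vals by (cases "t = 0") auto
  ultimately show ?thesis using q_n[OF t(1)] t(2) by simp
qed

text \<open>The ranges of the two angles could meet only at pi, which \<open>p\<close> reaches only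
  at \<open>R\<close>, where \<open>q\<close> is already \<open>2 * pi\<close>.\<close>

lemma p_less_q: "\<rho> \<in> {0..R} \<Longrightarrow> p \<rho> < q \<rho>"
  using strict_mono_onD[OF p_mono, of \<rho> R] pq_vals q_range[of \<rho>] pi_gt_zero by (cases "\<rho> = R") auto

lemma q_less_p: "\<rho> \<in> {0..R} \<Longrightarrow> q \<rho> < p \<rho> + 2 * pi"
  using strict_mono_onD[OF p_mono, of 0 \<rho>] pq_vals q_range[of \<rho>] pi_gt_zero by (cases "\<rho> = 0") auto

lemma path_image_two_branches: "path_image \<gamma> = two_branches p q"
proof -
  have "{0..1} = {t0..1} \<union> {0..t0}" using t0 by auto
  then have "path_image \<gamma> = \<gamma> ` {t0..1} \<union> \<gamma> ` {0..t0}" unfolding path_image_def by (simp only: image_Un)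
  also have "\<gamma> ` {t0..1} = (\<lambda>t. polar (p (n t), n t)) ` {t0..1}"
    using right p_n by (intro image_cong) (simp_all add: n_def)
  also have "\<dots> = (\<lambda>\<rho>. polar (p \<rho>, \<rho>)) ` {0..R}" unfolding n_image(1)[symmetric] by (simp only: image_image)
  also have "\<gamma> ` {0..t0} = (\<lambda>t. polar (q (n t), n t)) ` {0..t0}"
    using left q_n by (intro image_cong) (simp_all add: n_def)
  also have "\<dots> = (\<lambda>\<rho>. polar (q \<rho>, \<rho>)) ` {0..R}" unfolding n_image(2)[symmetric] by (simp only: image_image)
  finally show ?thesis by (simp add: two_branches_def)
qed

lemma splits: "splits_disk_into (path_image \<gamma>) (sector p q) (sector q (\<lambda>\<rho>. p \<rho> + 2 * pi))"
  unfolding path_image_two_branches by (rule splits_two_branches[OF cont_pq p_less_q q_less_p])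

text \<open>The congruence fixes the centre, hence preserves every concentric circle. There it
  carries an arc of length q - p onto one of length p + 2pi - q.\<close>

lemma q_eq_p_plus_pi:
  assumes "splits_congruent (path_image \<gamma>)" and \<rho>: "\<rho> \<in> {0..R}"
  shows "q \<rho> = p \<rho> + pi"
proof (cases "\<rho> = 0")
  case True then show ?thesis using pq_vals by simp
next
  case False
  then have \<rho>0: "0 < \<rho>" "\<rho> \<le> R" using \<rho> by auto
  define A B where "A = sector p q" and "B = sector q (\<lambda>\<rho>. p \<rho> + 2 * pi)"
  define e where "e = polar (pi, R)"
  have e: "norm e = R" "- e = polar (2 * pi, R)" "e = polar (3 * pi, R)"
    using polar_plus_pi[of pi R] polar_plus_pi[of "2 * pi" R] unfolding e_def by simp_all
  have AR: "polar (\<theta>, R) \<in> A" if "pi < \<theta>" "\<theta> < 2 * pi" for \<theta>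
    unfolding A_def using that pq_vals by (intro sectorI) auto
  have BR: "polar (\<theta>, R) \<in> B" if "2 * pi < \<theta>" "\<theta> < 3 * pi" for \<theta>
    unfolding B_def using that pq_vals by (intro sectorI) auto
  have clA: "e \<in> closure A" "- e \<in> closure A"
    unfolding e(2) unfolding e_def by (rule closure_of_half_circle[of pi "2 * pi" R A, OF AR]; simp)+
  have clB: "e \<in> closure B" "- e \<in> closure B"
    unfolding e(2) unfolding e(3) by (rule closure_of_half_circle[of "2 * pi" "3 * pi" R B, OF BR]; simp)+
  have sub: "A \<subseteq> disk" "B \<subseteq> disk" unfolding A_def B_def sector_def disk_def by auto
  obtain A' B' f where f: "splits_disk_into (path_image \<gamma>) A' B'" "isometry f" "f ` A' = B'"
    using assms(1) unfolding splits_congruent_def congruent_sets_def by blast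
  have "{A', B'} = {A, B}" "A' \<noteq> B'"
    using f(1) splits unfolding splits_disk_into_def A_def B_def by auto
  then consider "A' = A" "B' = B" | "A' = B" "B' = A" by (auto simp: doubleton_eq_iff)
  then have "\<exists>g. isometry g \<and> g 0 = 0 \<and> g ` A = B"
  proof cases
    case 1
    then have "f 0 = 0" using isometry_into_disk_fixes_origin[OF f(2) _ e(1) clA] f(3) sub by simp
    then show ?thesis using f 1 by blast
  next
    case 2
    then have f0: "f 0 = 0" using isometry_into_disk_fixes_origin[OF f(2) _ e(1) clB] f(3) sub by simp
    obtain g where g: "isometry g" "g 0 = 0" "\<And>x. g (f x) = x" using isometry_inverse[OF f(2) f0] by blast
    have "g ` A = B" using f(3) 2 g(3) by (auto simp: image_image)
    then show ?thesis using g by blast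
  qed
  then obtain g where g: "isometry g" "g 0 = 0" "g ` A = B" by blast
  obtain \<alpha> \<sigma> where \<sigma>: "\<sigma> = 1 \<or> \<sigma> = -1" and gp: "\<And>\<theta> r. g (polar (\<theta>, r)) = polar (\<alpha> + \<sigma> * \<theta>, r)"
    using isometry_polar[OF g(1,2)] by blast
  have arcs: "sector a b \<inter> sphere 0 \<rho> = (\<lambda>\<theta>. polar (\<theta>, \<rho>)) ` {a \<rho><..<b \<rho>}" for a b
  proof (intro set_eqI iffI)
    fix x assume "x \<in> sector a b \<inter> sphere 0 \<rho>"
    then show "x \<in> (\<lambda>\<theta>. polar (\<theta>, \<rho>)) ` {a \<rho><..<b \<rho>}" using sectorE[of x a b] by auto
  next
    fix x assume "x \<in> (\<lambda>\<theta>. polar (\<theta>, \<rho>)) ` {a \<rho><..<b \<rho>}"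
    then show "x \<in> sector a b \<inter> sphere 0 \<rho>" using \<rho>0 by (auto intro: sectorI)
  qed
  have "g ` (A \<inter> sphere 0 \<rho>) = B \<inter> sphere 0 \<rho>"
    using image_Int[OF isometry_inj[OF g(1,2)]] g(3) isometry_image_cball(2)[OF g(1,2)] by metis
  then have eq: "(\<lambda>\<theta>. polar (\<alpha> + \<sigma> * \<theta>, \<rho>)) ` {p \<rho><..<q \<rho>} = (\<lambda>\<theta>. polar (\<theta>, \<rho>)) ` {q \<rho><..<p \<rho> + 2 * pi}"
    unfolding A_def B_def arcs by (simp add: image_image gp)
  define c d where "c = (if \<sigma> = 1 then \<alpha> + p \<rho> else \<alpha> - q \<rho>)" and "d = (if \<sigma> = 1 then \<alpha> + q \<rho> else \<alpha> - p \<rho>)"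
  have "(\<lambda>\<theta>. \<alpha> + \<sigma> * \<theta>) ` {p \<rho><..<q \<rho>} = {c<..<d}"
  proof (intro set_eqI iffI)
    fix x assume "x \<in> {c<..<d}"
    then show "x \<in> (\<lambda>\<theta>. \<alpha> + \<sigma> * \<theta>) ` {p \<rho><..<q \<rho>}"
      using \<sigma> by (intro image_eqI[of _ _ "\<sigma> * (x - \<alpha>)"]) (auto simp: c_def d_def)
  qed (use \<sigma> in \<open>auto simp: c_def d_def\<close>)
  then have "(\<lambda>\<theta>. polar (\<theta>, \<rho>)) ` (\<lambda>\<theta>. \<alpha> + \<sigma> * \<theta>) ` {p \<rho><..<q \<rho>} = (\<lambda>\<theta>. polar (\<theta>, \<rho>)) ` {c<..<d}" by simp
  then have "(\<lambda>\<theta>. polar (\<alpha> + \<sigma> * \<theta>, \<rho>)) ` {p \<rho><..<q \<rho>} = (\<lambda>\<theta>. polar (\<theta>, \<rho>)) ` {c<..<d}" unfolding image_image .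
  then have eq': "(\<lambda>\<theta>. polar (\<theta>, \<rho>)) ` {q \<rho><..<p \<rho> + 2 * pi} = (\<lambda>\<theta>. polar (\<theta>, \<rho>)) ` {c<..<d}" using eq by simp
  have dc: "d - c = q \<rho> - p \<rho>" by (auto simp: c_def d_def)
  then have "\<exists>k::int. c = q \<rho> + 2 * pi * k \<and> d = p \<rho> + 2 * pi + 2 * pi * k"
    using p_less_q[OF \<rho>] q_less_p[OF \<rho>] by (intro arc_endpoints_unique[OF \<rho>0(1) _ _ _ _ eq']) linarith+
  then obtain k :: int where "c = q \<rho> + 2 * pi * k \<and> d = p \<rho> + 2 * pi + 2 * pi * k" by blast
  then show ?thesis using dc by simp
qed

lemma c_diff_component: "c_diff m {t0<..<1} (\<lambda>t. F k t $ i)"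
proof (induction m arbitrary: k)
  case 0
  have "continuous_on {0..1} (F k)"
    unfolding continuous_on_eq_continuous_within using has_vector_derivative_continuous[OF dF] by blast
  then have "continuous_on {t0<..<1} (F k)" by (rule continuous_on_subset) (use t0 in auto)
  then have "continuous_on {t0<..<1} (\<lambda>t. F k t $ i)"
    by (rule bounded_linear.continuous_on[OF bounded_linear_vec_nth])
  then show ?case by (simp only: c_diff.simps)
next
  case (Suc m)
  have d: "((\<lambda>t. F k t $ i) has_real_derivative F (Suc k) t $ i) (at t)" if t: "t \<in> {t0<..<1}" for t
  proof -
    have "at t within {0..1} = at t" using t t0 by (intro at_within_interior) auto
    then have "(F k has_vector_derivative F (Suc k) t) (at t)" using dF[of t k] t t0 by auto
    then have "((\<lambda>t. F k t $ i) has_vector_derivative F (Suc k) t $ i) (at t)"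
      by (rule bounded_linear.has_vector_derivative[OF bounded_linear_vec_nth])
    then show ?thesis by (simp add: has_real_derivative_iff_has_vector_derivative)
  qed
  show ?case
    unfolding c_diff.simps by (intro exI[of _ "\<lambda>t. F (Suc k) t $ i"] conjI ballI Suc d)
qed

lemma component_deriv:
  assumes "t \<in> {t0<..<1}"
  shows "((\<lambda>t. \<gamma> t $ i) has_real_derivative F 1 t $ i) (at t)"
proof -
  have "at t within {0..1} = at t" using assms t0 by (intro at_within_interior) auto
  then have "(\<gamma> has_vector_derivative F 1 t) (at t)" using dF[of t 0] F0 assms t0 by auto
  then have "((\<lambda>t. \<gamma> t $ i) has_vector_derivative F 1 t $ i) (at t)"
    by (rule bounded_linear.has_vector_derivative[OF bounded_linear_vec_nth])
  then show ?thesis by (simp add: has_real_derivative_iff_has_vector_derivative)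
qed

lemma n_square: "(n t)\<^sup>2 = (\<gamma> t $ 1)\<^sup>2 + (\<gamma> t $ 2)\<^sup>2"
  by (simp add: n_def norm_vec2)

lemma open_half_range:
  assumes "t \<in> {t0<..<1}" shows "0 < n t" "n t < R" "0 < \<theta> t" "\<theta> t < pi"
  using strict_mono_onD[OF n_mono(1), of t0 t] strict_mono_onD[OF n_mono(1), of t 1]
    strict_mono_onD[OF \<theta>_mono(1), of t0 t] strict_mono_onD[OF \<theta>_mono(1), of t 1] assms n_vals \<theta>_vals t0
  by auto

lemma \<gamma>2_pos: "t \<in> {t0<..<1} \<Longrightarrow> \<gamma> t $ 2 > 0"
proof -
  assume t: "t \<in> {t0<..<1}"
  have "\<gamma> t = polar (\<theta> t, n t)" using right[of t] t by (auto simp: n_def)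
  then have "\<gamma> t $ 2 = n t * sin (\<theta> t)" by simp
  then show ?thesis using open_half_range[OF t] by (simp add: sin_gt_zero)
qed

text \<open>The area coordinate along the curve; the spiral is the line z = \<theta>.\<close>

definition z :: "real \<Rightarrow> real" where "z t = pi\<^sup>2 * (n t)\<^sup>2"

text \<open>The derivative (x y' - y x') / (x^2 + y^2) of the argument, spelled with products and
  \<open>inverse\<close> to match the closure rules of \<open>c_diff\<close>.\<close>

definition \<theta>' :: "real \<Rightarrow> real" where
  "\<theta>' t = (\<gamma> t $ 1 * F 1 t $ 2 - \<gamma> t $ 2 * F 1 t $ 1) * inverse (\<gamma> t $ 1 * \<gamma> t $ 1 + \<gamma> t $ 2 * \<gamma> t $ 2)"

definition z' :: "real \<Rightarrow> real" where
  "z' t = pi\<^sup>2 * (2 * (\<gamma> t $ 1 * F 1 t $ 1 + \<gamma> t $ 2 * F 1 t $ 2))"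

lemma z_deriv: "t \<in> {t0<..<1} \<Longrightarrow> (z has_real_derivative z' t) (at t)"
proof -
  assume t: "t \<in> {t0<..<1}"
  have "((\<lambda>t. pi\<^sup>2 * ((\<gamma> t $ 1)\<^sup>2 + (\<gamma> t $ 2)\<^sup>2)) has_real_derivative z' t) (at t)"
    by (rule derivative_eq_intros component_deriv[OF t] refl)+ (simp add: z'_def algebra_simps)
  then show ?thesis unfolding z_def n_square .
qed

text \<open>The angle was obtained as a continuous function only. Between \<open>t0\<close> and 1
  the curve stays in the open upper half plane, where the angle is pi/2 - arctan (x/y).\<close>

lemma \<theta>_deriv: "t \<in> {t0<..<1} \<Longrightarrow> (\<theta> has_real_derivative \<theta>' t) (at t)"
proof -
  assume t: "t \<in> {t0<..<1}"
  define a b a' b' where "a = \<gamma> t $ 1" and "b = \<gamma> t $ 2" and "a' = F 1 t $ 1" and "b' = F 1 t $ 2"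
  have b: "b > 0" using \<gamma>2_pos[OF t] by (simp add: b_def)
  have da: "((\<lambda>t. \<gamma> t $ 1) has_real_derivative a') (at t)" and db: "((\<lambda>t. \<gamma> t $ 2) has_real_derivative b') (at t)"
    using component_deriv[OF t] by (simp_all add: a'_def b'_def)
  have 1: "((\<lambda>s. \<gamma> s $ 1 / \<gamma> s $ 2) has_real_derivative (a' * b - a * b') / (b * b)) (at t)"
    using DERIV_divide[OF da db] b by (simp add: a_def b_def)
  have "((\<lambda>s. arctan (\<gamma> s $ 1 / \<gamma> s $ 2)) has_real_derivative inverse (1 + (a / b)\<^sup>2) * ((a' * b - a * b') / (b * b))) (at t)"
    using DERIV_chain2[OF DERIV_arctan 1] unfolding a_def b_def .
  then have "((\<lambda>s. pi / 2 - arctan (\<gamma> s $ 1 / \<gamma> s $ 2)) has_real_derivative 0 - inverse (1 + (a / b)\<^sup>2) * ((a' * b - a * b') / (b * b))) (at t)"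
    by (intro DERIV_diff DERIV_const)
  moreover have "0 - inverse (1 + (a / b)\<^sup>2) * ((a' * b - a * b') / (b * b)) = \<theta>' t"
  proof -
    have "1 + (a / b)\<^sup>2 = (a * a + b * b) / (b * b)" using b by (simp add: field_simps power2_eq_square)
    then have "inverse (1 + (a / b)\<^sup>2) = (b * b) / (a * a + b * b)" by simp
    then have "inverse (1 + (a / b)\<^sup>2) * ((a' * b - a * b') / (b * b)) = (a' * b - a * b') / (a * a + b * b)"
      using b by (simp only:) simp
    then show ?thesis unfolding \<theta>'_def a_def[symmetric] b_def[symmetric] a'_def[symmetric] b'_def[symmetric]
      by (simp only: divide_inverse) (simp add: algebra_simps)
  qed
  ultimately have "((\<lambda>s. pi / 2 - arctan (\<gamma> s $ 1 / \<gamma> s $ 2)) has_real_derivative \<theta>' t) (at t)" by simp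
  then show ?thesis
  proof (rule has_field_derivative_transform_within_open)
    show "open {t0<..<1}" "t \<in> {t0<..<1}" using t by auto
    fix s assume s: "s \<in> {t0<..<1}"
    have "\<gamma> s = polar (\<theta> s, n s)" using right[of s] s by (auto simp: n_def)
    then have "\<gamma> s $ 1 / \<gamma> s $ 2 = cos (\<theta> s) / sin (\<theta> s)" using open_half_range[OF s] by simp
    then show "pi / 2 - arctan (\<gamma> s $ 1 / \<gamma> s $ 2) = \<theta> s" using arctan_cot[of "\<theta> s"] open_half_range[OF s] by simp
  qed
qed

lemma smooth: "c_diff m {t0<..<1} z" "c_diff m {t0<..<1} \<theta>"
proof -
  have c: "c_diff m {t0<..<1} (\<lambda>t. \<gamma> t $ i)" "c_diff m {t0<..<1} (\<lambda>t. F 1 t $ i)" for m i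
    using c_diff_component[of m 0 i] c_diff_component[of m 1 i] F0 by auto
  have "c_diff m {t0<..<1} \<theta>'" for m
    unfolding \<theta>'_def
  proof (intro c_diff_mult c_diff_diff c_diff_inverse c_diff_add c)
    fix t assume "t \<in> {t0<..<1}"
    then have "\<gamma> t $ 2 > 0" by (rule \<gamma>2_pos)
    then have "\<gamma> t $ 2 * \<gamma> t $ 2 > 0" by simp
    then show "\<gamma> t $ 1 * \<gamma> t $ 1 + \<gamma> t $ 2 * \<gamma> t $ 2 \<noteq> 0"
      using zero_le_square[of "\<gamma> t $ 1"] by linarith
  qed
  then have "c_diff (Suc m) {t0<..<1} \<theta>" unfolding c_diff.simps using \<theta>_deriv by blast
  then show "c_diff m {t0<..<1} \<theta>" by (rule c_diff_Suc_imp)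
  have "c_diff m {t0<..<1} z'" unfolding z'_def by (intro c_diff_mult c_diff_const c_diff_add c)
  then have "c_diff (Suc m) {t0<..<1} z" unfolding c_diff.simps using z_deriv by blast
  then show "c_diff m {t0<..<1} z" by (rule c_diff_Suc_imp)
qed

text \<open>Both summands are nonnegative by monotonicity. If both vanished, the velocity would be
  orthogonal to the position vector and to its quarter turn, hence zero, against regularity.\<close>

lemma u_deriv_pos: "t \<in> {t0<..<1} \<Longrightarrow> z' t + \<theta>' t > 0"
proof -
  assume t: "t \<in> {t0<..<1}"
  have int: "t \<in> interior {t0..1}" using t by simp
  have "mono_on {t0..1} \<theta>" using \<theta>_mono(1) by (rule strict_mono_on_imp_mono_on)
  then have 1: "\<theta>' t \<ge> 0" using mono_on_imp_deriv_nonneg[OF _ \<theta>_deriv[OF t] int] by blast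
  have "mono_on {t0..1} z"
  proof (rule mono_onI)
    fix r s assume "r \<in> {t0..1}" "s \<in> {t0..1}" "r \<le> s"
    then have "n r \<le> n s" using strict_mono_on_imp_mono_on[OF n_mono(1)] by (simp add: mono_onD)
    then show "z r \<le> z s" unfolding z_def by (intro mult_left_mono power_mono) (auto simp: n_def)
  qed
  then have 2: "z' t \<ge> 0" using mono_on_imp_deriv_nonneg[OF _ z_deriv[OF t] int] by blast
  have "\<not> (\<theta>' t = 0 \<and> z' t = 0)"
  proof
    assume *: "\<theta>' t = 0 \<and> z' t = 0"
    define a b a' b' where "a = \<gamma> t $ 1" and "b = \<gamma> t $ 2" and "a' = F 1 t $ 1" and "b' = F 1 t $ 2"
    have b: "b > 0" using \<gamma>2_pos[OF t] by (simp add: b_def)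
    then have ab: "a * a + b * b > 0" using zero_le_square[of a] mult_pos_pos[OF b b] by linarith
    have "(a * b' - b * a') * inverse (a * a + b * b) = 0"
      using * unfolding \<theta>'_def a_def b_def a'_def b'_def by blast
    moreover have "inverse (a * a + b * b) \<noteq> 0" using ab by (metis inverse_nonzero_iff_nonzero less_irrefl)
    ultimately have e1: "a * b' - b * a' = 0" by (metis mult_eq_0_iff)
    have e2: "a * a' + b * b' = 0" using * unfolding z'_def a_def b_def a'_def b'_def by simp
    have "(a * a + b * b) * a' = a * (a * a' + b * b') - b * (a * b' - b * a')" by algebra
    then have "(a * a + b * b) * a' = 0" unfolding e1 e2 by (simp only: mult_zero_right diff_zero)
    then have "a' = 0" using ab by (metis less_irrefl mult_eq_0_iff)
    moreover have "(a * a + b * b) * b' = b * (a * a' + b * b') + a * (a * b' - b * a')" by algebra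
    then have "(a * a + b * b) * b' = 0" unfolding e1 e2 by (simp only: mult_zero_right add_0_left)
    then have "b' = 0" using ab by (metis less_irrefl mult_eq_0_iff)
    ultimately have "F 1 t = 0" by (simp add: vec2_eq_iff a'_def b'_def)
    then show False using regular[of t] t t0 by auto
  qed
  then show ?thesis using 1 2 by linarith
qed

lemma image_eq_spiral:
  assumes cong: "splits_congruent (path_image \<gamma>)" and perf: "splits_perfect (path_image \<gamma>)"
    and alg: "algebraic_in_polar (path_image \<gamma>)"
  shows "path_image \<gamma> = fermat_spiral"
proof -
  have q: "q \<rho> = p \<rho> + pi" if "\<rho> \<in> {0..R}" for \<rho> using q_eq_p_plus_pi[OF cong that] .
  have tb: "path_image \<gamma> = two_branches p (\<lambda>\<rho>. p \<rho> + pi)"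
    unfolding path_image_two_branches two_branches_def using q by simp
  have "sector p q = half_sector p"
    unfolding sector_def using q by force
  moreover obtain A B where AB: "splits_disk_into (path_image \<gamma>) A B" "perfect A" "perfect B"
    using perf unfolding splits_perfect_def by blast
  moreover have "sector p q \<in> {A, B}" using AB(1) splits unfolding splits_disk_into_def by auto
  ultimately have "perfect (half_sector p)" by auto
  define k where "k = (\<lambda>\<tau>. p (sqrt \<tau> / pi))"
  have M: "integral {0..pi} (\<lambda>\<tau>. arccos (cos (\<psi> - 2 * k \<tau>))) = pi\<^sup>2 / 2" for \<psi>
    unfolding k_def by (rule perfect_half_sector_overlap[OF cont_pq(1) \<open>perfect (half_sector p)\<close>])
  have kc: "continuous_on {0..pi} k" unfolding k_def by (rule continuous_on_radius_of_area[OF cont_pq(1)])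
  have rad: "sqrt \<tau> / pi \<in> {0..R}" if "\<tau> \<in> {0..pi}" for \<tau>
    using radius_of_area[of \<tau>] that by (cases "\<tau> = 0") auto
  have km: "strict_mono_on {0..pi} k"
  proof (rule strict_mono_onI)
    fix r s :: real assume rs: "r \<in> {0..pi}" "s \<in> {0..pi}" "r < s"
    then have "sqrt r / pi < sqrt s / pi" by (simp add: divide_strict_right_mono)
    then show "k r < k s" unfolding k_def using strict_mono_onD[OF p_mono rad[OF rs(1)] rad[OF rs(2)]] by blast
  qed
  have k0: "k 0 = 0" by (simp add: k_def pq_vals)
  have "sqrt pi / pi = R" by (simp add: field_simps)
  then have kpi: "k pi = pi" by (simp only: k_def pq_vals)
  have kz: "k (z t) = \<theta> t" if "t \<in> {t0..1}" for t
  proof -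
    have "sqrt (z t) / pi = n t" by (simp add: z_def real_sqrt_mult n_def)
    then show ?thesis using p_n[OF that] by (simp add: k_def)
  qed
  have z_range: "z t \<in> {0..pi}" if "t \<in> {t0..1}" for t
  proof -
    have "n t \<in> {0..R}" using n_image(1) that by blast
    then show ?thesis using pi_square_radius[of "n t"] by (simp add: z_def)
  qed
  obtain T where T: "T \<noteq> 0" "\<And>x r. 0 < r \<Longrightarrow> 0 \<le> x \<Longrightarrow> x \<le> pi \<Longrightarrow> polar (x, r) \<in> path_image \<gamma> \<Longrightarrow>
      poly2 T (pi\<^sup>2 * r\<^sup>2 - x) (pi\<^sup>2 * r\<^sup>2 + x) = 0"
    using algebraic_in_polar_relation[OF alg] by blast
  interpret algebraic_arc t0 1 "\<lambda>t. z t + \<theta> t" "\<lambda>t. z t - \<theta> t" T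
  proof
    show "t0 < 1" by (rule t0)
    show "c_diff m {t0<..<1} (\<lambda>t. z t + \<theta> t)" "c_diff m {t0<..<1} (\<lambda>t. z t - \<theta> t)" for m
      by (intro c_diff_add c_diff_diff smooth)+
    show "\<exists>d>0. ((\<lambda>t. z t + \<theta> t) has_real_derivative d) (at t)" if "t \<in> {t0<..<1}" for t
      using u_deriv_pos[OF that] DERIV_add[OF z_deriv[OF that] \<theta>_deriv[OF that]] by blast
    show "T \<noteq> 0" by (rule T)
    show "poly2 T (z t - \<theta> t) (z t + \<theta> t) = 0" if t: "t \<in> {t0<..<1}" for t
    proof -
      have "\<gamma> t = polar (\<theta> t, n t)" using right[of t] t by (auto simp: n_def)
      moreover have "\<gamma> t \<in> path_image \<gamma>" using t t0 by (auto simp: path_image_def)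
      ultimately have "polar (\<theta> t, n t) \<in> path_image \<gamma>" by simp
      then show ?thesis unfolding z_def using open_half_range[OF t] by (intro T(2)) auto
    qed
  qed
  \<comment> \<open>Before this parameter the translate by (pi/2, pi/2) still lies on the half after
    \<open>t0\<close>.\<close>
  have "\<exists>t. t0 < t \<and> t < 1 \<and> \<theta> t = pi / 2"
    using cont_halves(3) t0 \<theta>_vals by (intro IVT_strict) auto
  then obtain t1 where t1: "t0 < t1" "t1 < 1" "\<theta> t1 = pi / 2" by blast
  have "\<exists>c. \<forall>t\<in>{t0<..<1}. z t - \<theta> t = c"
  \<comment> \<open>The two increments pi/2 of \<open>z\<close> and \<open>\<theta>\<close> add up
    to the shift pi of \<open>u\<close> and cancel in \<open>w\<close>.\<close>
  proof (rule w_constant[of pi "{t0<..<t1}"])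
    show "pi \<noteq> 0" "open {t0<..<t1}" "{t0<..<t1} \<noteq> {}" "{t0<..<t1} \<subseteq> {t0<..<1}" using t1 by auto
    fix t assume t: "t \<in> {t0<..<t1}"
    then have tI: "t \<in> {t0<..<1}" "t \<in> {t0..1}" using t1 by auto
    have a: "0 < \<theta> t" "\<theta> t < pi / 2"
      using open_half_range[OF tI(1)] strict_mono_onD[OF \<theta>_mono(1), of t t1] t t1 by auto
    have "\<exists>t'. t0 < t' \<and> t' < 1 \<and> \<theta> t' = \<theta> t + pi / 2"
      using cont_halves(3) t0 \<theta>_vals a by (intro IVT_strict) auto
    then obtain t' where t': "t0 < t'" "t' < 1" "\<theta> t' = \<theta> t + pi / 2" by blast
    then have tI': "t' \<in> {t0..1}" by simp
    have "z t' = z t + pi / 2"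
    proof (rule quarter_period_shift[OF kc km k0 kpi M a z_range[OF tI(2)] z_range[OF tI']])
      show "k (z t) = \<theta> t" by (rule kz[OF tI(2)])
      show "k (z t') = \<theta> t + pi / 2" using kz[OF tI'] t'(3) by simp
    qed
    then show "\<exists>t'\<in>{t0<..<1}. z t' - \<theta> t' = z t - \<theta> t \<and> z t' + \<theta> t' = z t + \<theta> t + pi"
      using t' by (intro bexI[of _ t']) auto
  qed
  then obtain c where c: "\<And>t. t \<in> {t0<..<1} \<Longrightarrow> z t - \<theta> t = c" by blast
  \<comment> \<open>The constant is found on the open arc; its value 0 can be read off only at the
    centre, reached by continuity.\<close>
  have cl: "closure {t0<..<1} = {t0..1}" using t0 by (simp add: closure_greaterThanLessThan)
  have cont_w: "continuous_on (closure {t0<..<1}) (\<lambda>t. z t - \<theta> t)"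
    unfolding cl z_def by (intro continuous_intros cont_halves)
  have w: "z t - \<theta> t = c" if "t \<in> {t0..1}" for t
    using continuous_constant_on_closure[OF cont_w c] that cl by blast
  moreover have "z t0 - \<theta> t0 = 0" by (simp add: z_def n_vals \<theta>_vals)
  ultimately have zt: "z t = \<theta> t" if "t \<in> {t0..1}" for t using that w[of t0] w[of t] t0 by auto
  have "p \<rho> = spiral_angle 0 \<rho>" if \<rho>: "\<rho> \<in> {0..R}" for \<rho>
  proof -
    obtain t where t: "t \<in> {t0..1}" "n t = \<rho>" using obtain_right[OF \<rho>] by blast
    then show ?thesis using p_n[OF t(1)] zt[OF t(1)] by (simp add: z_def spiral_angle_def)
  qed
  then show ?thesis unfolding tb fermat_spiral_two_branches two_branches_def by simp
qed

end

section \<open>A continuous angle through the centre, and the conclusion\<close>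

text \<open>Dividing by \<open>t - t0\<close> removes the zero of the curve at the centre, and
  regularity makes the filled-in value nonzero, so that a continuous argument exists.\<close>

lemma continuous_on_slope:
  fixes f :: "real \<Rightarrow> real"
  assumes f: "continuous_on S f" and d: "(f has_real_derivative D) (at x0 within S)"
  shows "continuous_on S (\<lambda>t. if t = x0 then D else (f t - f x0) / (t - x0))" (is "continuous_on S ?g")
  unfolding continuous_on_def
proof
  fix x assume x: "x \<in> S"
  show "(?g \<longlongrightarrow> ?g x) (at x within S)"
  proof (cases "x = x0")
    case True
    have "((\<lambda>t. (f t - f x0) / (t - x0)) \<longlongrightarrow> D) (at x0 within S)"
      using d by (simp add: has_field_derivative_iff)
    moreover have "\<forall>\<^sub>F t in at x0 within S. (f t - f x0) / (t - x0) = ?g t"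
      by (simp add: eventually_at_filter)
    ultimately show ?thesis using True by (simp add: tendsto_cong)
  next
    case False
    have "(f \<longlongrightarrow> f x) (at x within S)" using f x by (simp add: continuous_on_def)
    then have "((\<lambda>t. (f t - f x0) / (t - x0)) \<longlongrightarrow> (f x - f x0) / (x - x0)) (at x within S)"
      using False by (intro tendsto_intros) auto
    moreover have "\<forall>\<^sub>F t in at x within S. (f t - f x0) / (t - x0) = ?g t"
      using tendsto_imp_eventually_ne[OF tendsto_ident_at False] by eventually_elim simp
    ultimately show ?thesis using False by (simp add: tendsto_cong)
  qed
qed

text \<open>The interval is contractible, so a nowhere vanishing complex function on it has a
  continuous logarithm; its imaginary part is the angle.\<close>

lemma polar_lift:
  fixes a b :: "real \<Rightarrow> real"
  assumes "continuous_on {0..1} a" "continuous_on {0..1} b" "\<And>t. t \<in> {0..1} \<Longrightarrow> a t \<noteq> 0 \<or> b t \<noteq> 0"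
  shows "\<exists>\<theta> r. continuous_on {0..1} \<theta> \<and> (\<forall>t\<in>{0..1}. r t > 0 \<and> a t = r t * cos (\<theta> t) \<and> b t = r t * sin (\<theta> t))"
proof -
  have "continuous_on {0..1} (\<lambda>t. Complex (a t) (b t))"
    unfolding Complex_eq by (intro continuous_intros assms)
  moreover have "contractible {0..1::real}" by (intro convex_imp_contractible) simp
  moreover have "Complex (a t) (b t) \<noteq> 0" if "t \<in> {0..1}" for t using assms(3)[OF that] by (auto simp: complex_eq_iff)
  ultimately obtain g where g: "continuous_on {0..1} g" "\<And>t. t \<in> {0..1} \<Longrightarrow> Complex (a t) (b t) = exp (g t)"
    using continuous_logarithm_on_contractible[of "{0..1}" "\<lambda>t. Complex (a t) (b t)"] by blast
  have "a t = exp (Re (g t)) * cos (Im (g t)) \<and> b t = exp (Re (g t)) * sin (Im (g t))" if "t \<in> {0..1}" for t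
    using g(2)[OF that] by (metis Re_exp Im_exp complex.sel)
  moreover have "continuous_on {0..1} (\<lambda>t. Im (g t))" by (intro continuous_intros g(1))
  ultimately show ?thesis by (intro exI[of _ "\<lambda>t. Im (g t)"] exI[of _ "\<lambda>t. exp (Re (g t))"]) simp
qed

lemma six_conditions_imp_congruent:
  assumes disk: "\<beta> \<subseteq> disk" and cong: "splits_congruent \<beta>" and circ: "crosses_circles_twice \<beta>"
    and rad: "crosses_radii_once \<beta>" and perf: "splits_perfect \<beta>" and smooth: "smooth_curve \<beta>"
    and alg: "algebraic_in_polar \<beta>"
  shows "congruent_sets \<beta> fermat_spiral"
proof -
  obtain \<gamma> F where \<gamma>: "arc \<gamma>" "path_image \<gamma> = \<beta>" "F 0 = \<gamma>"
    and dF: "\<And>k t. t \<in> {0..1} \<Longrightarrow> (F k has_vector_derivative F (Suc k) t) (at t within {0..1})"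
    and reg: "\<And>t. t \<in> {0..1} \<Longrightarrow> vector_derivative \<gamma> (at t within {0..1}) \<noteq> 0"
    using smooth unfolding smooth_curve_def infinitely_differentiable_on_def by blast
  have regular: "F 1 t \<noteq> 0" if t: "t \<in> {0..1}" for t
    using reg[OF t] smooth_vector_derivative[of \<gamma> "F 1" t] dF[of _ 0] \<gamma>(3) t by auto
  have inj: "inj_on \<gamma> {0..1}" and c\<gamma>: "continuous_on {0..1} \<gamma>" using \<gamma>(1) by (auto simp: arc_def path_def)
  have \<beta>: "\<beta> = \<gamma> ` {0..1}" using \<gamma>(2) by (simp add: path_image_def)
  define n where "n t = norm (\<gamma> t)" for t
  have cn: "continuous_on {0..1} n" unfolding n_def by (intro continuous_intros c\<gamma>)
  have "\<exists>t0. 0 < t0 \<and> t0 < 1 \<and> n t0 = 0 \<and> n 0 = R \<and> n 1 = R \<and> inj_on n {0..t0} \<and> inj_on n {t0..1}"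
  proof (rule takes_values_twice_shape[OF cn R_pos])
    fix t :: real assume "t \<in> {0..1}"
    then have "\<gamma> t \<in> disk" using \<beta> disk by blast
    then show "0 \<le> n t \<and> n t \<le> R" by (simp add: n_def disk_def)
  next
    fix \<rho> assume \<rho>: "0 < \<rho>" "\<rho> \<le> R"
    have "\<beta> \<inter> sphere 0 \<rho> = \<gamma> ` {t\<in>{0..1}. n t = \<rho>}" unfolding \<beta> n_def by auto
    moreover have "card (\<gamma> ` {t\<in>{0..1}. n t = \<rho>}) = card {t\<in>{0..1}. n t = \<rho>}"
      by (rule card_image[OF inj_on_subset[OF inj]]) auto
    moreover have "card (\<beta> \<inter> sphere 0 \<rho>) = 2" using circ \<rho> unfolding crosses_circles_twice_def by blast
    ultimately show "card {t\<in>{0..1}. n t = \<rho>} = 2" by (simp only:)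
  next
    fix s t :: real assume "s \<in> {0..1}" "t \<in> {0..1}" "n s = 0" "n t = 0"
    then show "s = t" using inj_onD[OF inj, of s t] by (simp add: n_def)
  qed
  then obtain t0 where t0: "0 < t0" "t0 < 1" "n t0 = 0" "n 0 = R" "n 1 = R" "inj_on n {0..t0}" "inj_on n {t0..1}" by blast
  have \<gamma>t0: "\<gamma> t0 = 0" using t0(3) by (simp add: n_def)
  have ne: "\<gamma> t \<noteq> 0" if "t \<in> {0..1}" "t \<noteq> t0" for t using inj_onD[OF inj, of t t0] that \<gamma>t0 t0 by auto
  define d where "d i t = (if t = t0 then F 1 t0 $ i else (\<gamma> t $ i - \<gamma> t0 $ i) / (t - t0))" for i t
  have cd: "continuous_on {0..1} (d i)" for i
    unfolding d_def
  proof (rule continuous_on_slope)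
    show "continuous_on {0..1} (\<lambda>t. \<gamma> t $ i)" by (rule bounded_linear.continuous_on[OF bounded_linear_vec_nth c\<gamma>])
    have "(\<gamma> has_vector_derivative F 1 t0) (at t0 within {0..1})" using dF[of t0 0] \<gamma>(3) t0 by simp
    then have "((\<lambda>t. \<gamma> t $ i) has_vector_derivative F 1 t0 $ i) (at t0 within {0..1})"
      by (rule bounded_linear.has_vector_derivative[OF bounded_linear_vec_nth])
    then show "((\<lambda>t. \<gamma> t $ i) has_real_derivative F 1 t0 $ i) (at t0 within {0..1})"
      by (simp add: has_real_derivative_iff_has_vector_derivative)
  qed
  have dne: "d 1 t \<noteq> 0 \<or> d 2 t \<noteq> 0" if "t \<in> {0..1}" for t
  proof (cases "t = t0")
    case True
    then show ?thesis using regular[OF that] by (auto simp: d_def vec2_eq_iff)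
  next
    case False
    then show ?thesis using ne[OF that False] \<gamma>t0 by (auto simp: d_def vec2_eq_iff)
  qed
  obtain \<theta>0 r where \<theta>0: "continuous_on {0..1} \<theta>0"
    and dr: "\<And>t. t \<in> {0..1} \<Longrightarrow> r t > 0 \<and> d 1 t = r t * cos (\<theta>0 t) \<and> d 2 t = r t * sin (\<theta>0 t)"
    using polar_lift[OF cd cd dne] by blast
  have \<gamma>pol: "\<gamma> t = polar (\<theta>0 t, (t - t0) * r t)" if t: "t \<in> {0..1}" for t
  proof (cases "t = t0")
    case True then show ?thesis using \<gamma>t0 by simp
  next
    case False
    then have "\<gamma> t $ i = (t - t0) * d i t" for i using \<gamma>t0 by (simp add: d_def)
    then show ?thesis using dr[OF t] by (simp add: vec2_eq_iff)
  qed
  have nr: "n t = \<bar>t - t0\<bar> * r t" if t: "t \<in> {0..1}" for t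
    using \<gamma>pol[OF t] dr[OF t] by (simp add: n_def abs_mult)
  have right: "\<gamma> t = polar (\<theta>0 t, n t)" if t: "t \<in> {t0..1}" for t
    using \<gamma>pol[of t] nr[of t] t t0 by simp
  \<comment> \<open>Before \<open>t0\<close> the factor \<open>t - t0\<close> is negative; making
    the radius positive costs a half turn.\<close>
  have left: "\<gamma> t = polar (\<theta>0 t + pi, n t)" if t: "t \<in> {0..t0}" for t
  proof -
    have "n t = - ((t - t0) * r t)" using nr[of t] t t0(1,2) by (simp add: algebra_simps)
    then have "polar (\<theta>0 t + pi, n t) = polar (\<theta>0 t, (t - t0) * r t)" by (simp only: polar_plus_pi polar_minus minus_minus)
    then show ?thesis using \<gamma>pol[of t] t t0 by simp
  qed
  define \<alpha> where "\<alpha> = \<theta>0 t0"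
  define \<theta>1 where "\<theta>1 t = \<theta>0 t - \<alpha>" for t
  have D: "\<gamma> t = polar (branch_angle t0 \<theta>1 t + \<alpha>, n t)" if "t \<in> {0..1}" for t
    using right[of t] left[of t] that by (auto simp: branch_angle_def \<theta>1_def algebra_simps)
  have npos: "n t > 0" "n t \<le> R" if "t \<in> {0..1} - {t0}" for t
  proof -
    show "n t > 0" using ne[of t] that by (simp add: n_def)
    have "\<gamma> t \<in> disk" using that \<beta> disk by blast
    then show "n t \<le> R" by (simp add: n_def disk_def)
  qed
  \<comment> \<open>Radial crossings in polar form: uniqueness of the crossing will give injectivity
    of the branch angle modulo \<open>2 * pi\<close>, existence its surjectivity.\<close>
  have ray: "\<exists>y. {polar (x, r) |r. 0 < r \<and> r \<le> R} \<inter> \<beta> = {y}" for x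
  proof -
    have "polar (x, R) \<in> sphere 0 R" by simp
    then have "card (\<beta> \<inter> closed_segment 0 (polar (x, R)) - {0}) = 1" using rad unfolding crosses_radii_once_def by blast
    moreover have "\<beta> \<inter> closed_segment 0 (polar (x, R)) - {0} = {polar (x, r) |r. 0 < r \<and> r \<le> R} \<inter> \<beta>"
      using radius_points[OF R_pos, of x] by blast
    ultimately have "card ({polar (x, r) |r. 0 < r \<and> r \<le> R} \<inter> \<beta>) = 1" by simp
    then show ?thesis by (rule card_1_singletonE) blast
  qed
  have "\<exists>\<sigma>. (\<sigma> = 1 \<or> \<sigma> = -1) \<and> \<sigma> * \<theta>1 1 = pi \<and> \<sigma> * \<theta>1 0 = pi \<and>
     strict_mono_on {t0..1} (\<lambda>t. \<sigma> * \<theta>1 t) \<and> strict_mono_on {0..t0} (\<lambda>t. - (\<sigma> * \<theta>1 t))"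
  proof (rule branch_angle_shape_oriented)
    show "continuous_on {0..1} \<theta>1" unfolding \<theta>1_def by (intro continuous_intros \<theta>0)
    show "0 < t0" "t0 < 1" "\<theta>1 t0 = 0" using t0 by (auto simp: \<theta>1_def \<alpha>_def)
  next
    fix s t and k :: int
    assume s: "s \<in> {0..1} - {t0}" and t: "t \<in> {0..1} - {t0}"
      and eq: "branch_angle t0 \<theta>1 s = branch_angle t0 \<theta>1 t + 2 * pi * k"
    let ?x = "branch_angle t0 \<theta>1 t + \<alpha>"
    have "\<gamma> s = polar (?x + 2 * pi * k, n s)" using D[of s] s eq by (simp add: algebra_simps)
    also have "\<dots> = polar (?x, n s)" using polar_eq_iff[OF npos(1)[OF s]] by blast
    finally have "\<gamma> s \<in> {polar (?x, r) |r. 0 < r \<and> r \<le> R} \<inter> \<beta>" using npos[OF s] s \<beta> by blast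
    moreover have "\<gamma> t = polar (?x, n t)" using D[of t] t by simp
    then have "\<gamma> t \<in> {polar (?x, r) |r. 0 < r \<and> r \<le> R} \<inter> \<beta>" using npos[OF t] t \<beta> by blast
    ultimately have "\<gamma> s = \<gamma> t" using ray[of ?x] by (metis singletonD)
    then show "s = t" using inj_onD[OF inj, of s t] s t by simp
  next
    fix x
    obtain y where "{polar (x + \<alpha>, r) |r. 0 < r \<and> r \<le> R} \<inter> \<beta> = {y}" using ray by blast
    then have "y \<in> {polar (x + \<alpha>, r) |r. 0 < r \<and> r \<le> R} \<inter> \<beta>" by blast
    then obtain r t where r: "0 < r" "y = polar (x + \<alpha>, r)" and t: "t \<in> {0..1}" "y = \<gamma> t" using \<beta> by blast
    have "norm y = r" using r by simp
    then have "t \<noteq> t0" using t(2) \<gamma>t0 r(1) by auto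
    then have tI: "t \<in> {0..1} - {t0}" using t by simp
    have "polar (branch_angle t0 \<theta>1 t + \<alpha>, n t) = polar (x + \<alpha>, r)" using D[OF t(1)] t(2) r(2) by simp
    then obtain k :: int where "branch_angle t0 \<theta>1 t + \<alpha> = x + \<alpha> + 2 * pi * k"
      using polar_eq_pos_iff[OF npos(1)[OF tI] r(1)] by blast
    then have "branch_angle t0 \<theta>1 t = x + 2 * pi * k" by simp
    then show "\<exists>t\<in>{0..1} - {t0}. \<exists>k::int. branch_angle t0 \<theta>1 t = x + 2 * pi * k" using tI by blast
  qed
  then obtain \<sigma> where \<sigma>: "\<sigma> = 1 \<or> \<sigma> = -1" "\<sigma> * \<theta>1 1 = pi" "\<sigma> * \<theta>1 0 = pi"
     "strict_mono_on {t0..1} (\<lambda>t. \<sigma> * \<theta>1 t)" "strict_mono_on {0..t0} (\<lambda>t. - (\<sigma> * \<theta>1 t))" by blast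
  \<comment> \<open>The isometry sends angle x to \<sigma> (x - \<alpha>): it turns the tangent at
    the centre to angle 0 and orients the curve so that angles grow away from the centre.\<close>
  obtain f where f: "isometry f" "f 0 = 0" and fp: "\<And>\<theta> r. f (polar (\<theta>, r)) = polar (- \<sigma> * \<alpha> + \<sigma> * \<theta>, r)"
    using polar_map_isometry[OF \<sigma>(1), of "- \<sigma> * \<alpha>"] by blast
  have lin: "bounded_linear f"
    using isometry_orthogonal[OF f] orthogonal_transformation_linear linear_conv_bounded_linear by blast
  have fn: "norm (f x) = norm x" for x by (rule isometry_norm[OF f])
  interpret normalized_curve "f \<circ> \<gamma>" "\<lambda>k. f \<circ> F k" t0 "\<lambda>t. \<sigma> * \<theta>1 t"
  proof
    show "0 < t0" "t0 < 1" using t0 by auto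
    show "f \<circ> F 0 = f \<circ> \<gamma>" using \<gamma>(3) by simp
    show "((f \<circ> F k) has_vector_derivative (f \<circ> F (Suc k)) t) (at t within {0..1})" if "t \<in> {0..1}" for k t
      using bounded_linear.has_vector_derivative[OF lin dF[OF that]] by (simp add: o_def)
    show "(f \<circ> F 1) t \<noteq> 0" if "t \<in> {0..1}" for t
      using regular[OF that] fn[of "F 1 t"] by (metis comp_apply norm_eq_zero)
    show "inj_on (\<lambda>t. norm ((f \<circ> \<gamma>) t)) {0..t0}" "inj_on (\<lambda>t. norm ((f \<circ> \<gamma>) t)) {t0..1}"
      using t0 unfolding o_def fn n_def by auto
    show "norm ((f \<circ> \<gamma>) 0) = R" "norm ((f \<circ> \<gamma>) 1) = R" using t0(4,5) unfolding o_def fn n_def by auto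
    show "(f \<circ> \<gamma>) t0 = 0" using \<gamma>t0 f by simp
    show "continuous_on {0..1} (\<lambda>t. \<sigma> * \<theta>1 t)" unfolding \<theta>1_def by (intro continuous_intros \<theta>0)
    show "\<sigma> * \<theta>1 t0 = 0" by (simp add: \<theta>1_def \<alpha>_def)
    show "\<sigma> * \<theta>1 0 = pi" "\<sigma> * \<theta>1 1 = pi" by (rule \<sigma>)+
    show "strict_mono_on {t0..1} (\<lambda>t. \<sigma> * \<theta>1 t)" "strict_mono_on {0..t0} (\<lambda>t. - (\<sigma> * \<theta>1 t))" by (rule \<sigma>)+
    show "(f \<circ> \<gamma>) t = polar (\<sigma> * \<theta>1 t, norm ((f \<circ> \<gamma>) t))" if "t \<in> {t0..1}" for t
    proof -
      have "f (\<gamma> t) = polar (- \<sigma> * \<alpha> + \<sigma> * \<theta>0 t, n t)" using right[OF that] fp by metis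
      then show ?thesis by (simp add: fn n_def \<theta>1_def algebra_simps)
    qed
    show "(f \<circ> \<gamma>) t = polar (\<sigma> * \<theta>1 t + pi, norm ((f \<circ> \<gamma>) t))" if "t \<in> {0..t0}" for t
    proof -
      have "f (\<gamma> t) = polar (- \<sigma> * \<alpha> + \<sigma> * (\<theta>0 t + pi), n t)" using left[OF that] fp by metis
      also have "- \<sigma> * \<alpha> + \<sigma> * (\<theta>0 t + pi) = \<sigma> * \<theta>1 t + \<sigma> * pi" by (simp add: \<theta>1_def algebra_simps)
      \<comment> \<open>pi and -pi differ by a full turn, so the half turn survives a
        reflection.\<close>
      also have "polar (\<sigma> * \<theta>1 t + \<sigma> * pi, n t) = polar (\<sigma> * \<theta>1 t + pi, n t)"
        using \<sigma>(1) by (auto simp: vec2_eq_iff)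
      finally show ?thesis by (simp add: fn n_def)
    qed
  qed
  have img: "path_image (f \<circ> \<gamma>) = f ` \<beta>" using \<gamma>(2) by (simp add: path_image_compose)
  have "f ` \<beta> = fermat_spiral"
    using image_eq_spiral splits_congruent_image[OF f cong] splits_perfect_image[OF f perf]
      algebraic_in_polar_image[OF f alg] unfolding img by blast
  then show ?thesis using f(1) unfolding congruent_sets_def by blast
qed

theorem theorem1:
  fixes \<beta> :: "(real^2) set"
  assumes "is_curve \<beta>" and "\<beta> \<subseteq> disk"
  shows "(splits_congruent \<beta> \<and> crosses_circles_twice \<beta> \<and> crosses_radii_once \<beta> \<and>
          splits_perfect \<beta> \<and> smooth_curve \<beta> \<and> algebraic_in_polar \<beta>)
         \<longleftrightarrow> congruent_sets \<beta> fermat_spiral"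
  using six_conditions_imp_congruent[OF assms(2)] congruent_to_fermat_spiral_conditions[OF assms(2)] by blast

end
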